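(* Let $n\ge1$. Let $\mathcal{A}$ and $\mathcal{B}$ be two classes of objects in an abelian category $\mathcal{C}$ with enough injectives, such that $\mathrm{Ext}^1_{\mathcal{C}}(\mathcal{A},\mathcal{B})=0$ and $\mathcal{B}$ is closed under extensions and contains the injective objects of $\mathcal{C}$. If $(\mathrm{Ch}_{\mathrm{acy}}(\mathcal{A};\widetilde{\mathcal{B}}),\widetilde{\mathcal{B}})$ or $(\widetilde{\mathcal{A}},\mathrm{Ch}_{\mathrm{acy}}(\widetilde{\mathcal{A}};\mathcal{B}))$ is a left $n$-cotorsion pair in $\mathrm{Ch}(\mathcal{C})$, then $(\mathcal{A},\mathcal{B})$ is a left $n$-cotorsion pair in $\mathcal{C}$.
   Context: $\mathrm{Ch}(\mathcal{C})$ is the (abelian) category of unbounded chain complexes in $\mathcal{C}$, with differentials $\partial_m^X:X_m\to X_{m-1}$ and cycles $Z_m(X)=\mathrm{Ker}(\partial_m^X)$. For a class $\mathcal{X}$ of objects of $\mathcal{C}$: $\mathrm{Ch}(\mathcal{X})$ is the class of complexes $X$ with $X_m\in\mathcal{X}$ for all $m\in\mathbb{Z}$; $\widetilde{\mathcal{X}}$ is the class of exact complexes $X$ with $Z_m(X)\in\mathcal{X}$ for all $m$. $\mathcal{H}om(X,Y)$ is the complex of abelian groups with $\mathcal{H}om(X,Y)_m=\prod_{k\in\mathbb{Z}}\mathrm{Hom}_{\mathcal{C}}(X_k,Y_{m+k})$ and differential $f\mapsto\partial^Y\circ f-(-1)^mf\circ\partial^X$. $\mathrm{Ch}_{\mathrm{acy}}(\mathcal{A};\widetilde{\mathcal{B}})$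 is the class of $X\in\mathrm{Ch}(\mathcal{A})$ such that $\mathcal{H}om(X,B)$ is exact for every $B\in\widetilde{\mathcal{B}}$; $\mathrm{Ch}_{\mathrm{acy}}(\widetilde{\mathcal{A}};\mathcal{B})$ is the class of $Y\in\mathrm{Ch}(\mathcal{B})$ such that $\mathcal{H}om(A,Y)$ is exact for every $A\in\widetilde{\mathcal{A}}$. In any abelian category $\mathcal{E}$, $\mathcal{Y}^\wedge_k$ is the class of objects $C$ with an exact sequence $0\to Y_k\to\cdots\to Y_0\to C\to0$ of length at most $k$ with terms in $\mathcal{Y}$; $(\mathcal{X},\mathcal{Y})$ is a left $n$-cotorsion pair in $\mathcal{E}$ if $\mathcal{X}$ is closed under direct summands, $\mathrm{Ext}^i_{\mathcal{E}}(X,Y)=0$ for all $X\in\mathcal{X}$, $Y\in\mathcal{Y}$, $1\le i\le n$, and every $C\in\mathcal{E}$ fits in a short exact sequence $0\to K\to X\to C\to0$ with $X\in\mathcal{X}$, $K\in\mathcal{Y}^\wedge_{n-1}$. *)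

theory Defs
  imports "HOL-Algebra.Product_Groups"
begin

section \<open>Abelian categories\<close>

text \<open>Each arrow has a unique domain and codomain, so hom-sets are disjoint and addition of
  arrows needs no object arguments. As in HOL-Algebra, the operations are constrained only on
  the carriers \<open>Obj C\<close> and \<open>Arr C\<close>. A class of objects is a subset of \<open>Obj C\<close>.\<close>

record ('o, 'm) cat =
  Obj :: "'o set"
  Arr :: "'m set"
  Dom :: "'m \<Rightarrow> 'o"
  Cod :: "'m \<Rightarrow> 'o"
  Ide :: "'o \<Rightarrow> 'm"
  Comp :: "'m \<Rightarrow> 'm \<Rightarrow> 'm" (infixl "\<cdot>\<index>" 70)
  Add :: "'m \<Rightarrow> 'm \<Rightarrow> 'm"
  Zero :: "'o \<Rightarrow> 'o \<Rightarrow> 'm"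

definition Hom :: "('o, 'm) cat \<Rightarrow> 'o \<Rightarrow> 'o \<Rightarrow> 'm set" where
  "Hom C a b = {f \<in> Arr C. Dom C f = a \<and> Cod C f = b}"

definition hom_group :: "('o, 'm) cat \<Rightarrow> 'o \<Rightarrow> 'o \<Rightarrow> 'm monoid" where
  "hom_group C a b = \<lparr>carrier = Hom C a b, monoid.mult = Add C, one = Zero C a b\<rparr>"

locale category =
  fixes C :: "('o, 'm) cat" (structure)
  assumes dom_obj: "f \<in> Arr C \<Longrightarrow> Dom C f \<in> Obj C"
    and cod_obj: "f \<in> Arr C \<Longrightarrow> Cod C f \<in> Obj C"
    and ide_hom: "a \<in> Obj C \<Longrightarrow> Ide C a \<in> Hom C a a"
    and comp_hom: "\<lbrakk>f \<in> Hom C a b; g \<in> Hom C b c\<rbrakk> \<Longrightarrow> g \<cdot> f \<in> Hom C a c"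
    and comp_assoc:
      "\<lbrakk>f \<in> Hom C a b; g \<in> Hom C b c; h \<in> Hom C c d\<rbrakk> \<Longrightarrow> (h \<cdot> g) \<cdot> f = h \<cdot> (g \<cdot> f)"
    and comp_ide_left: "f \<in> Hom C a b \<Longrightarrow> Ide C b \<cdot> f = f"
    and comp_ide_right: "f \<in> Hom C a b \<Longrightarrow> f \<cdot> Ide C a = f"

locale preadditive_category = category +
  assumes hom_comm_group: "\<lbrakk>a \<in> Obj C; b \<in> Obj C\<rbrakk> \<Longrightarrow> comm_group (hom_group C a b)"
    and comp_add_left:
      "\<lbrakk>f \<in> Hom C a b; g \<in> Hom C b c; h \<in> Hom C b c\<rbrakk> \<Longrightarrow> Add C g h \<cdot> f = Add C (g \<cdot> f) (h \<cdot> f)"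
    and comp_add_right:
      "\<lbrakk>f \<in> Hom C a b; g \<in> Hom C a b; h \<in> Hom C b c\<rbrakk> \<Longrightarrow> h \<cdot> Add C f g = Add C (h \<cdot> f) (h \<cdot> g)"

definition zero_object :: "('o, 'm) cat \<Rightarrow> 'o \<Rightarrow> bool" where
  "zero_object C z \<longleftrightarrow> z \<in> Obj C \<and>
     (\<forall>a\<in>Obj C. is_singleton (Hom C a z) \<and> is_singleton (Hom C z a))"

definition biproduct ::
    "('o, 'm) cat \<Rightarrow> 'o \<Rightarrow> 'o \<Rightarrow> 'o \<Rightarrow> 'm \<Rightarrow> 'm \<Rightarrow> 'm \<Rightarrow> 'm \<Rightarrow> bool" where
  "biproduct C s a b i j p q \<longleftrightarrow>
     i \<in> Hom C a s \<and> j \<in> Hom C b s \<and> p \<in> Hom C s a \<and> q \<in> Hom C s b \<and>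
     p \<cdot>\<^bsub>C\<^esub> i = Ide C a \<and> q \<cdot>\<^bsub>C\<^esub> j = Ide C b \<and>
     p \<cdot>\<^bsub>C\<^esub> j = Zero C b a \<and> q \<cdot>\<^bsub>C\<^esub> i = Zero C a b \<and>
     Add C (i \<cdot>\<^bsub>C\<^esub> p) (j \<cdot>\<^bsub>C\<^esub> q) = Ide C s"

definition mono_arr :: "('o, 'm) cat \<Rightarrow> 'm \<Rightarrow> bool" where
  "mono_arr C f \<longleftrightarrow> f \<in> Arr C \<and>
     (\<forall>a. \<forall>g\<in>Hom C a (Dom C f). \<forall>h\<in>Hom C a (Dom C f). f \<cdot>\<^bsub>C\<^esub> g = f \<cdot>\<^bsub>C\<^esub> h \<longrightarrow> g = h)"

definition epi_arr :: "('o, 'm) cat \<Rightarrow> 'm \<Rightarrow> bool" where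
  "epi_arr C f \<longleftrightarrow> f \<in> Arr C \<and>
     (\<forall>a. \<forall>g\<in>Hom C (Cod C f) a. \<forall>h\<in>Hom C (Cod C f) a. g \<cdot>\<^bsub>C\<^esub> f = h \<cdot>\<^bsub>C\<^esub> f \<longrightarrow> g = h)"

definition iso_objs :: "('o, 'm) cat \<Rightarrow> 'o \<Rightarrow> 'o \<Rightarrow> bool" where
  "iso_objs C a b \<longleftrightarrow>
     (\<exists>f\<in>Hom C a b. \<exists>g\<in>Hom C b a. g \<cdot>\<^bsub>C\<^esub> f = Ide C a \<and> f \<cdot>\<^bsub>C\<^esub> g = Ide C b)"

text \<open>\<open>is_kernel C f k\<close>: the arrow \<open>k\<close> is a kernel of \<open>f\<close>; dually for cokernels.\<close>

definition is_kernel :: "('o, 'm) cat \<Rightarrow> 'm \<Rightarrow> 'm \<Rightarrow> bool" where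
  "is_kernel C f k \<longleftrightarrow> f \<in> Arr C \<and> k \<in> Arr C \<and> Cod C k = Dom C f \<and>
     f \<cdot>\<^bsub>C\<^esub> k = Zero C (Dom C k) (Cod C f) \<and>
     (\<forall>a. \<forall>h\<in>Hom C a (Dom C f). f \<cdot>\<^bsub>C\<^esub> h = Zero C a (Cod C f) \<longrightarrow>
        (\<exists>!u. u \<in> Hom C a (Dom C k) \<and> k \<cdot>\<^bsub>C\<^esub> u = h))"

definition is_cokernel :: "('o, 'm) cat \<Rightarrow> 'm \<Rightarrow> 'm \<Rightarrow> bool" where
  "is_cokernel C f q \<longleftrightarrow> f \<in> Arr C \<and> q \<in> Arr C \<and> Dom C q = Cod C f \<and>
     q \<cdot>\<^bsub>C\<^esub> f = Zero C (Dom C f) (Cod C q) \<and>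
     (\<forall>b. \<forall>h\<in>Hom C (Cod C f) b. h \<cdot>\<^bsub>C\<^esub> f = Zero C (Dom C f) b \<longrightarrow>
        (\<exists>!u. u \<in> Hom C (Cod C q) b \<and> u \<cdot>\<^bsub>C\<^esub> q = h))"

locale abelian_category = preadditive_category +
  assumes ex_zero_object: "\<exists>z. zero_object C z"
    and ex_biproduct:
      "\<lbrakk>a \<in> Obj C; b \<in> Obj C\<rbrakk> \<Longrightarrow> \<exists>s i j p q. biproduct C s a b i j p q"
    and ex_kernel: "f \<in> Arr C \<Longrightarrow> \<exists>k. is_kernel C f k"
    and ex_cokernel: "f \<in> Arr C \<Longrightarrow> \<exists>q. is_cokernel C f q"
    and mono_normal: "mono_arr C f \<Longrightarrow> \<exists>g. is_kernel C g f"
    and epi_normal: "epi_arr C f \<Longrightarrow> \<exists>g. is_cokernel C g f"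


section \<open>Exactness\<close>

definition is_image :: "('o, 'm) cat \<Rightarrow> 'm \<Rightarrow> 'm \<Rightarrow> bool" where
  "is_image C f k \<longleftrightarrow> (\<exists>q. is_cokernel C f q \<and> is_kernel C q k)"

definition exact_at :: "('o, 'm) cat \<Rightarrow> 'm \<Rightarrow> 'm \<Rightarrow> bool" where
  "exact_at C f g \<longleftrightarrow> (\<exists>k. is_image C f k \<and> is_kernel C g k)"

text \<open>Finite sequences of composable arrows are lists, in the order in which the arrows are
  travelled. \<open>exact_bounded C [f\<^sub>0, \<dots>, f\<^sub>r]\<close> is exactness of
  \<open>0 \<rightarrow> \<bullet> \<rightarrow> \<dots> \<rightarrow> \<bullet> \<rightarrow> 0\<close>, where the \<open>r + 1\<close> arrows between the
  outer zeros are \<open>f\<^sub>0, \<dots>, f\<^sub>r\<close>.\<close>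

definition exact_list :: "('o, 'm) cat \<Rightarrow> 'm list \<Rightarrow> bool" where
  "exact_list C fs \<longleftrightarrow> (\<forall>j. Suc j < length fs \<longrightarrow> exact_at C (fs ! j) (fs ! Suc j))"

definition exact_bounded :: "('o, 'm) cat \<Rightarrow> 'm list \<Rightarrow> bool" where
  "exact_bounded C fs \<longleftrightarrow> fs \<noteq> [] \<and>
     (\<exists>z. zero_object C z \<and>
        exact_list C ([Zero C z (Dom C (hd fs))] @ fs @ [Zero C (Cod C (last fs)) z]))"

definition short_exact :: "('o, 'm) cat \<Rightarrow> 'm \<Rightarrow> 'm \<Rightarrow> bool" where
  "short_exact C f g \<longleftrightarrow> exact_bounded C [f, g]"


section \<open>Classes of objects\<close>

text \<open>Classes of objects are closed under isomorphism. For a class \<open>X\<close> without this property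
  a condition such as "the cycles lie in \<open>X\<close>" would depend on the choice of kernels.\<close>

definition object_class :: "('o, 'm) cat \<Rightarrow> 'o set \<Rightarrow> bool" where
  "object_class C X \<longleftrightarrow> X \<subseteq> Obj C \<and> (\<forall>a\<in>X. \<forall>b\<in>Obj C. iso_objs C a b \<longrightarrow> b \<in> X)"

definition injective_object :: "('o, 'm) cat \<Rightarrow> 'o \<Rightarrow> bool" where
  "injective_object C e \<longleftrightarrow> e \<in> Obj C \<and>
     (\<forall>f g. mono_arr C f \<and> g \<in> Hom C (Dom C f) e \<longrightarrow> (\<exists>h\<in>Hom C (Cod C f) e. h \<cdot>\<^bsub>C\<^esub> f = g))"

definition enough_injectives :: "('o, 'm) cat \<Rightarrow> bool" where
  "enough_injectives C \<longleftrightarrow>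
     (\<forall>a\<in>Obj C. \<exists>e f. injective_object C e \<and> f \<in> Hom C a e \<and> mono_arr C f)"

definition extension_closed :: "('o, 'm) cat \<Rightarrow> 'o set \<Rightarrow> bool" where
  "extension_closed C X \<longleftrightarrow>
     (\<forall>f g. short_exact C f g \<and> Dom C f \<in> X \<and> Cod C g \<in> X \<longrightarrow> Cod C f \<in> X)"

definition summand_closed :: "('o, 'm) cat \<Rightarrow> 'o set \<Rightarrow> bool" where
  "summand_closed C X \<longleftrightarrow>
     (\<forall>s\<in>X. \<forall>a\<in>Obj C. \<forall>b\<in>Obj C. (\<exists>i j p q. biproduct C s a b i j p q) \<longrightarrow> a \<in> X)"


section \<open>Yoneda Ext\<close>

text \<open>A \<open>k\<close>-extension \<open>0 \<rightarrow> Y \<rightarrow> E\<^sub>1 \<rightarrow> \<dots> \<rightarrow> E\<^sub>k \<rightarrow> X \<rightarrow> 0\<close> is the list of its \<open>k + 1\<close> arrows.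
  Yoneda equivalence is generated by the morphisms of extensions that are the identity on
  both ends.\<close>

definition extensions :: "('o, 'm) cat \<Rightarrow> nat \<Rightarrow> 'o \<Rightarrow> 'o \<Rightarrow> 'm list set" where
  "extensions C k X Y =
     {fs. length fs = k + 1 \<and> exact_bounded C fs \<and> Dom C (hd fs) = Y \<and> Cod C (last fs) = X}"

definition ext_morphism ::
    "('o, 'm) cat \<Rightarrow> nat \<Rightarrow> 'o \<Rightarrow> 'o \<Rightarrow> 'm list \<Rightarrow> 'm list \<Rightarrow> bool" where
  "ext_morphism C k X Y fs gs \<longleftrightarrow> fs \<in> extensions C k X Y \<and> gs \<in> extensions C k X Y \<and>
     (\<exists>u :: nat \<Rightarrow> 'm. u 0 = Ide C Y \<and> u (k + 1) = Ide C X \<and>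
        (\<forall>j. 1 \<le> j \<and> j \<le> k \<longrightarrow> u j \<in> Hom C (Dom C (fs ! j)) (Dom C (gs ! j))) \<and>
        (\<forall>j\<le>k. u (Suc j) \<cdot>\<^bsub>C\<^esub> (fs ! j) = (gs ! j) \<cdot>\<^bsub>C\<^esub> u j))"

definition Ext :: "('o, 'm) cat \<Rightarrow> nat \<Rightarrow> 'o \<Rightarrow> 'o \<Rightarrow> 'm list set set" where
  "Ext C k X Y = extensions C k X Y //
     {(fs, gs). fs \<in> extensions C k X Y \<and> gs \<in> extensions C k X Y \<and>
        equivclp (ext_morphism C k X Y) fs gs}"

text \<open>\<open>Ext C k X Y\<close> (for \<open>k \<ge> 1\<close>) is the underlying set of the Ext group; that group is zero
  iff it has exactly one element.\<close>

definition Ext_vanishes :: "('o, 'm) cat \<Rightarrow> nat \<Rightarrow> 'o set \<Rightarrow> 'o set \<Rightarrow> bool" where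
  "Ext_vanishes C k A B \<longleftrightarrow> (\<forall>X\<in>A. \<forall>Y\<in>B. is_singleton (Ext C k X Y))"


section \<open>Left cotorsion pairs\<close>

text \<open>\<open>finite_resol C Y k\<close> is \<open>Y\<^sup>\<and>\<^sub>k\<close>; a resolution \<open>0 \<rightarrow> Y\<^sub>j \<rightarrow> \<dots> \<rightarrow> Y\<^sub>0 \<rightarrow> c \<rightarrow> 0\<close> of length \<open>j\<close> has
  \<open>j + 1\<close> arrows.\<close>

definition finite_resol :: "('o, 'm) cat \<Rightarrow> 'o set \<Rightarrow> nat \<Rightarrow> 'o set" where
  "finite_resol C Y k = {c. \<exists>fs. length fs \<le> k + 1 \<and> exact_bounded C fs \<and> Cod C (last fs) = c \<and>
     (\<forall>f\<in>set fs. Dom C f \<in> Y)}"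

definition left_cotorsion_pair :: "('o, 'm) cat \<Rightarrow> nat \<Rightarrow> 'o set \<Rightarrow> 'o set \<Rightarrow> bool" where
  "left_cotorsion_pair C n X Y \<longleftrightarrow>
     summand_closed C X \<and>
     (\<forall>i. 1 \<le> i \<and> i \<le> n \<longrightarrow> Ext_vanishes C i X Y) \<and>
     (\<forall>c\<in>Obj C. \<exists>f g. short_exact C f g \<and> Cod C g = c \<and> Dom C g \<in> X \<and>
        Dom C f \<in> finite_resol C Y (n - 1))"


section \<open>The category of chain complexes\<close>

datatype ('o, 'm) chain_cpx = Chain_Cpx (Ob: "int \<Rightarrow> 'o") (Diff: "int \<Rightarrow> 'm")

datatype ('o, 'm) chain_map =
  Chain_Map (Src: "('o, 'm) chain_cpx") (Tgt: "('o, 'm) chain_cpx") (Comps: "int \<Rightarrow> 'm")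

definition is_chain_cpx :: "('o, 'm) cat \<Rightarrow> ('o, 'm) chain_cpx \<Rightarrow> bool" where
  "is_chain_cpx C X \<longleftrightarrow> (\<forall>m. Ob X m \<in> Obj C \<and> Diff X m \<in> Hom C (Ob X m) (Ob X (m - 1)) \<and>
     Diff X (m - 1) \<cdot>\<^bsub>C\<^esub> Diff X m = Zero C (Ob X m) (Ob X (m - 2)))"

definition is_chain_map :: "('o, 'm) cat \<Rightarrow> ('o, 'm) chain_map \<Rightarrow> bool" where
  "is_chain_map C F \<longleftrightarrow> is_chain_cpx C (Src F) \<and> is_chain_cpx C (Tgt F) \<and>
     (\<forall>m. Comps F m \<in> Hom C (Ob (Src F) m) (Ob (Tgt F) m) \<and>
        Diff (Tgt F) m \<cdot>\<^bsub>C\<^esub> Comps F m = Comps F (m - 1) \<cdot>\<^bsub>C\<^esub> Diff (Src F) m)"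

definition Ch :: "('o, 'm) cat \<Rightarrow> (('o, 'm) chain_cpx, ('o, 'm) chain_map) cat" where
  "Ch C = \<lparr>
     Obj = {X. is_chain_cpx C X},
     Arr = {F. is_chain_map C F},
     Dom = Src,
     Cod = Tgt,
     Ide = (\<lambda>X. Chain_Map X X (\<lambda>m. Ide C (Ob X m))),
     Comp = (\<lambda>G F. Chain_Map (Src F) (Tgt G) (\<lambda>m. Comps G m \<cdot>\<^bsub>C\<^esub> Comps F m)),
     Add = (\<lambda>F G. Chain_Map (Src F) (Tgt F) (\<lambda>m. Add C (Comps F m) (Comps G m))),
     Zero = (\<lambda>X Y. Chain_Map X Y (\<lambda>m. Zero C (Ob X m) (Ob Y m)))\<rparr>"

definition Ch_class :: "('o, 'm) cat \<Rightarrow> 'o set \<Rightarrow> ('o, 'm) chain_cpx set" where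
  "Ch_class C A = {X \<in> Obj (Ch C). \<forall>m. Ob X m \<in> A}"

definition exact_cpx :: "('o, 'm) cat \<Rightarrow> ('o, 'm) chain_cpx \<Rightarrow> bool" where
  "exact_cpx C X \<longleftrightarrow> (\<forall>m. exact_at C (Diff X (m + 1)) (Diff X m))"

definition tilde_class :: "('o, 'm) cat \<Rightarrow> 'o set \<Rightarrow> ('o, 'm) chain_cpx set" where
  "tilde_class C A = {X \<in> Obj (Ch C). exact_cpx C X \<and>
     (\<forall>m. \<exists>k. is_kernel C (Diff X m) k \<and> Dom C k \<in> A)}"


section \<open>The hom complex\<close>

definition hom_cpx ::
    "('o, 'm) cat \<Rightarrow> ('o, 'm) chain_cpx \<Rightarrow> ('o, 'm) chain_cpx \<Rightarrow> int \<Rightarrow> (int \<Rightarrow> 'm) monoid" where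
  "hom_cpx C X Y m = product_group UNIV (\<lambda>k. hom_group C (Ob X k) (Ob Y (m + k)))"

text \<open>The component at \<open>k\<close> of the differential is
  \<open>\<partial>\<^sup>Y f\<^sub>k - (-1)\<^sup>m f\<^sub>k\<^sub>-\<^sub>1 \<partial>\<^sup>X : X\<^sub>k \<rightarrow> Y\<^sub>m\<^sub>+\<^sub>k\<^sub>-\<^sub>1\<close>.\<close>

definition hom_diff ::
    "('o, 'm) cat \<Rightarrow> ('o, 'm) chain_cpx \<Rightarrow> ('o, 'm) chain_cpx \<Rightarrow> int \<Rightarrow>
     (int \<Rightarrow> 'm) \<Rightarrow> (int \<Rightarrow> 'm)" where
  "hom_diff C X Y m f = (\<lambda>k.
     let G = hom_group C (Ob X k) (Ob Y (m - 1 + k));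
         l = Diff Y (m + k) \<cdot>\<^bsub>C\<^esub> f k;
         r = f (k - 1) \<cdot>\<^bsub>C\<^esub> Diff X k
     in if even m then l \<otimes>\<^bsub>G\<^esub> inv\<^bsub>G\<^esub> r else l \<otimes>\<^bsub>G\<^esub> r)"

definition hom_cpx_exact ::
    "('o, 'm) cat \<Rightarrow> ('o, 'm) chain_cpx \<Rightarrow> ('o, 'm) chain_cpx \<Rightarrow> bool" where
  "hom_cpx_exact C X Y \<longleftrightarrow>
     (\<forall>m. kernel (hom_cpx C X Y m) (hom_cpx C X Y (m - 1)) (hom_diff C X Y m) =
          hom_diff C X Y (m + 1) ` carrier (hom_cpx C X Y (m + 1)))"

text \<open>\<open>Ch_acy_left C A B\<close> is \<open>Ch\<^sub>a\<^sub>c\<^sub>y(A; B~)\<close> and \<open>Ch_acy_right C A B\<close> is \<open>Ch\<^sub>a\<^sub>c\<^sub>y(A~; B)\<close>.\<close>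

definition Ch_acy_left :: "('o, 'm) cat \<Rightarrow> 'o set \<Rightarrow> 'o set \<Rightarrow> ('o, 'm) chain_cpx set" where
  "Ch_acy_left C A B = {X \<in> Ch_class C A. \<forall>W\<in>tilde_class C B. hom_cpx_exact C X W}"

definition Ch_acy_right :: "('o, 'm) cat \<Rightarrow> 'o set \<Rightarrow> 'o set \<Rightarrow> ('o, 'm) chain_cpx set" where
  "Ch_acy_right C A B = {Y \<in> Ch_class C B. \<forall>W\<in>tilde_class C A. hom_cpx_exact C W Y}"

end

theory Submission
  imports Defs
begin

text \<open>Evaluation of a complex in degree \<open>1\<close> and the disk functor \<open>D\<close> (\<open>a\<close> in degrees \<open>1\<close> and \<open>0\<close>,
  identity differential) are exact, since both have adjoints on either side, and evaluation is a
  retraction of \<open>D\<close>. Disks on \<open>A\<close> and \<open>B\<close> lie in the classes of either pair, because they are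
  contractible, so both the vanishing of Ext and the closure under summands descend to \<open>C\<close>. A precover
  of \<open>D c\<close>, evaluated in degree \<open>1\<close>, is a precover of \<open>c\<close> as soon as degree \<open>1\<close> of the first class
  lies in \<open>A\<close>. For the second pair this degree is an extension of cycles, so \<open>A\<close> has to be closed under
  extensions: if \<open>0 \<rightarrow> K \<rightarrow> X \<rightarrow> D x \<rightarrow> 0\<close> is a precover with \<open>x\<close> an extension of members of \<open>A\<close>, then
  \<open>Ext\<^sup>1(x, K\<^sub>1) = 0\<close> by dimension shifting along the resolution of \<open>K\<^sub>1\<close>, hence the
  sequence splits by adjunction and \<open>D x\<close> is a summand of \<open>X\<close>.\<close>

section \<open>Preadditive categories\<close>

text \<open>Ext is a bare set of Yoneda classes modulo zigzags, with neither a group law nor a long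
  exact sequence at hand, so dimension shifting cannot be done on it directly.
  \<open>ext_acyclic\<close> takes its place: along an injective coresolution the vanishing of Ext
  becomes a lifting property of arrows, and the pieces of the long exact sequence become diagram
  chases. The passage from Yoneda Ext to lifting rests on this: an arrow into a cosyzygy and the
  zero arrow pull the coresolution back to two extensions, and a zigzag between them forces the
  arrow to factor through the last injective. \<open>Ch C\<close> is handled as a preadditive
  category. Kernels and cokernels of complexes are never constructed; disk and evaluation functors
  only have to preserve those that occur in a given exact sequence, and disks provide the test
  objects for this. A disk is zero in almost all degrees, so the zero object must lie in both
  classes: in \<open>B\<close> because it is injective, in \<open>A\<close> because the zero disk is
  a summand of a precover. Extension closure of \<open>B\<close> puts degree 1 of
  \<open>tilde_class C B\<close> into \<open>B\<close>.\<close>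

lemma Hom_iff: "f \<in> Hom C a b \<longleftrightarrow> f \<in> Arr C \<and> Dom C f = a \<and> Cod C f = b"
  by (simp add: Hom_def)

lemma Hom_Arr: "f \<in> Arr C \<Longrightarrow> f \<in> Hom C (Dom C f) (Cod C f)"
  by (simp add: Hom_iff)

lemma hom_group_simps [simp]:
  "carrier (hom_group C a b) = Hom C a b"
  "x \<otimes>\<^bsub>hom_group C a b\<^esub> y = Add C x y"
  "\<one>\<^bsub>hom_group C a b\<^esub> = Zero C a b"
  by (auto simp: hom_group_def)

context category
begin

lemma Hom_obj:
  assumes "f \<in> Hom C a b"
  shows "a \<in> Obj C" "b \<in> Obj C"
  using assms dom_obj cod_obj by (auto simp: Hom_iff)

lemma zero_object_eq_to: "\<lbrakk>zero_object C z; f \<in> Hom C a z; g \<in> Hom C a z\<rbrakk> \<Longrightarrow> f = g"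
  unfolding zero_object_def using Hom_obj by (metis is_singleton_def singletonD)

lemma zero_object_eq_from: "\<lbrakk>zero_object C z; f \<in> Hom C z a; g \<in> Hom C z a\<rbrakk> \<Longrightarrow> f = g"
  unfolding zero_object_def using Hom_obj by (metis is_singleton_def singletonD)

section \<open>Monomorphisms and epimorphisms\<close>

lemma monoD:
  assumes "mono_arr C f" "f \<in> Hom C b c" "g \<in> Hom C a b" "h \<in> Hom C a b" "f \<cdot> g = f \<cdot> h"
  shows "g = h"
  using assms unfolding mono_arr_def by (auto simp: Hom_iff)

lemma epiD:
  assumes "epi_arr C f" "f \<in> Hom C a b" "g \<in> Hom C b c" "h \<in> Hom C b c" "g \<cdot> f = h \<cdot> f"
  shows "g = h"
  using assms unfolding epi_arr_def by (auto simp: Hom_iff)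

lemma mono_ide: "a \<in> Obj C \<Longrightarrow> mono_arr C (Ide C a)"
  using ide_hom[of a] unfolding mono_arr_def by (simp add: Hom_iff[of "Ide C a"] comp_ide_left)

lemma epi_ide: "a \<in> Obj C \<Longrightarrow> epi_arr C (Ide C a)"
  using ide_hom[of a] unfolding epi_arr_def by (simp add: Hom_iff[of "Ide C a"] comp_ide_right)

lemma mono_comp:
  assumes "mono_arr C f" "f \<in> Hom C a b" "mono_arr C g" "g \<in> Hom C b c"
  shows "mono_arr C (g \<cdot> f)"
proof -
  have gf: "g \<cdot> f \<in> Hom C a c" using assms comp_hom by blast
  have "u = v" if "u \<in> Hom C t a" "v \<in> Hom C t a" "(g \<cdot> f) \<cdot> u = (g \<cdot> f) \<cdot> v" for t u v
  proof -
    have "g \<cdot> (f \<cdot> u) = g \<cdot> (f \<cdot> v)"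
      using that(3) comp_assoc[OF that(1) assms(2,4)] comp_assoc[OF that(2) assms(2,4)] by simp
    then have "f \<cdot> u = f \<cdot> v"
      using monoD[OF assms(3,4)] comp_hom that assms(2) by blast
    then show ?thesis using monoD[OF assms(1,2)] that by blast
  qed
  then show ?thesis using gf unfolding mono_arr_def by (auto simp: Hom_iff)
qed

lemma epi_comp:
  assumes "epi_arr C f" "f \<in> Hom C a b" "epi_arr C g" "g \<in> Hom C b c"
  shows "epi_arr C (g \<cdot> f)"
proof -
  have gf: "g \<cdot> f \<in> Hom C a c" using assms comp_hom by blast
  have "u = v" if "u \<in> Hom C c t" "v \<in> Hom C c t" "u \<cdot> (g \<cdot> f) = v \<cdot> (g \<cdot> f)" for t u v
  proof -
    have "(u \<cdot> g) \<cdot> f = (v \<cdot> g) \<cdot> f"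
      using that(3) comp_assoc[OF assms(2,4) that(1)] comp_assoc[OF assms(2,4) that(2)] by simp
    then have "u \<cdot> g = v \<cdot> g"
      using epiD[OF assms(1,2)] comp_hom that assms(4) by blast
    then show ?thesis using epiD[OF assms(3,4)] that by blast
  qed
  then show ?thesis using gf unfolding epi_arr_def by (auto simp: Hom_iff)
qed

lemma epi_cancel:
  assumes "epi_arr C (g \<cdot> f)" "f \<in> Hom C a b" "g \<in> Hom C b c"
  shows "epi_arr C g"
proof -
  have gf: "g \<cdot> f \<in> Hom C a c" using assms comp_hom by blast
  have "u = v" if "u \<in> Hom C c t" "v \<in> Hom C c t" "u \<cdot> g = v \<cdot> g" for t u v
    using epiD[OF assms(1) gf that(1,2)] that(3) comp_assoc[OF assms(2,3) that(1)] comp_assoc[OF assms(2,3) that(2)]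
    by simp
  then show ?thesis using assms unfolding epi_arr_def by (auto simp: Hom_iff)
qed

lemma mono_cancel:
  assumes "mono_arr C (g \<cdot> f)" "f \<in> Hom C a b" "g \<in> Hom C b c"
  shows "mono_arr C f"
proof -
  have gf: "g \<cdot> f \<in> Hom C a c" using assms comp_hom by blast
  have "u = v" if "u \<in> Hom C t a" "v \<in> Hom C t a" "f \<cdot> u = f \<cdot> v" for t u v
    using monoD[OF assms(1) gf that(1,2)] that(3) comp_assoc[OF that(1) assms(2,3)] comp_assoc[OF that(2) assms(2,3)]
    by simp
  then show ?thesis using assms unfolding mono_arr_def by (auto simp: Hom_iff)
qed

end

context preadditive_category
begin

abbreviation plus_arr (infixl "\<boxplus>" 65) where "f \<boxplus> g \<equiv> Add C f g"

text \<open>The hom-group is recovered from the first operand, so that subtraction is an infix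
  operation without object arguments, as addition is.\<close>

definition minus_arr (infixl "\<boxminus>" 65) where
  "f \<boxminus> g = f \<boxplus> inv\<^bsub>hom_group C (Dom C f) (Cod C f)\<^esub> g"

lemma minus_arr_eq: "f \<in> Hom C a b \<Longrightarrow> f \<boxminus> g = f \<boxplus> inv\<^bsub>hom_group C a b\<^esub> g"
  by (simp add: minus_arr_def Hom_iff)

section \<open>Arithmetic in the groups of arrows\<close>

lemma hom_comm_group': "f \<in> Hom C a b \<Longrightarrow> comm_group (hom_group C a b)"
  by (intro hom_comm_group; erule Hom_obj)

lemma hom_monoid: "\<lbrakk>a \<in> Obj C; b \<in> Obj C\<rbrakk> \<Longrightarrow> monoid (hom_group C a b)"
  by (intro comm_monoid.axioms(1) comm_group.axioms(1) hom_comm_group)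

lemma hom_monoid': "f \<in> Hom C a b \<Longrightarrow> monoid (hom_group C a b)"
  by (intro hom_monoid; erule Hom_obj)

lemma hom_group': "f \<in> Hom C a b \<Longrightarrow> group (hom_group C a b)"
  by (intro comm_group.axioms(2) hom_comm_group')

lemma zero_hom: "\<lbrakk>a \<in> Obj C; b \<in> Obj C\<rbrakk> \<Longrightarrow> Zero C a b \<in> Hom C a b"
  using monoid.one_closed[OF hom_monoid] by simp

lemma add_hom: "\<lbrakk>f \<in> Hom C a b; g \<in> Hom C a b\<rbrakk> \<Longrightarrow> f \<boxplus> g \<in> Hom C a b"
  using monoid.m_closed[OF hom_monoid'] by simp

lemma neg_hom: "f \<in> Hom C a b \<Longrightarrow> inv\<^bsub>hom_group C a b\<^esub> f \<in> Hom C a b"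
  using group.inv_closed[OF hom_group'] by simp

lemma minus_hom: "\<lbrakk>f \<in> Hom C a b; g \<in> Hom C a b\<rbrakk> \<Longrightarrow> f \<boxminus> g \<in> Hom C a b"
  by (simp add: minus_arr_eq add_hom neg_hom)

lemma add_zero_left: "f \<in> Hom C a b \<Longrightarrow> Zero C a b \<boxplus> f = f"
  using monoid.l_one[OF hom_monoid'] by simp

lemma add_zero_right: "f \<in> Hom C a b \<Longrightarrow> f \<boxplus> Zero C a b = f"
  using monoid.r_one[OF hom_monoid'] by simp

lemma add_assoc:
  "\<lbrakk>f \<in> Hom C a b; g \<in> Hom C a b; h \<in> Hom C a b\<rbrakk> \<Longrightarrow> (f \<boxplus> g) \<boxplus> h = f \<boxplus> (g \<boxplus> h)"
  using monoid.m_assoc[OF hom_monoid'] by simp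

lemma add_comm: "\<lbrakk>f \<in> Hom C a b; g \<in> Hom C a b\<rbrakk> \<Longrightarrow> f \<boxplus> g = g \<boxplus> f"
  using comm_monoid.m_comm[OF comm_group.axioms(1)[OF hom_comm_group']] by simp

lemma add_neg: "f \<in> Hom C a b \<Longrightarrow> f \<boxplus> inv\<^bsub>hom_group C a b\<^esub> f = Zero C a b"
  using group.r_inv[OF hom_group'] by simp

lemma add_cancel_right:
  assumes "f \<in> Hom C a b" "g \<in> Hom C a b" "h \<in> Hom C a b" "f \<boxplus> h = g \<boxplus> h"
  shows "f = g"
  using group.right_cancel[OF hom_group', of f a b h f g] assms by simp

lemma minus_add:
  assumes "f \<in> Hom C a b" "g \<in> Hom C a b"
  shows "(f \<boxminus> g) \<boxplus> g = f"
  unfolding minus_arr_eq[OF assms(1)]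
  by (simp add: add_assoc[OF assms(1) neg_hom[OF assms(2)] assms(2)] add_comm[OF neg_hom[OF assms(2)] assms(2)]
      add_neg[OF assms(2)] add_zero_right[OF assms(1)])

lemma add_minus:
  assumes "f \<in> Hom C a b" "g \<in> Hom C a b"
  shows "(f \<boxplus> g) \<boxminus> g = f"
  unfolding minus_arr_eq[OF add_hom[OF assms]]
  by (simp add: add_assoc[OF assms neg_hom[OF assms(2)]] add_neg[OF assms(2)] add_zero_right[OF assms(1)])

lemma minus_self: "f \<in> Hom C a b \<Longrightarrow> f \<boxminus> f = Zero C a b"
  by (simp add: minus_arr_eq add_neg)

lemma minus_eq_iff:
  assumes "f \<in> Hom C a b" "g \<in> Hom C a b" "h \<in> Hom C a b"
  shows "f \<boxminus> g = h \<longleftrightarrow> f = h \<boxplus> g"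
  using minus_add[OF assms(1,2)] add_minus[OF assms(3,2)] by auto

lemma minus_eq_zero:
  assumes "f \<in> Hom C a b" "g \<in> Hom C a b" "f \<boxminus> g = Zero C a b"
  shows "f = g"
  using minus_add[OF assms(1,2)] add_zero_left[OF assms(2)] assms(3) by simp

lemma minus_zero: "f \<in> Hom C a b \<Longrightarrow> f \<boxminus> Zero C a b = f"
  by (metis Hom_obj zero_hom add_zero_right add_minus)

lemma minus_minus_self:
  assumes "f \<in> Hom C a b" "g \<in> Hom C a b"
  shows "f \<boxminus> (f \<boxminus> g) = g"
  using minus_eq_iff[OF assms(1) minus_hom[OF assms] assms(2)] minus_add[OF assms]
    add_comm[OF minus_hom[OF assms] assms(2)] by simp

lemma comp_zero_right:
  assumes "f \<in> Hom C b c" "a \<in> Obj C"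
  shows "f \<cdot> Zero C a b = Zero C a c"
proof -
  have z: "Zero C a b \<in> Hom C a b" "Zero C a c \<in> Hom C a c"
    using zero_hom assms Hom_obj by auto
  then have fz: "f \<cdot> Zero C a b \<in> Hom C a c" using comp_hom assms by blast
  have "f \<cdot> Zero C a b \<boxplus> f \<cdot> Zero C a b = Zero C a c \<boxplus> f \<cdot> Zero C a b"
    using comp_add_right[OF z(1) z(1) assms(1)] add_zero_left[OF z(1)] add_zero_left[OF fz] by simp
  then show ?thesis using add_cancel_right fz z by blast
qed

lemma comp_zero_left:
  assumes "f \<in> Hom C a b" "c \<in> Obj C"
  shows "Zero C b c \<cdot> f = Zero C a c"
proof -
  have z: "Zero C b c \<in> Hom C b c" "Zero C a c \<in> Hom C a c"
    using zero_hom assms Hom_obj by auto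
  then have fz: "Zero C b c \<cdot> f \<in> Hom C a c" using comp_hom assms by blast
  have "Zero C b c \<cdot> f \<boxplus> Zero C b c \<cdot> f = Zero C a c \<boxplus> Zero C b c \<cdot> f"
    using comp_add_left[OF assms(1) z(1) z(1)] add_zero_left[OF z(1)] add_zero_left[OF fz] by simp
  then show ?thesis using add_cancel_right fz z by blast
qed

lemma comp_minus_right:
  assumes "f \<in> Hom C a b" "g \<in> Hom C a b" "h \<in> Hom C b c"
  shows "h \<cdot> (f \<boxminus> g) = h \<cdot> f \<boxminus> h \<cdot> g"
proof -
  have "h \<cdot> (f \<boxminus> g) \<boxplus> h \<cdot> g = h \<cdot> f"
    using comp_add_right[OF minus_hom[OF assms(1,2)] assms(2,3)] minus_add[OF assms(1,2)] by simp
  then show ?thesis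
    using minus_eq_iff[OF comp_hom[OF assms(1,3)] comp_hom[OF assms(2,3)]
        comp_hom[OF minus_hom[OF assms(1,2)] assms(3)]] by simp
qed

lemma comp_minus_left:
  assumes "f \<in> Hom C a b" "g \<in> Hom C b c" "h \<in> Hom C b c"
  shows "(g \<boxminus> h) \<cdot> f = g \<cdot> f \<boxminus> h \<cdot> f"
proof -
  have "(g \<boxminus> h) \<cdot> f \<boxplus> h \<cdot> f = g \<cdot> f"
    using comp_add_left[OF assms(1) minus_hom[OF assms(2,3)] assms(3)] minus_add[OF assms(2,3)] by simp
  then show ?thesis
    using minus_eq_iff[OF comp_hom[OF assms(1,2)] comp_hom[OF assms(1,3)]
        comp_hom[OF assms(1) minus_hom[OF assms(2,3)]]] by simp
qed

section \<open>Monomorphisms, epimorphisms, kernels and cokernels tested by vanishing\<close>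

lemma monoI:
  assumes "f \<in> Hom C b c" "\<And>t x. \<lbrakk>x \<in> Hom C t b; f \<cdot> x = Zero C t c\<rbrakk> \<Longrightarrow> x = Zero C t b"
  shows "mono_arr C f"
proof -
  have "g = h" if "g \<in> Hom C t b" "h \<in> Hom C t b" "f \<cdot> g = f \<cdot> h" for t g h
  proof -
    have "f \<cdot> (g \<boxminus> h) = Zero C t c"
      using comp_minus_right[OF that(1,2) assms(1)] that minus_self comp_hom assms(1) by metis
    then show ?thesis using assms(2) minus_hom that minus_eq_zero by metis
  qed
  then show ?thesis using assms(1) unfolding mono_arr_def by (auto simp: Hom_iff)
qed

lemma epiI:
  assumes "f \<in> Hom C a b" "\<And>t x. \<lbrakk>x \<in> Hom C b t; x \<cdot> f = Zero C a t\<rbrakk> \<Longrightarrow> x = Zero C b t"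
  shows "epi_arr C f"
proof -
  have "g = h" if "g \<in> Hom C b t" "h \<in> Hom C b t" "g \<cdot> f = h \<cdot> f" for t g h
  proof -
    have "(g \<boxminus> h) \<cdot> f = Zero C a t"
      using comp_minus_left[OF assms(1) that(1,2)] that minus_self comp_hom assms(1) by metis
    then show ?thesis using assms(2) minus_hom that minus_eq_zero by metis
  qed
  then show ?thesis using assms(1) unfolding epi_arr_def by (auto simp: Hom_iff)
qed

lemma monoD0:
  assumes "mono_arr C f" "f \<in> Hom C b c" "x \<in> Hom C a b" "f \<cdot> x = Zero C a c"
  shows "x = Zero C a b"
  using assms by (metis monoD comp_zero_right zero_hom Hom_obj)

lemma epiD0:
  assumes "epi_arr C f" "f \<in> Hom C a b" "x \<in> Hom C b c" "x \<cdot> f = Zero C a c"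
  shows "x = Zero C b c"
  using assms by (metis epiD comp_zero_left zero_hom Hom_obj)

text \<open>Monicity of \<open>k\<close> gives uniqueness of factorisations, so only their existence
  has to be supplied.\<close>

lemma kernelI:
  assumes "f \<in> Hom C b c" "k \<in> Hom C a b" "mono_arr C k" "f \<cdot> k = Zero C a c"
    and "\<And>t x. \<lbrakk>x \<in> Hom C t b; f \<cdot> x = Zero C t c\<rbrakk> \<Longrightarrow> \<exists>u\<in>Hom C t a. k \<cdot> u = x"
  shows "is_kernel C f k"
proof -
  have "\<exists>!u. u \<in> Hom C t a \<and> k \<cdot> u = x" if "x \<in> Hom C t b" "f \<cdot> x = Zero C t c" for t x
    using assms(5)[OF that] monoD[OF assms(3,2)] by metis
  moreover have "f \<in> Arr C" "k \<in> Arr C" "Dom C f = b" "Cod C f = c" "Dom C k = a" "Cod C k = b"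
    using assms(1,2) by (auto simp: Hom_iff)
  ultimately show ?thesis unfolding is_kernel_def using assms(4) by simp
qed

lemma cokernelI:
  assumes "f \<in> Hom C a b" "q \<in> Hom C b c" "epi_arr C q" "q \<cdot> f = Zero C a c"
    and "\<And>t x. \<lbrakk>x \<in> Hom C b t; x \<cdot> f = Zero C a t\<rbrakk> \<Longrightarrow> \<exists>u\<in>Hom C c t. u \<cdot> q = x"
  shows "is_cokernel C f q"
proof -
  have "\<exists>!u. u \<in> Hom C c t \<and> u \<cdot> q = x" if "x \<in> Hom C b t" "x \<cdot> f = Zero C a t" for t x
    using assms(5)[OF that] epiD[OF assms(3,2)] by metis
  moreover have "f \<in> Arr C" "q \<in> Arr C" "Dom C f = a" "Cod C f = b" "Dom C q = b" "Cod C q = c"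
    using assms(1,2) by (auto simp: Hom_iff)
  ultimately show ?thesis unfolding is_cokernel_def using assms(4) by simp
qed

lemma kernel_hom:
  assumes "is_kernel C f k" "f \<in> Hom C b c"
  shows "k \<in> Hom C (Dom C k) b"
  using assms by (auto simp: is_kernel_def Hom_iff)

lemma cokernel_hom:
  assumes "is_cokernel C f q" "f \<in> Hom C a b"
  shows "q \<in> Hom C b (Cod C q)"
  using assms by (auto simp: is_cokernel_def Hom_iff)

lemma kernel_zero:
  assumes "is_kernel C f k" "f \<in> Hom C b c" "k \<in> Hom C a b"
  shows "f \<cdot> k = Zero C a c"
  using assms by (auto simp: is_kernel_def Hom_iff)

lemma cokernel_zero:
  assumes "is_cokernel C f q" "f \<in> Hom C a b" "q \<in> Hom C b c"
  shows "q \<cdot> f = Zero C a c"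
  using assms by (auto simp: is_cokernel_def Hom_iff)

lemma kernel_lift:
  assumes "is_kernel C f k" "f \<in> Hom C b c" "k \<in> Hom C a b"
    and "x \<in> Hom C t b" "f \<cdot> x = Zero C t c"
  shows "\<exists>u\<in>Hom C t a. k \<cdot> u = x"
proof -
  have "Dom C f = b" "Cod C f = c" "Dom C k = a" using assms by (auto simp: Hom_iff)
  then show ?thesis using assms unfolding is_kernel_def by blast
qed

lemma cokernel_desc:
  assumes "is_cokernel C f q" "f \<in> Hom C a b" "q \<in> Hom C b c"
    and "x \<in> Hom C b t" "x \<cdot> f = Zero C a t"
  shows "\<exists>u\<in>Hom C c t. u \<cdot> q = x"
proof -
  have "Dom C f = a" "Cod C f = b" "Cod C q = c" using assms by (auto simp: Hom_iff)
  then show ?thesis using assms unfolding is_cokernel_def by blast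
qed

text \<open>An arrow killed by \<open>k\<close> and the zero arrow are both factorisations of zero
  through \<open>k\<close>, hence equal.\<close>

lemma kernel_mono:
  assumes "is_kernel C f k"
  shows "mono_arr C k"
proof -
  have f: "f \<in> Hom C (Dom C f) (Cod C f)" and k: "k \<in> Hom C (Dom C k) (Dom C f)"
    using assms by (auto simp: is_kernel_def Hom_iff)
  show ?thesis
  proof (rule monoI[OF k])
    fix t x assume x: "x \<in> Hom C t (Dom C k)" "k \<cdot> x = Zero C t (Dom C f)"
    have t: "t \<in> Obj C" using x Hom_obj by blast
    have z: "Zero C t (Dom C f) \<in> Hom C t (Dom C f)" using t f Hom_obj zero_hom by blast
    have fz: "f \<cdot> Zero C t (Dom C f) = Zero C t (Cod C f)" using comp_zero_right f t by blast
    have "\<exists>!u. u \<in> Hom C t (Dom C k) \<and> k \<cdot> u = Zero C t (Dom C f)"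
      using assms z fz unfolding is_kernel_def by blast
    moreover have "k \<cdot> Zero C t (Dom C k) = Zero C t (Dom C f)" using k t comp_zero_right by blast
    moreover have "Zero C t (Dom C k) \<in> Hom C t (Dom C k)" using t k Hom_obj zero_hom by blast
    ultimately show "x = Zero C t (Dom C k)" using x by blast
  qed
qed

lemma cokernel_epi:
  assumes "is_cokernel C f q"
  shows "epi_arr C q"
proof -
  have f: "f \<in> Hom C (Dom C f) (Cod C f)" and q: "q \<in> Hom C (Cod C f) (Cod C q)"
    using assms by (auto simp: is_cokernel_def Hom_iff)
  show ?thesis
  proof (rule epiI[OF q])
    fix t x assume x: "x \<in> Hom C (Cod C q) t" "x \<cdot> q = Zero C (Cod C f) t"
    have t: "t \<in> Obj C" using x Hom_obj by blast
    have z: "Zero C (Cod C f) t \<in> Hom C (Cod C f) t" using t f Hom_obj zero_hom by blast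
    have fz: "Zero C (Cod C f) t \<cdot> f = Zero C (Dom C f) t" using comp_zero_left f t by blast
    have "\<exists>!u. u \<in> Hom C (Cod C q) t \<and> u \<cdot> q = Zero C (Cod C f) t"
      using assms z fz unfolding is_cokernel_def by blast
    moreover have "Zero C (Cod C q) t \<cdot> q = Zero C (Cod C f) t" using q t comp_zero_left by blast
    moreover have "Zero C (Cod C q) t \<in> Hom C (Cod C q) t" using t q Hom_obj zero_hom by blast
    ultimately show "x = Zero C (Cod C q) t" using x by blast
  qed
qed

section \<open>Biproducts, splittings and comparison of kernels\<close>

lemma biproductD:
  assumes "biproduct C s a b i j p q"
  shows "i \<in> Hom C a s" "j \<in> Hom C b s" "p \<in> Hom C s a" "q \<in> Hom C s b"
    "p \<cdot> i = Ide C a" "q \<cdot> j = Ide C b" "p \<cdot> j = Zero C b a" "q \<cdot> i = Zero C a b"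
    "(i \<cdot> p) \<boxplus> (j \<cdot> q) = Ide C s"
  using assms by (auto simp: biproduct_def)

text \<open>The missing projection \<open>q\<close> is the factorisation of \<open>1 - s g\<close>
  through the kernel \<open>f\<close>. The argument is purely preadditive, so it can be applied in
  \<open>Ch C\<close>.\<close>

lemma split_kernel_biproduct:
  assumes ker: "is_kernel C g f" and f: "f \<in> Hom C a b" and g: "g \<in> Hom C b c"
    and s: "s \<in> Hom C c b" "g \<cdot> s = Ide C c"
  shows "\<exists>q. biproduct C b c a s f g q"
proof -
  have b: "Ide C b \<in> Hom C b b" "s \<cdot> g \<in> Hom C b b" using g s ide_hom comp_hom Hom_obj by blast+
  have "g \<cdot> (s \<cdot> g) = g" using s g comp_assoc[of g b c s b g c] comp_ide_left by metis
  then have "g \<cdot> (Ide C b \<boxminus> s \<cdot> g) = Zero C b c"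
    using comp_minus_right[OF b g] comp_ide_right[OF g] minus_self[OF g] by simp
  then obtain q where q: "q \<in> Hom C b a" "f \<cdot> q = Ide C b \<boxminus> s \<cdot> g"
    using kernel_lift[OF ker g f minus_hom[OF b]] by blast
  have gf: "g \<cdot> f = Zero C a c" using kernel_zero[OF ker g f] .
  have mono: "mono_arr C f" using ker kernel_mono by blast
  have a: "Ide C a \<in> Hom C a a" and o: "a \<in> Obj C" "c \<in> Obj C" "b \<in> Obj C"
    using ide_hom f g Hom_obj by blast+
  have "f \<cdot> (q \<cdot> f) = (Ide C b \<boxminus> s \<cdot> g) \<cdot> f" using comp_assoc f q by metis
  also have "\<dots> = f \<boxminus> s \<cdot> (g \<cdot> f)"
    using comp_minus_left[OF f b] comp_ide_left[OF f] comp_assoc[OF f g s(1)] by simp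
  also have "\<dots> = f \<cdot> Ide C a"
    using gf comp_zero_right[OF s(1) o(1)] minus_zero[OF f] comp_ide_right[OF f] by simp
  finally have 1: "q \<cdot> f = Ide C a" using monoD[OF mono f] a comp_hom f q by blast
  have "f \<cdot> (q \<cdot> s) = (Ide C b \<boxminus> s \<cdot> g) \<cdot> s" using comp_assoc s q f by metis
  also have "\<dots> = s \<boxminus> s \<cdot> (g \<cdot> s)"
    using comp_minus_left[OF s(1) b] comp_ide_left[OF s(1)] comp_assoc[OF s(1) g s(1)] by simp
  also have "\<dots> = Zero C c b"
    using s minus_self[OF s(1)] comp_ide_right[OF s(1)] by simp
  finally have 2: "q \<cdot> s = Zero C c a" using monoD0[OF mono f] comp_hom s q by blast
  have "s \<cdot> g \<boxplus> f \<cdot> q = Ide C b"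
    using q(2) minus_add[OF b] add_comm[OF minus_hom[OF b] b(2)] by simp
  then show ?thesis using 1 2 s f g q gf unfolding biproduct_def by blast
qed

text \<open>Serves twice: an injective object gets its trivial coresolution from it, and the zero
  disk is a summand of any complex.\<close>

lemma zero_object_summand:
  assumes z: "zero_object C z" and s: "s \<in> Obj C"
  shows "biproduct C s z s (Zero C z s) (Ide C s) (Zero C s z) (Ide C s)"
proof -
  have zo: "z \<in> Obj C" using z by (simp add: zero_object_def)
  note h = zero_hom[OF zo s] zero_hom[OF s zo] ide_hom[OF s] ide_hom[OF zo] zero_hom[OF zo zo] zero_hom[OF s s]
  have "Zero C s z \<cdot> Zero C z s = Ide C z" using zero_object_eq_to[OF z] comp_hom h by blast
  moreover have "Zero C z s \<cdot> Zero C s z = Zero C s s" using comp_zero_right h s by blast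
  ultimately show ?thesis
    unfolding biproduct_def using h comp_ide_left comp_ide_right add_zero_left comp_hom by auto
qed

text \<open>Each kernel factors through the other, and monicity makes the factorisations inverse.
  Together with closure under isomorphism this makes the choice of cycles in
  \<open>tilde_class\<close> harmless.\<close>

lemma kernels_iso:
  assumes k: "is_kernel C f k" and l: "is_kernel C f l"
  shows "iso_objs C (Dom C k) (Dom C l)"
proof -
  have f: "f \<in> Hom C (Dom C f) (Cod C f)" using assms by (auto simp: is_kernel_def Hom_iff)
  note hk = kernel_hom[OF k f] note hl = kernel_hom[OF l f]
  obtain u where u: "u \<in> Hom C (Dom C k) (Dom C l)" "l \<cdot> u = k"
    using kernel_lift[OF l f hl hk kernel_zero[OF k f hk]] by blast
  obtain v where v: "v \<in> Hom C (Dom C l) (Dom C k)" "k \<cdot> v = l"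
    using kernel_lift[OF k f hk hl kernel_zero[OF l f hl]] by blast
  have "k \<cdot> (v \<cdot> u) = k \<cdot> Ide C (Dom C k)" using u v hk comp_assoc comp_ide_right by metis
  then have 1: "v \<cdot> u = Ide C (Dom C k)"
    using monoD[OF kernel_mono[OF k] hk] u v comp_hom ide_hom Hom_obj hk by meson
  have "l \<cdot> (u \<cdot> v) = l \<cdot> Ide C (Dom C l)" using u v hl comp_assoc comp_ide_right by metis
  then have "u \<cdot> v = Ide C (Dom C l)"
    using monoD[OF kernel_mono[OF l] hl] u v comp_hom ide_hom Hom_obj hl by meson
  then show ?thesis unfolding iso_objs_def using 1 u v by blast
qed

text \<open>Exactness provides some arrow that is both an image and a kernel; this exchanges it for
  a prescribed kernel \<open>l\<close> of \<open>g\<close>, for instance one whose domain is known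
  to lie in the class.\<close>

lemma kernel_swap:
  assumes "is_kernel C g k" "is_kernel C g l" "is_kernel C q k"
  shows "is_kernel C q l"
proof -
  have g: "g \<in> Hom C (Dom C g) (Cod C g)" using assms by (auto simp: is_kernel_def Hom_iff)
  have D: "Dom C q = Dom C g" using assms by (auto simp: is_kernel_def)
  have q: "q \<in> Hom C (Dom C g) (Cod C q)" using assms D by (auto simp: is_kernel_def Hom_iff)
  note hk = kernel_hom[OF assms(1) g] note hl = kernel_hom[OF assms(2) g]
  obtain u where u: "u \<in> Hom C (Dom C l) (Dom C k)" "k \<cdot> u = l"
    using kernel_lift[OF assms(1) g hk hl kernel_zero[OF assms(2) g hl]] by blast
  obtain v where v: "v \<in> Hom C (Dom C k) (Dom C l)" "l \<cdot> v = k"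
    using kernel_lift[OF assms(2) g hl hk kernel_zero[OF assms(1) g hk]] by blast
  show ?thesis
  proof (rule kernelI[OF q hl])
    show "mono_arr C l" using kernel_mono assms by blast
    have "q \<cdot> l = (q \<cdot> k) \<cdot> u" using u comp_assoc[OF u(1) hk q] by simp
    then show "q \<cdot> l = Zero C (Dom C l) (Cod C q)"
      using kernel_zero[OF assms(3) q hk] comp_zero_left[OF u(1) Hom_obj(2)[OF q]] by simp
    fix t x assume "x \<in> Hom C t (Dom C g)" "q \<cdot> x = Zero C t (Cod C q)"
    then obtain w where w: "w \<in> Hom C t (Dom C k)" "k \<cdot> w = x"
      using kernel_lift[OF assms(3) q hk] by blast
    then have "l \<cdot> (v \<cdot> w) = x" using v comp_assoc[OF w(1) v(1) hl] by simp
    then show "\<exists>u\<in>Hom C t (Dom C l). l \<cdot> u = x" using comp_hom[OF w(1) v(1)] by blast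
  qed
qed

end

context preadditive_category
begin

lemma biproduct_pair:
  assumes bp: "biproduct C s a b i j p q" and u: "u \<in> Hom C t a" and v: "v \<in> Hom C t b"
  shows "\<exists>m\<in>Hom C t s. p \<cdot> m = u \<and> q \<cdot> m = v"
proof -
  note B = biproductD[OF bp]
  note h = comp_hom[OF u B(1)] comp_hom[OF v B(2)]
  have t: "t \<in> Obj C" using u Hom_obj by blast
  have "p \<cdot> (i \<cdot> u \<boxplus> j \<cdot> v) = u"
    using comp_add_right[OF h B(3)] comp_assoc[OF u B(1,3)] comp_assoc[OF v B(2,3)] B(5,7)
      comp_ide_left[OF u] comp_zero_left[OF v Hom_obj(2)[OF u]] add_zero_right[OF u] by simp
  moreover have "q \<cdot> (i \<cdot> u \<boxplus> j \<cdot> v) = v"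
    using comp_add_right[OF h B(4)] comp_assoc[OF u B(1,4)] comp_assoc[OF v B(2,4)] B(6,8)
      comp_ide_left[OF v] comp_zero_left[OF u Hom_obj(2)[OF v]] add_zero_left[OF v] by simp
  ultimately show ?thesis using add_hom[OF h] by blast
qed

lemma biproduct_eq:
  assumes bp: "biproduct C s a b i j p q" and m: "m \<in> Hom C t s" "m' \<in> Hom C t s"
    and e: "p \<cdot> m = p \<cdot> m'" "q \<cdot> m = q \<cdot> m'"
  shows "m = m'"
proof -
  note B = biproductD[OF bp]
  have *: "x = i \<cdot> (p \<cdot> x) \<boxplus> j \<cdot> (q \<cdot> x)" if x: "x \<in> Hom C t s" for x
    using comp_add_left[OF x comp_hom[OF B(3,1)] comp_hom[OF B(4,2)]] B(9) comp_ide_left[OF x]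
      comp_assoc[OF x B(3,1)] comp_assoc[OF x B(4,2)] by simp
  show ?thesis using *[OF m(1)] *[OF m(2)] e by simp
qed

lemma biproduct_swap: "biproduct C s a b i j p q \<Longrightarrow> biproduct C s b a j i q p"
  unfolding biproduct_def using add_comm[of "i \<cdot> p" s s "j \<cdot> q"] comp_hom by metis

lemma biproduct_epi:
  assumes bp: "biproduct C s a b i j p q"
  shows "epi_arr C p" "epi_arr C q"
  using biproductD[OF bp] epi_cancel epi_ide Hom_obj by metis+

lemma biproduct_mono:
  assumes bp: "biproduct C s a b i j p q"
  shows "mono_arr C i" "mono_arr C j"
  using biproductD[OF bp] mono_cancel mono_ide Hom_obj by metis+

lemma biproduct_kernel:
  assumes bp: "biproduct C s a b i j p q"
  shows "is_kernel C q i"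
proof -
  note B = biproductD[OF bp]
  show ?thesis
  proof (rule kernelI[OF B(4,1) biproduct_mono(1)[OF bp] B(8)])
    fix t x assume x: "x \<in> Hom C t s" "q \<cdot> x = Zero C t b"
    have px: "p \<cdot> x \<in> Hom C t a" using x B comp_hom by blast
    have "p \<cdot> (i \<cdot> (p \<cdot> x)) = p \<cdot> x"
      using comp_assoc[OF px B(1,3)] B(5) comp_ide_left[OF px] by simp
    moreover have "q \<cdot> (i \<cdot> (p \<cdot> x)) = q \<cdot> x"
      using comp_assoc[OF px B(1,4)] B(8) comp_zero_left[OF px Hom_obj(2)[OF B(4)]] x(2) by simp
    ultimately have "i \<cdot> (p \<cdot> x) = x"
      using biproduct_eq[OF bp comp_hom[OF px B(1)] x(1)] by blast
    then show "\<exists>u\<in>Hom C t a. i \<cdot> u = x" using px by blast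
  qed
qed

end

section \<open>Diagram chasing in abelian categories\<close>

text \<open>Diagrams are chased with generalised elements \<open>x : t \<rightarrow> b\<close>: \<open>covers f x\<close> says that \<open>x\<close>
  lifts along \<open>f\<close> after precomposition with an epimorphism.\<close>

definition covers :: "('o, 'm) cat \<Rightarrow> 'm \<Rightarrow> 'm \<Rightarrow> bool" where
  "covers C f x \<longleftrightarrow> (\<exists>s. \<exists>e\<in>Hom C s (Dom C x). \<exists>y\<in>Hom C s (Dom C f).
     epi_arr C e \<and> f \<cdot>\<^bsub>C\<^esub> y = x \<cdot>\<^bsub>C\<^esub> e)"

lemma covers_iff:
  "\<lbrakk>f \<in> Hom C a b; x \<in> Hom C t b\<rbrakk> \<Longrightarrow> covers C f x \<longleftrightarrow>
    (\<exists>s. \<exists>e\<in>Hom C s t. \<exists>y\<in>Hom C s a. epi_arr C e \<and> f \<cdot>\<^bsub>C\<^esub> y = x \<cdot>\<^bsub>C\<^esub> e)"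
  by (simp add: covers_def Hom_iff)

definition is_pullback :: "('o, 'm) cat \<Rightarrow> 'm \<Rightarrow> 'm \<Rightarrow> 'o \<Rightarrow> 'm \<Rightarrow> 'm \<Rightarrow> bool" where
  "is_pullback C g x P p q \<longleftrightarrow> p \<in> Hom C P (Dom C x) \<and> q \<in> Hom C P (Dom C g) \<and>
     g \<cdot>\<^bsub>C\<^esub> q = x \<cdot>\<^bsub>C\<^esub> p \<and>
     (\<forall>w. \<forall>u\<in>Hom C w (Dom C x). \<forall>v\<in>Hom C w (Dom C g). g \<cdot>\<^bsub>C\<^esub> v = x \<cdot>\<^bsub>C\<^esub> u \<longrightarrow>
        (\<exists>m\<in>Hom C w P. p \<cdot>\<^bsub>C\<^esub> m = u \<and> q \<cdot>\<^bsub>C\<^esub> m = v)) \<and>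
     (\<forall>w. \<forall>m\<in>Hom C w P. \<forall>m'\<in>Hom C w P.
        p \<cdot>\<^bsub>C\<^esub> m = p \<cdot>\<^bsub>C\<^esub> m' \<and> q \<cdot>\<^bsub>C\<^esub> m = q \<cdot>\<^bsub>C\<^esub> m' \<longrightarrow> m = m')"

lemma is_pullbackD:
  assumes "is_pullback C g x P p q" "g \<in> Hom C b c" "x \<in> Hom C t c"
  shows "p \<in> Hom C P t" "q \<in> Hom C P b" "g \<cdot>\<^bsub>C\<^esub> q = x \<cdot>\<^bsub>C\<^esub> p"
    "\<lbrakk>u \<in> Hom C w t; v \<in> Hom C w b; g \<cdot>\<^bsub>C\<^esub> v = x \<cdot>\<^bsub>C\<^esub> u\<rbrakk> \<Longrightarrow>
       \<exists>m\<in>Hom C w P. p \<cdot>\<^bsub>C\<^esub> m = u \<and> q \<cdot>\<^bsub>C\<^esub> m = v"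
    "\<lbrakk>m \<in> Hom C w P; m' \<in> Hom C w P; p \<cdot>\<^bsub>C\<^esub> m = p \<cdot>\<^bsub>C\<^esub> m'; q \<cdot>\<^bsub>C\<^esub> m = q \<cdot>\<^bsub>C\<^esub> m'\<rbrakk> \<Longrightarrow> m = m'"
proof -
  have "Dom C g = b" "Dom C x = t" using assms(2,3) by (auto simp: Hom_iff)
  note P = assms(1)[unfolded is_pullback_def this]
  show "p \<in> Hom C P t" "q \<in> Hom C P b" "g \<cdot>\<^bsub>C\<^esub> q = x \<cdot>\<^bsub>C\<^esub> p" using P by blast+
  show "\<exists>m\<in>Hom C w P. p \<cdot>\<^bsub>C\<^esub> m = u \<and> q \<cdot>\<^bsub>C\<^esub> m = v"
    if "u \<in> Hom C w t" "v \<in> Hom C w b" "g \<cdot>\<^bsub>C\<^esub> v = x \<cdot>\<^bsub>C\<^esub> u" using P that by blast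
  show "m = m'"
    if "m \<in> Hom C w P" "m' \<in> Hom C w P" "p \<cdot>\<^bsub>C\<^esub> m = p \<cdot>\<^bsub>C\<^esub> m'" "q \<cdot>\<^bsub>C\<^esub> m = q \<cdot>\<^bsub>C\<^esub> m'"
    using P that by blast
qed

context abelian_category
begin

text \<open>The epimorphism is a cokernel of some \<open>h\<close>, and \<open>h\<close> factors
  through \<open>f\<close>, so whatever kills \<open>f\<close> also kills \<open>h\<close>.\<close>

lemma epi_kernel_cokernel:
  assumes g: "epi_arr C g" and k: "is_kernel C g f"
  shows "is_cokernel C f g"
proof -
  obtain h where h: "is_cokernel C h g" using epi_normal[OF g] by blast
  have hh: "h \<in> Hom C (Dom C h) (Dom C g)" and gh: "g \<in> Hom C (Dom C g) (Cod C g)"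
    using h by (auto simp: is_cokernel_def Hom_iff)
  note fh = kernel_hom[OF k gh]
  obtain w where w: "w \<in> Hom C (Dom C h) (Dom C f)" "f \<cdot> w = h"
    using kernel_lift[OF k gh fh hh cokernel_zero[OF h hh gh]] by blast
  show ?thesis
  proof (rule cokernelI[OF fh gh g kernel_zero[OF k gh fh]])
    fix t x assume x: "x \<in> Hom C (Dom C g) t" "x \<cdot> f = Zero C (Dom C f) t"
    have "x \<cdot> h = Zero C (Dom C h) t"
      using comp_assoc[OF w(1) fh x(1)] w x comp_zero_left[OF w(1) Hom_obj(2)[OF x(1)]] by simp
    then show "\<exists>u\<in>Hom C (Cod C g) t. u \<cdot> g = x" using cokernel_desc[OF h hh gh x(1)] by blast
  qed
qed

lemma mono_cokernel_kernel:
  assumes f: "mono_arr C f" and c: "is_cokernel C f g"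
  shows "is_kernel C g f"
proof -
  obtain h where h: "is_kernel C h f" using mono_normal[OF f] by blast
  have hh: "h \<in> Hom C (Cod C f) (Cod C h)" and fh: "f \<in> Hom C (Dom C f) (Cod C f)"
    using h by (auto simp: is_kernel_def Hom_iff)
  note gh = cokernel_hom[OF c fh]
  obtain w where w: "w \<in> Hom C (Cod C g) (Cod C h)" "w \<cdot> g = h"
    using cokernel_desc[OF c fh gh hh kernel_zero[OF h hh fh]] by blast
  show ?thesis
  proof (rule kernelI[OF gh fh f cokernel_zero[OF c fh gh]])
    fix t x assume x: "x \<in> Hom C t (Cod C f)" "g \<cdot> x = Zero C t (Cod C g)"
    have "h \<cdot> x = Zero C t (Cod C h)"
      using comp_assoc[OF x(1) gh w(1)] w x comp_zero_right[OF w(1) Hom_obj(1)[OF x(1)]] by simp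
    then show "\<exists>u\<in>Hom C t (Dom C f). f \<cdot> u = x" using kernel_lift[OF h hh fh x(1)] by blast
  qed
qed

text \<open>The pullback is the kernel of \<phi> \<open>= g r - x r'\<close> on the biproduct of
  \<open>b\<close> and \<open>t\<close>.\<close>

lemma pullback:
  assumes g: "g \<in> Hom C b c" and x: "x \<in> Hom C t c"
  obtains P p q where "is_pullback C g x P p q" "epi_arr C g \<Longrightarrow> epi_arr C p"
proof -
  obtain s i j r r' where bp: "biproduct C s b t i j r r'"
    using ex_biproduct Hom_obj g x by blast
  note B = biproductD[OF bp]
  define \<phi> where "\<phi> = g \<cdot> r \<boxminus> x \<cdot> r'"
  note gr = comp_hom[OF B(3) g] and xr = comp_hom[OF B(4) x]
  have \<phi>: "\<phi> \<in> Hom C s c" unfolding \<phi>_def using minus_hom[OF gr xr] .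
  have \<phi>z: "\<phi> \<cdot> z = g \<cdot> (r \<cdot> z) \<boxminus> x \<cdot> (r' \<cdot> z)" if "z \<in> Hom C w s" for w z
    unfolding \<phi>_def using comp_minus_left[OF that gr xr] comp_assoc[OF that B(3) g]
      comp_assoc[OF that B(4) x] by simp
  obtain k where k: "is_kernel C \<phi> k" using ex_kernel \<phi> by (auto simp: Hom_iff)
  define P where "P = Dom C k"
  have kh: "k \<in> Hom C P s" unfolding P_def using kernel_hom[OF k \<phi>] .
  note mono = kernel_mono[OF k]
  note rk = comp_hom[OF kh B(3)] and rk' = comp_hom[OF kh B(4)]
  have sq: "g \<cdot> (r \<cdot> k) = x \<cdot> (r' \<cdot> k)"
    using \<phi>z[OF kh] kernel_zero[OF k \<phi> kh] minus_eq_zero[OF comp_hom[OF rk g] comp_hom[OF rk' x]] by simp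
  have D: "Dom C g = b" "Dom C x = t" using g x by (auto simp: Hom_iff)
  have "is_pullback C g x P (r' \<cdot> k) (r \<cdot> k)"
    unfolding is_pullback_def D
  proof (intro conjI allI ballI impI rk rk' sq; (elim conjE)?)
    fix w u v assume u: "u \<in> Hom C w t" and v: "v \<in> Hom C w b" and e: "g \<cdot> v = x \<cdot> u"
    obtain z where z: "z \<in> Hom C w s" "r \<cdot> z = v" "r' \<cdot> z = u"
      using biproduct_pair[OF bp v u] by blast
    have "\<phi> \<cdot> z = Zero C w c" using \<phi>z[OF z(1)] z e minus_self[OF comp_hom[OF u x]] by simp
    then obtain m where m: "m \<in> Hom C w P" "k \<cdot> m = z" using kernel_lift[OF k \<phi> kh z(1)] by blast
    show "\<exists>m\<in>Hom C w P. r' \<cdot> k \<cdot> m = u \<and> r \<cdot> k \<cdot> m = v"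
      using m z comp_assoc[OF m(1) kh B(3)] comp_assoc[OF m(1) kh B(4)] by auto
  next
    fix w m m'
    assume m: "m \<in> Hom C w P" "m' \<in> Hom C w P" "r' \<cdot> k \<cdot> m = r' \<cdot> k \<cdot> m'" "r \<cdot> k \<cdot> m = r \<cdot> k \<cdot> m'"
    have "k \<cdot> m = k \<cdot> m'"
      using biproduct_eq[OF bp comp_hom[OF m(1) kh] comp_hom[OF m(2) kh]] m(3,4)
        comp_assoc[OF m(1) kh B(3)] comp_assoc[OF m(1) kh B(4)]
        comp_assoc[OF m(2) kh B(3)] comp_assoc[OF m(2) kh B(4)] by simp
    then show "m = m'" using monoD[OF mono kh m(1,2)] by blast
  qed
  \<comment> \<open>Restricted to \<open>b\<close>, \<phi> is \<open>g\<close>, so it is epi and is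
    the cokernel of its kernel \<open>k\<close>. If \<open>v\<close> kills \<open>r' k\<close>, then
    \<open>v r'\<close> factors as \<open>u\<close> after \<phi>; restriction to \<open>b\<close>
    gives \<open>u g = 0\<close>, hence \<open>u = 0\<close>, and restriction to \<open>t\<close>
    gives \<open>v = 0\<close>.\<close>
  moreover have "epi_arr C (r' \<cdot> k)" if epi: "epi_arr C g"
  proof -
    have o: "b \<in> Obj C" "t \<in> Obj C" "c \<in> Obj C" using Hom_obj B g by blast+
    have \<phi>i: "\<phi> \<cdot> i = g"
      using \<phi>z[OF B(1)] B(5,8) comp_zero_right[OF x o(1)] minus_zero[OF g] comp_ide_right[OF g] by simp
    then have "epi_arr C \<phi>" using epi_cancel[OF _ B(1) \<phi>] epi by simp
    then have ck: "is_cokernel C k \<phi>" using epi_kernel_cokernel k by blast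
    show "epi_arr C (r' \<cdot> k)"
    proof (rule epiI[OF rk'])
      fix w v assume v: "v \<in> Hom C t w" "v \<cdot> (r' \<cdot> k) = Zero C P w"
      note vr = comp_hom[OF B(4) v(1)]
      have "(v \<cdot> r') \<cdot> k = Zero C P w" using comp_assoc[OF kh B(4) v(1)] v(2) by simp
      then obtain u where u: "u \<in> Hom C c w" "u \<cdot> \<phi> = v \<cdot> r'" using cokernel_desc[OF ck kh \<phi> vr] by blast
      have wo: "w \<in> Obj C" using v Hom_obj by blast
      have "u \<cdot> g = Zero C b w"
        using comp_assoc[OF B(1) \<phi> u(1)] \<phi>i u(2) comp_assoc[OF B(1,4) v(1)] B(8) comp_zero_right[OF v(1) o(1)]
        by simp
      then have "u = Zero C c w" using epiD0[OF epi g u(1)] by blast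
      then have "v \<cdot> r' = Zero C s w" using u comp_zero_left[OF \<phi> wo] by simp
      then have "v \<cdot> (r' \<cdot> j) = Zero C t w"
        using comp_assoc[OF B(2,4) v(1)] comp_zero_left[OF B(2) wo] by simp
      then show "v = Zero C t w" using B(6) comp_ide_right[OF v(1)] by simp
    qed
  qed
  ultimately show ?thesis using that by blast
qed

text \<open>The required epimorphism is the projection of the pullback of \<open>f\<close> along
  \<open>x\<close>.\<close>

lemma epi_covers:
  assumes "epi_arr C f" "f \<in> Hom C a b" "x \<in> Hom C t b"
  shows "covers C f x"
proof -
  obtain P p q where P: "is_pullback C f x P p q" "epi_arr C p" using pullback[OF assms(2,3)] assms(1) by blast
  note D = is_pullbackD[OF P(1) assms(2,3)]
  show ?thesis unfolding covers_iff[OF assms(2,3)] using P(2) D(1-3) by blast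
qed

lemma covers_epi:
  assumes f: "f \<in> Hom C a b" and c: "covers C f (Ide C b)"
  shows "epi_arr C f"
proof -
  have b: "b \<in> Obj C" using f Hom_obj by blast
  obtain s e y where e: "e \<in> Hom C s b" "y \<in> Hom C s a" "epi_arr C e" "f \<cdot> y = Ide C b \<cdot> e"
    using c unfolding covers_iff[OF f ide_hom[OF b]] by blast
  then have "epi_arr C (f \<cdot> y)" using comp_ide_left by simp
  then show ?thesis using epi_cancel[OF _ e(2) f] by blast
qed

lemma epi_precomp_zero:
  assumes "epi_arr C e" "e \<in> Hom C s t" "x \<in> Hom C t b" "x \<cdot> e = Zero C s b"
  shows "x = Zero C t b"
  using epiD0 assms by blast

text \<open>A lift after an epimorphism becomes an honest lift: \<open>f\<close> is the kernel of
  its cokernel \<open>q\<close>, and \<open>q x\<close> vanishes because it does so after that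
  epimorphism. This is what allows kernels to be found by element chases.\<close>

lemma kernelI_covers:
  assumes f: "f \<in> Hom C a b" and g: "g \<in> Hom C b c" and mono: "mono_arr C f"
    and z: "g \<cdot> f = Zero C a c"
    and cov: "\<And>t x. \<lbrakk>x \<in> Hom C t b; g \<cdot> x = Zero C t c\<rbrakk> \<Longrightarrow> covers C f x"
  shows "is_kernel C g f"
proof (rule kernelI[OF g f mono z])
  fix t x assume x: "x \<in> Hom C t b" "g \<cdot> x = Zero C t c"
  obtain q where q: "is_cokernel C f q" using ex_cokernel f by (auto simp: Hom_iff)
  note qh = cokernel_hom[OF q f]
  have qk: "is_kernel C q f" using mono_cokernel_kernel mono q by blast
  obtain s e y where e: "e \<in> Hom C s t" "y \<in> Hom C s a" "epi_arr C e" "f \<cdot> y = x \<cdot> e"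
    using cov[OF x] unfolding covers_iff[OF f x(1)] by blast
  have qo: "Cod C q \<in> Obj C" using qh Hom_obj by blast
  have "(q \<cdot> x) \<cdot> e = Zero C s (Cod C q)"
    using comp_assoc[OF e(1) x(1) qh] e(4) comp_assoc[OF e(2) f qh] cokernel_zero[OF q f qh]
      comp_zero_left[OF e(2) qo] by simp
  then have "q \<cdot> x = Zero C t (Cod C q)" using epi_precomp_zero e comp_hom[OF x(1) qh] by blast
  then show "\<exists>u\<in>Hom C t a. f \<cdot> u = x" using kernel_lift[OF qk qh f x(1)] by blast
qed

lemma image_factorization:
  assumes f: "f \<in> Hom C a b"
  obtains k e i where "is_image C f k" "k \<in> Hom C i b" "e \<in> Hom C a i"
    "mono_arr C k" "epi_arr C e" "f = k \<cdot> e"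
proof -
  obtain q where q: "is_cokernel C f q" using ex_cokernel f by (auto simp: Hom_iff)
  note qh = cokernel_hom[OF q f]
  obtain k where k: "is_kernel C q k" using ex_kernel qh by (auto simp: Hom_iff)
  note kh = kernel_hom[OF k qh] note mono = kernel_mono[OF k]
  obtain e where e: "e \<in> Hom C a (Dom C k)" "k \<cdot> e = f"
    using kernel_lift[OF k qh kh f cokernel_zero[OF q f qh]] by blast
  \<comment> \<open>If \<open>v e = 0\<close>, then \<open>f\<close> factors through the smaller
    subobject \<open>k l\<close>, where \<open>l\<close> is the kernel of \<open>v\<close>. The
    cokernel \<open>r\<close> of \<open>k l\<close> kills \<open>f\<close>, so it factors through
    \<open>q\<close> and kills \<open>k\<close>; thus \<open>k\<close> factors through
    \<open>k l\<close>, \<open>l\<close> is split epi, and \<open>v = 0\<close>.\<close>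
  have "epi_arr C e"
  proof (rule epiI[OF e(1)])
    fix w v assume v: "v \<in> Hom C (Dom C k) w" "v \<cdot> e = Zero C a w"
    obtain l where l: "is_kernel C v l" using ex_kernel v by (auto simp: Hom_iff)
    note lh = kernel_hom[OF l v(1)] note lm = kernel_mono[OF l]
    obtain e' where e': "e' \<in> Hom C a (Dom C l)" "l \<cdot> e' = e"
      using kernel_lift[OF l v(1) lh e(1) v(2)] by blast
    note klh = comp_hom[OF lh kh]
    have klm: "mono_arr C (k \<cdot> l)" using mono_comp lm lh mono kh by blast
    obtain r where r: "is_cokernel C (k \<cdot> l) r" using ex_cokernel klh by (auto simp: Hom_iff)
    note rh = cokernel_hom[OF r klh]
    have rk: "is_kernel C r (k \<cdot> l)" using mono_cokernel_kernel klm r by blast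
    have ro: "Cod C r \<in> Obj C" using rh Hom_obj by blast
    have "(k \<cdot> l) \<cdot> e' = f" using comp_assoc[OF e'(1) lh kh] e' e by simp
    then have "r \<cdot> f = Zero C a (Cod C r)"
      using comp_assoc[OF e'(1) klh rh] cokernel_zero[OF r klh rh] comp_zero_left[OF e'(1) ro] by simp
    then obtain r' where r': "r' \<in> Hom C (Cod C q) (Cod C r)" "r' \<cdot> q = r"
      using cokernel_desc[OF q f qh rh] by blast
    have ko: "Dom C k \<in> Obj C" using kh Hom_obj by blast
    have "r \<cdot> k = Zero C (Dom C k) (Cod C r)"
      using comp_assoc[OF kh qh r'(1)] r'(2) kernel_zero[OF k qh kh] comp_zero_right[OF r'(1) ko] by simp
    then obtain m where m: "m \<in> Hom C (Dom C k) (Dom C l)" "(k \<cdot> l) \<cdot> m = k"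
      using kernel_lift[OF rk rh klh kh] by blast
    have "k \<cdot> (l \<cdot> m) = k \<cdot> Ide C (Dom C k)"
      using m comp_assoc[OF m(1) lh kh] comp_ide_right[OF kh] by simp
    then have lm1: "l \<cdot> m = Ide C (Dom C k)" using monoD[OF mono kh comp_hom[OF m(1) lh] ide_hom[OF ko]] by blast
    have wo: "w \<in> Obj C" using v Hom_obj by blast
    have "v \<cdot> (l \<cdot> m) = Zero C (Dom C k) w"
      using comp_assoc[OF m(1) lh v(1)] kernel_zero[OF l v(1) lh] comp_zero_left[OF m(1) wo] by simp
    then show "v = Zero C (Dom C k) w" using lm1 comp_ide_right[OF v(1)] by simp
  qed
  then show ?thesis using that[of k "Dom C k" e] q k kh mono e unfolding is_image_def by blast
qed

text \<open>An arbitrary image \<open>k\<close> is compared with the constructed one: each factors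
  through the other, which makes the comparison \<open>u\<close> a split epimorphism, so
  \<open>u e\<close> is epi.\<close>

lemma image_epi:
  assumes f: "f \<in> Hom C a b" and k: "is_image C f k"
  shows "k \<in> Hom C (Dom C k) b" "mono_arr C k" "\<exists>e\<in>Hom C a (Dom C k). epi_arr C e \<and> f = k \<cdot> e"
proof -
  obtain q where q: "is_cokernel C f q" "is_kernel C q k" using k unfolding is_image_def by blast
  note qh = cokernel_hom[OF q(1) f]
  show kh: "k \<in> Hom C (Dom C k) b" using kernel_hom[OF q(2) qh] .
  show km: "mono_arr C k" using kernel_mono q by blast
  obtain l e i where l: "is_image C f l" "l \<in> Hom C i b" "e \<in> Hom C a i"
    "mono_arr C l" "epi_arr C e" "f = l \<cdot> e" using image_factorization[OF f] by blast
  have lq: "q \<cdot> l = Zero C i (Cod C q)"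
  proof (rule epi_precomp_zero[OF l(5,3) comp_hom[OF l(2) qh]])
    show "q \<cdot> l \<cdot> e = Zero C a (Cod C q)"
      using comp_assoc[OF l(3,2) qh] l(6) cokernel_zero[OF q(1) f qh] by simp
  qed
  obtain u where u: "u \<in> Hom C i (Dom C k)" "k \<cdot> u = l" using kernel_lift[OF q(2) qh kh l(2) lq] by blast
  obtain q' where q': "is_cokernel C f q'" "is_kernel C q' l" using l(1) unfolding is_image_def by blast
  note qh' = cokernel_hom[OF q'(1) f]
  obtain r where r: "r \<in> Hom C (Cod C q) (Cod C q')" "r \<cdot> q = q'"
    using cokernel_desc[OF q(1) f qh qh' cokernel_zero[OF q'(1) f qh']] by blast
  have ko: "Dom C k \<in> Obj C" using kh Hom_obj by blast
  have "q' \<cdot> k = Zero C (Dom C k) (Cod C q')"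
    using comp_assoc[OF kh qh r(1)] r(2) kernel_zero[OF q(2) qh kh] comp_zero_right[OF r(1) ko] by simp
  then obtain v where v: "v \<in> Hom C (Dom C k) i" "l \<cdot> v = k" using kernel_lift[OF q'(2) qh' l(2) kh] by blast
  have "k \<cdot> (u \<cdot> v) = k \<cdot> Ide C (Dom C k)"
    using comp_assoc[OF v(1) u(1) kh] u v comp_ide_right[OF kh] by simp
  then have "u \<cdot> v = Ide C (Dom C k)" using monoD[OF km kh comp_hom[OF v(1) u(1)] ide_hom[OF ko]] by blast
  then have "epi_arr C u" using epi_cancel[OF _ v(1) u(1)] epi_ide[OF ko] by simp
  then have "epi_arr C (u \<cdot> e)" using epi_comp[OF l(5,3) _ u(1)] by blast
  moreover have "k \<cdot> (u \<cdot> e) = f" using comp_assoc[OF l(3) u(1) kh] u l(6) by simp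
  ultimately show "\<exists>e\<in>Hom C a (Dom C k). epi_arr C e \<and> f = k \<cdot> e" using comp_hom[OF l(3) u(1)] by auto
qed

text \<open>The form in which exactness is used and proved from here on: images and cokernels
  disappear, and a cycle only has to lift locally.\<close>

lemma exact_at_iff:
  assumes f: "f \<in> Hom C a b" and g: "g \<in> Hom C b c"
  shows "exact_at C f g \<longleftrightarrow> g \<cdot> f = Zero C a c \<and>
    (\<forall>t. \<forall>x\<in>Hom C t b. g \<cdot> x = Zero C t c \<longrightarrow> covers C f x)" (is "_ \<longleftrightarrow> ?R")
proof
  assume "exact_at C f g"
  then obtain k where k: "is_image C f k" "is_kernel C g k" unfolding exact_at_def by blast
  note I = image_epi[OF f k(1)]
  obtain e where e: "e \<in> Hom C a (Dom C k)" "epi_arr C e" "f = k \<cdot> e" using I by blast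
  have co: "c \<in> Obj C" using g Hom_obj by blast
  have "g \<cdot> f = Zero C a c"
    using comp_assoc[OF e(1) I(1) g] e kernel_zero[OF k(2) g I(1)] comp_zero_left[OF e(1) co] by simp
  moreover have "covers C f x" if x: "x \<in> Hom C t b" "g \<cdot> x = Zero C t c" for t x
  proof -
    obtain y where y: "y \<in> Hom C t (Dom C k)" "k \<cdot> y = x" using kernel_lift[OF k(2) g I(1) x] by blast
    obtain s d z where d: "d \<in> Hom C s t" "z \<in> Hom C s a" "epi_arr C d" "e \<cdot> z = y \<cdot> d"
      using epi_covers[OF e(2,1) y(1)] unfolding covers_iff[OF e(1) y(1)] by blast
    have "f \<cdot> z = x \<cdot> d" using comp_assoc[OF d(2) e(1) I(1)] e(3) d(4) comp_assoc[OF d(1) y(1) I(1)] y(2) by simp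
    then show ?thesis unfolding covers_iff[OF f x(1)] using d by blast
  qed
  ultimately show ?R by blast
next
  assume R: ?R
  obtain k e i where k: "is_image C f k" "k \<in> Hom C i b" "e \<in> Hom C a i"
    "mono_arr C k" "epi_arr C e" "f = k \<cdot> e" using image_factorization[OF f] by blast
  have "is_kernel C g k"
  proof (rule kernelI_covers[OF k(2) g k(4)])
    show "g \<cdot> k = Zero C i c"
      using epi_precomp_zero[OF k(5,3) comp_hom[OF k(2) g]] comp_assoc[OF k(3,2) g] k(6) R by simp
    fix t x assume x: "x \<in> Hom C t b" "g \<cdot> x = Zero C t c"
    then have "covers C f x" using R by blast
    then obtain s d z where d: "d \<in> Hom C s t" "z \<in> Hom C s a" "epi_arr C d" "f \<cdot> z = x \<cdot> d"
      unfolding covers_iff[OF f x(1)] by blast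
    then show "covers C k x" unfolding covers_iff[OF k(2) x(1)]
      using comp_assoc[OF d(2) k(3,2)] k(6) comp_hom[OF d(2) k(3)] by metis
  qed
  then show "exact_at C f g" unfolding exact_at_def using k(1) by blast
qed

lemma exact_at_kernel:
  assumes "is_kernel C g f"
  shows "exact_at C f g"
proof -
  obtain f': "mono_arr C f" and g: "g \<in> Hom C (Dom C g) (Cod C g)" using assms kernel_mono
    by (auto simp: is_kernel_def Hom_iff)
  note f = kernel_hom[OF assms g]
  obtain q where q: "is_cokernel C f q" using ex_cokernel f by (auto simp: Hom_iff)
  then show ?thesis unfolding exact_at_def is_image_def using mono_cokernel_kernel[OF f'] assms by blast
qed

lemma kernel_exact_at:
  assumes "mono_arr C f" "f \<in> Hom C a b" "g \<in> Hom C b c" "exact_at C f g"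
  shows "is_kernel C g f"
  using kernelI_covers[OF assms(2,3,1)] assms(4) unfolding exact_at_iff[OF assms(2,3)] by blast

lemma covers_zero:
  assumes f: "f \<in> Hom C a b" and t: "t \<in> Obj C"
  shows "covers C f (Zero C t b)"
proof -
  have o: "a \<in> Obj C" "b \<in> Obj C" using f Hom_obj by auto
  show ?thesis unfolding covers_iff[OF f zero_hom[OF t o(2)]]
    using ide_hom[OF t] epi_ide[OF t] zero_hom[OF t o(1)] comp_zero_right[OF f t]
      comp_zero_left[OF ide_hom[OF t] o(2)] by metis
qed

lemma mono_iff_exact_at:
  assumes z: "zero_object C z" and f: "f \<in> Hom C a b"
  shows "exact_at C (Zero C z a) f \<longleftrightarrow> mono_arr C f"
proof -
  have zo: "z \<in> Obj C" and ao: "a \<in> Obj C" and bo: "b \<in> Obj C" using z f Hom_obj by (auto simp: zero_object_def)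
  note zh = zero_hom[OF zo ao]
  show ?thesis
  proof
    assume ex: "exact_at C (Zero C z a) f"
    show "mono_arr C f"
    proof (rule monoI[OF f])
      fix t x assume x: "x \<in> Hom C t a" "f \<cdot> x = Zero C t b"
      then have "covers C (Zero C z a) x" using ex unfolding exact_at_iff[OF zh f] by blast
      then obtain s e y where e: "e \<in> Hom C s t" "y \<in> Hom C s z" "epi_arr C e" "Zero C z a \<cdot> y = x \<cdot> e"
        unfolding covers_iff[OF zh x(1)] by blast
      then have "x \<cdot> e = Zero C s a" using comp_zero_left[OF e(2) ao] by simp
      then show "x = Zero C t a" using epi_precomp_zero[OF e(3,1) x(1)] by blast
    qed
  next
    assume m: "mono_arr C f"
    show "exact_at C (Zero C z a) f" unfolding exact_at_iff[OF zh f]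
      using comp_zero_right[OF f zo] monoD0[OF m f] covers_zero[OF zh] Hom_obj by metis
  qed
qed

lemma epi_iff_exact_at:
  assumes z: "zero_object C z" and f: "f \<in> Hom C a b"
  shows "exact_at C f (Zero C b z) \<longleftrightarrow> epi_arr C f"
proof -
  have zo: "z \<in> Obj C" and ao: "a \<in> Obj C" and bo: "b \<in> Obj C" using z f Hom_obj by (auto simp: zero_object_def)
  note zh = zero_hom[OF bo zo]
  show ?thesis
  proof
    assume ex: "exact_at C f (Zero C b z)"
    have "Zero C b z \<cdot> Ide C b = Zero C b z" using comp_ide_right[OF zh] .
    then have "covers C f (Ide C b)" using ex ide_hom[OF bo] unfolding exact_at_iff[OF f zh] by blast
    then show "epi_arr C f" using covers_epi[OF f] by blast
  next
    assume "epi_arr C f"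
    then show "exact_at C f (Zero C b z)" unfolding exact_at_iff[OF f zh]
      using comp_zero_left[OF f zo] epi_covers[OF _ f] by metis
  qed
qed

end

section \<open>Short exact sequences and dimension shifting\<close>

text \<open>All three objects are named, so that hom-set facts follow without \<open>Dom\<close> and
  \<open>Cod\<close>; \<open>short_exact_iff\<close> connects it with
  \<open>short_exact\<close>.\<close>

definition ses :: "('o, 'm) cat \<Rightarrow> 'o \<Rightarrow> 'm \<Rightarrow> 'o \<Rightarrow> 'm \<Rightarrow> 'o \<Rightarrow> bool" where
  "ses C a f b g c \<longleftrightarrow> f \<in> Hom C a b \<and> g \<in> Hom C b c \<and> is_kernel C g f \<and> epi_arr C g"

text \<open>If \<open>ses C Y f J g S\<close> holds with \<open>J\<close> injective, then Ext^1(X,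
  Y) is the cokernel of Hom(X, J) \<rightarrow> Hom(X, S), so \<open>lifts C X g\<close> is its
  vanishing.\<close>

definition lifts :: "('o, 'm) cat \<Rightarrow> 'o \<Rightarrow> 'm \<Rightarrow> bool" where
  "lifts C X g \<longleftrightarrow> (\<forall>f\<in>Hom C X (Cod C g). \<exists>h\<in>Hom C X (Dom C g). g \<cdot>\<^bsub>C\<^esub> h = f)"

lemma liftsI:
  "\<lbrakk>g \<in> Hom C b c; \<And>f. f \<in> Hom C X c \<Longrightarrow> \<exists>h\<in>Hom C X b. g \<cdot>\<^bsub>C\<^esub> h = f\<rbrakk> \<Longrightarrow> lifts C X g"
  by (simp add: lifts_def Hom_iff)

lemma liftsD:
  "\<lbrakk>lifts C X g; g \<in> Hom C b c; f \<in> Hom C X c\<rbrakk> \<Longrightarrow> \<exists>h\<in>Hom C X b. g \<cdot>\<^bsub>C\<^esub> h = f"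
  by (simp add: lifts_def Hom_iff)

lemma exact_list_successively: "exact_list C fs \<longleftrightarrow> successively (exact_at C) fs"
  unfolding exact_list_def successively_conv_nth by (auto simp: Suc_less_eq)

lemma exact_at_arr:
  assumes "exact_at C f g"
  shows "f \<in> Arr C" "g \<in> Arr C" "Cod C f = Dom C g"
  using assms unfolding exact_at_def is_image_def is_kernel_def is_cokernel_def by auto

lemma injective_extend:
  assumes "injective_object C J" "mono_arr C m" "m \<in> Hom C a b" "h \<in> Hom C a J"
  shows "\<exists>h'\<in>Hom C b J. h' \<cdot>\<^bsub>C\<^esub> m = h"
  using assms unfolding injective_object_def by (auto simp: Hom_iff)

text \<open>\<open>ext_acyclic C A i Y\<close> expresses \<open>Ext\<^sup>j(A, Y) = 0\<close> for \<open>1 \<le> j \<le> i\<close> through an injective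
  coresolution of \<open>Y\<close>.\<close>

primrec ext_acyclic :: "('o, 'm) cat \<Rightarrow> 'o set \<Rightarrow> nat \<Rightarrow> 'o \<Rightarrow> bool" where
  "ext_acyclic C A 0 Y \<longleftrightarrow> True"
| "ext_acyclic C A (Suc i) Y \<longleftrightarrow> (\<exists>J S f g. injective_object C J \<and> ses C Y f J g S \<and>
     (\<forall>X\<in>A. lifts C X g) \<and> ext_acyclic C A i S)"

context abelian_category
begin

lemma sesD:
  assumes "ses C a f b g c"
  shows "f \<in> Hom C a b" "g \<in> Hom C b c" "mono_arr C f" "epi_arr C g" "g \<cdot> f = Zero C a c"
    "is_kernel C g f" "is_cokernel C f g" "exact_at C f g"
  using assms kernel_mono kernel_zero epi_kernel_cokernel exact_at_kernel unfolding ses_def by auto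

lemma ses_lift:
  assumes "ses C a f b g c" "x \<in> Hom C t b" "g \<cdot> x = Zero C t c"
  shows "\<exists>u\<in>Hom C t a. f \<cdot> u = x"
  using kernel_lift sesD[OF assms(1)] assms(2,3) by blast

lemma ses_desc:
  assumes "ses C a f b g c" "x \<in> Hom C b t" "x \<cdot> f = Zero C a t"
  shows "\<exists>u\<in>Hom C c t. u \<cdot> g = x"
  using cokernel_desc sesD[OF assms(1)] assms(2,3) by blast

lemma ses_cover:
  assumes "ses C a f b g c" "x \<in> Hom C t c"
  obtains s e y where "e \<in> Hom C s t" "epi_arr C e" "y \<in> Hom C s b" "g \<cdot> y = x \<cdot> e"
  using epi_covers[OF sesD(4,2)[OF assms(1)] assms(2)]
  unfolding covers_iff[OF sesD(2)[OF assms(1)] assms(2)] by blast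

lemma mono_ses:
  assumes f: "mono_arr C f" "f \<in> Hom C a b"
  obtains c g where "ses C a f b g c"
proof -
  obtain g where g: "is_cokernel C f g" using ex_cokernel f by (auto simp: Hom_iff)
  have "ses C a f b g (Cod C g)"
    unfolding ses_def
    using g f cokernel_hom[OF g f(2)] mono_cokernel_kernel[OF f(1) g] cokernel_epi[OF g] by blast
  then show ?thesis using that by blast
qed

text \<open>The outer zeros amount to monicity of the first arrow and epicity of the last, so the
  chosen zero object drops out.\<close>

lemma exact_bounded_iff:
  "exact_bounded C fs \<longleftrightarrow>
     fs \<noteq> [] \<and> mono_arr C (hd fs) \<and> epi_arr C (last fs) \<and> exact_list C fs"
proof (cases "fs = []")
  case True
  then show ?thesis by (simp add: exact_bounded_def)
next
  case False
  have *: "exact_list C ([Zero C z (Dom C (hd fs))] @ fs @ [Zero C (Cod C (last fs)) z]) \<longleftrightarrow>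
      exact_at C (Zero C z (Dom C (hd fs))) (hd fs) \<and> exact_list C fs \<and>
      exact_at C (last fs) (Zero C (Cod C (last fs)) z)" for z
    unfolding exact_list_successively using False by (auto simp: successively_append_iff successively_Cons)
  have m: "exact_at C (Zero C z (Dom C (hd fs))) (hd fs) \<longleftrightarrow> mono_arr C (hd fs)" if "zero_object C z" for z
  proof -
    have "mono_arr C (hd fs) \<Longrightarrow> hd fs \<in> Arr C" by (simp add: mono_arr_def)
    then show ?thesis using mono_iff_exact_at[OF that Hom_Arr] exact_at_arr(2) by metis
  qed
  have e: "exact_at C (last fs) (Zero C (Cod C (last fs)) z) \<longleftrightarrow> epi_arr C (last fs)" if "zero_object C z" for z
  proof -
    have "epi_arr C (last fs) \<Longrightarrow> last fs \<in> Arr C" by (simp add: epi_arr_def)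
    then show ?thesis using epi_iff_exact_at[OF that Hom_Arr] exact_at_arr(1) by metis
  qed
  show ?thesis unfolding exact_bounded_def * using False m e ex_zero_object by blast
qed

lemma short_exact_iff: "short_exact C f g \<longleftrightarrow> ses C (Dom C f) f (Dom C g) g (Cod C g)"
proof
  assume "short_exact C f g"
  then have *: "mono_arr C f" "epi_arr C g" "exact_at C f g"
    unfolding short_exact_def exact_bounded_iff exact_list_successively by auto
  then have h: "f \<in> Hom C (Dom C f) (Dom C g)" "g \<in> Hom C (Dom C g) (Cod C g)"
    using exact_at_arr by (auto simp: Hom_iff)
  then show "ses C (Dom C f) f (Dom C g) g (Cod C g)"
    unfolding ses_def using kernel_exact_at[OF *(1) h *(3)] * by blast
next
  assume "ses C (Dom C f) f (Dom C g) g (Cod C g)"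
  then show "short_exact C f g"
    unfolding short_exact_def exact_bounded_iff exact_list_successively using sesD by auto
qed

lemma ses_short_exact: "ses C a f b g c \<Longrightarrow> short_exact C f g"
  unfolding short_exact_iff by (auto simp: ses_def Hom_iff)

lemma biproduct_ses:
  assumes "biproduct C s a b i j p q"
  shows "ses C a i s q b"
  unfolding ses_def using biproductD[OF assms] biproduct_kernel[OF assms] biproduct_epi[OF assms] by blast

text \<open>Exactness makes \<open>g\<close> the cokernel of the image of \<open>f\<close>, and
  \<open>h\<close> kills that image because it does so after the epimorphism
  \<open>e\<close>.\<close>

lemma exact_desc_epi:
  assumes ex: "exact_at C f g" and f: "f \<in> Hom C a b" and g: "g \<in> Hom C b c" and epi: "epi_arr C g"
    and h: "h \<in> Hom C b t" "h \<cdot> f = Zero C a t"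
  shows "\<exists>u\<in>Hom C c t. u \<cdot> g = h"
proof -
  obtain k where k: "is_image C f k" "is_kernel C g k" using ex unfolding exact_at_def by blast
  note I = image_epi[OF f k(1)]
  obtain e where e: "e \<in> Hom C a (Dom C k)" "epi_arr C e" "f = k \<cdot> e" using I by blast
  have "h \<cdot> k = Zero C (Dom C k) t"
    using epi_precomp_zero[OF e(2,1) comp_hom[OF I(1) h(1)]] comp_assoc[OF e(1) I(1) h(1)] e(3) h(2) by simp
  then show ?thesis using cokernel_desc[OF epi_kernel_cokernel[OF epi k(2)] I(1) g h(1)] by blast
qed

text \<open>The inductive step for comparison maps and homotopies: \<open>h\<close> descends to the
  image of \<open>g\<close>, and injectivity extends it from there to all of
  \<open>c\<close>.\<close>

lemma exact_extend_injective:
  assumes ex: "exact_at C f g" and f: "f \<in> Hom C a b" and g: "g \<in> Hom C b c"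
    and J: "injective_object C J" and h: "h \<in> Hom C b J" "h \<cdot> f = Zero C a J"
  shows "\<exists>u\<in>Hom C c J. u \<cdot> g = h"
proof -
  obtain k e i where k: "k \<in> Hom C i c" "e \<in> Hom C b i"
    "mono_arr C k" "epi_arr C e" "g = k \<cdot> e" using image_factorization[OF g] by blast
  have io: "i \<in> Obj C" and ao: "a \<in> Obj C" using k f Hom_obj by blast+
  have "exact_at C f e"
    unfolding exact_at_iff[OF f k(2)]
  proof (intro conjI allI ballI impI)
    have "k \<cdot> (e \<cdot> f) = Zero C a c" using ex comp_assoc[OF f k(2,1)] k(5) unfolding exact_at_iff[OF f g] by simp
    then show "e \<cdot> f = Zero C a i" using monoD0[OF k(3,1) comp_hom[OF f k(2)]] by blast
    fix t x assume x: "x \<in> Hom C t b" "e \<cdot> x = Zero C t i"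
    have "g \<cdot> x = Zero C t c"
      using comp_assoc[OF x(1) k(2,1)] k(5) x comp_zero_right[OF k(1) Hom_obj(1)[OF x(1)]] by simp
    then show "covers C f x" using ex x unfolding exact_at_iff[OF f g] by blast
  qed
  then obtain u where u: "u \<in> Hom C i J" "u \<cdot> e = h" using exact_desc_epi[OF _ f k(2,4) h] by blast
  obtain v where v: "v \<in> Hom C c J" "v \<cdot> k = u" using injective_extend[OF J k(3,1) u(1)] by blast
  have "v \<cdot> g = h" using comp_assoc[OF k(2,1) v(1)] k(5) v u by simp
  then show ?thesis using v by blast
qed

text \<open>\<open>P\<close> is the quotient \<open>d/a\<close>, with subobject
  \<open>c = b/a\<close> and quotient \<open>e = d/b\<close>. The two squares are recorded since
  lifts are carried across them later.\<close>

lemma third_isomorphism: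
  assumes s1: "ses C a f b g c" and s2: "ses C b f' d g' e"
  obtains P r s t where "ses C a (f' \<cdot> f) d r P" "ses C c s P t e" "s \<cdot> g = r \<cdot> f'" "t \<cdot> r = g'"
proof -
  note A = sesD[OF s1] note B = sesD[OF s2]
  note ffh = comp_hom[OF A(1) B(1)]
  obtain P r where r: "ses C a (f' \<cdot> f) d r P"
    using mono_ses[OF mono_comp[OF A(3,1) B(3,1)] ffh] by blast
  note R = sesD[OF r]
  have o: "a \<in> Obj C" "e \<in> Obj C" "P \<in> Obj C" "c \<in> Obj C" using A B R Hom_obj by blast+
  have "r \<cdot> f' \<cdot> f = Zero C a P" using R(5) comp_assoc[OF A(1) B(1) R(2)] by simp
  then obtain s where s: "s \<in> Hom C c P" "s \<cdot> g = r \<cdot> f'" using ses_desc[OF s1 comp_hom[OF B(1) R(2)]] by blast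
  have "g' \<cdot> (f' \<cdot> f) = Zero C a e"
    using comp_assoc[OF A(1) B(1,2)] B(5) comp_zero_left[OF A(1) o(2)] by simp
  then obtain t where t: "t \<in> Hom C P e" "t \<cdot> r = g'" using ses_desc[OF r B(2)] by blast
  have mono: "mono_arr C s"
  proof (rule monoI[OF s(1)])
    fix w x assume x: "x \<in> Hom C w c" "s \<cdot> x = Zero C w P"
    obtain v z y where c: "z \<in> Hom C v w" "epi_arr C z" "y \<in> Hom C v b" "g \<cdot> y = x \<cdot> z"
      using ses_cover[OF s1 x(1)] by blast
    have "r \<cdot> (f' \<cdot> y) = (r \<cdot> f') \<cdot> y" using comp_assoc[OF c(3) B(1) R(2)] by simp
    also have "\<dots> = s \<cdot> (g \<cdot> y)" using comp_assoc[OF c(3) A(2) s(1)] s(2) by simp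
    also have "\<dots> = Zero C v P"
      using c(4) comp_assoc[OF c(1) x(1) s(1)] x(2) comp_zero_left[OF c(1) o(3)] by simp
    finally obtain u where u: "u \<in> Hom C v a" "f' \<cdot> f \<cdot> u = f' \<cdot> y"
      using ses_lift[OF r comp_hom[OF c(3) B(1)]] by blast
    have "f' \<cdot> (f \<cdot> u) = f' \<cdot> y" using u comp_assoc[OF u(1) A(1) B(1)] by simp
    then have "f \<cdot> u = y" using monoD[OF B(3,1) comp_hom[OF u(1) A(1)] c(3)] by blast
    then have "x \<cdot> z = Zero C v c" using c(4) comp_assoc[OF u(1) A(1,2)] A(5) comp_zero_left[OF u(1) o(4)] by simp
    then show "x = Zero C w c" using epi_precomp_zero c x by blast
  qed
  have "ses C c s P t e"
    unfolding ses_def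
  proof (intro conjI kernelI_covers[OF s(1) t(1) mono] s(1) t(1))
    have "(t \<cdot> s) \<cdot> g = Zero C b e"
      using comp_assoc[OF A(2) s(1) t(1)] s(2) comp_assoc[OF B(1) R(2) t(1)] t(2) B(5) by simp
    then show "t \<cdot> s = Zero C c e" using epi_precomp_zero[OF A(4,2) comp_hom[OF s(1) t(1)]] by blast
    show "epi_arr C t" using epi_cancel[OF _ R(2) t(1)] B(4) t(2) by simp
    fix w x assume x: "x \<in> Hom C w P" "t \<cdot> x = Zero C w e"
    obtain v z y where c: "z \<in> Hom C v w" "epi_arr C z" "y \<in> Hom C v d" "r \<cdot> y = x \<cdot> z"
      using ses_cover[OF r x(1)] by blast
    have "g' \<cdot> y = t \<cdot> (r \<cdot> y)" using comp_assoc[OF c(3) R(2) t(1)] t(2) by simp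
    also have "\<dots> = Zero C v e"
      using c(4) comp_assoc[OF c(1) x(1) t(1)] x(2) comp_zero_left[OF c(1) o(2)] by simp
    finally obtain u where u: "u \<in> Hom C v b" "f' \<cdot> u = y" using ses_lift[OF s2 c(3)] by blast
    have "s \<cdot> (g \<cdot> u) = x \<cdot> z"
      using comp_assoc[OF u(1) A(2) s(1)] s(2) comp_assoc[OF u(1) B(1) R(2)] u(2) c(4) by simp
    then show "covers C s x" unfolding covers_iff[OF s(1) x(1)] using c comp_hom[OF u(1) A(2)] by blast
  qed
  then show ?thesis using that r s(2) t(2) by blast
qed

text \<open>The pushout of \<open>b\<close> along \<open>a \<rightarrow> J\<close> splits as \<open>J \<oplus> c\<close>, because \<open>a \<rightarrow> J\<close> extends to \<open>b\<close>.\<close>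

lemma pushout_injective:
  assumes s1: "ses C a f b g c" and s2: "ses C a f' J g' S" and J: "injective_object C J"
    and bp: "biproduct C Q J c i j p q"
  obtains m \<pi> where "ses C b m Q \<pi> S" "\<pi> \<cdot> i = g'"
proof -
  note A = sesD[OF s1] note B = sesD[OF s2] note P = biproductD[OF bp]
  have o: "a \<in> Obj C" "b \<in> Obj C" "c \<in> Obj C" "S \<in> Obj C" "J \<in> Obj C" using A B Hom_obj by blast+
  obtain h where h: "h \<in> Hom C b J" "h \<cdot> f = f'" using injective_extend[OF J A(3,1) B(1)] by blast
  have "g' \<cdot> h \<cdot> f = Zero C a S" using comp_assoc[OF A(1) h(1) B(2)] h(2) B(5) by simp
  then obtain k where k: "k \<in> Hom C c S" "k \<cdot> g = g' \<cdot> h" using ses_desc[OF s1 comp_hom[OF h(1) B(2)]] by blast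
  obtain m where m: "m \<in> Hom C b Q" "p \<cdot> m = h" "q \<cdot> m = g" using biproduct_pair[OF bp h(1) A(2)] by blast
  note gp = comp_hom[OF P(3) B(2)] and kq = comp_hom[OF P(4) k(1)]
  \<comment> \<open>\<open>Q\<close> stands for the pushout, with \<open>b\<close> embedded by
    \<open>m = (h, g)\<close>. The arrow \<open>k\<close> is induced by \<open>g' h\<close>, and the
    minus sign makes \<pi> kill \<open>m\<close>.\<close>
  define \<pi> where "\<pi> = g' \<cdot> p \<boxminus> k \<cdot> q"
  have \<pi>: "\<pi> \<in> Hom C Q S" unfolding \<pi>_def using minus_hom[OF gp kq] .
  have \<pi>x: "\<pi> \<cdot> x = g' \<cdot> (p \<cdot> x) \<boxminus> k \<cdot> (q \<cdot> x)" if "x \<in> Hom C w Q" for w x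
    unfolding \<pi>_def using comp_minus_left[OF that gp kq] comp_assoc[OF that P(3) B(2)]
      comp_assoc[OF that P(4) k(1)] by simp
  have \<pi>i: "\<pi> \<cdot> i = g'"
    using \<pi>x[OF P(1)] P(5,8) comp_zero_right[OF k(1) o(5)] minus_zero[OF B(2)] comp_ide_right[OF B(2)] by simp
  have px: "p \<cdot> (m \<cdot> x) = h \<cdot> x" "q \<cdot> (m \<cdot> x) = g \<cdot> x" if "x \<in> Hom C w b" for w x
    using comp_assoc[OF that m(1) P(3)] comp_assoc[OF that m(1) P(4)] m by simp_all
  have mono: "mono_arr C m"
  proof (rule monoI[OF m(1)])
    fix w x assume x: "x \<in> Hom C w b" "m \<cdot> x = Zero C w Q"
    have w: "w \<in> Obj C" using x Hom_obj by blast
    have hx: "h \<cdot> x = Zero C w J" "g \<cdot> x = Zero C w c"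
      using px[OF x(1)] x(2) comp_zero_right[OF P(3) w] comp_zero_right[OF P(4) w] by simp_all
    obtain y where y: "y \<in> Hom C w a" "f \<cdot> y = x" using ses_lift[OF s1 x(1) hx(2)] by blast
    have "f' \<cdot> y = Zero C w J" using comp_assoc[OF y(1) A(1) h(1)] y h hx by simp
    then have "y = Zero C w a" using monoD0[OF B(3,1) y(1)] by blast
    then show "x = Zero C w b" using y comp_zero_right[OF A(1) w] by simp
  qed
  have "ses C b m Q \<pi> S"
    unfolding ses_def
  proof (intro conjI kernelI_covers[OF m(1) \<pi> mono] m(1) \<pi>)
    show "\<pi> \<cdot> m = Zero C b S" using \<pi>x[OF m(1)] m k(2) minus_self[OF comp_hom[OF h(1) B(2)]] by simp
    show "epi_arr C \<pi>" using epi_cancel[OF _ P(1) \<pi>] \<pi>i B(4) by simp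
    fix w x assume x: "x \<in> Hom C w Q" "\<pi> \<cdot> x = Zero C w S"
    note pxh = comp_hom[OF x(1) P(3)] and qxh = comp_hom[OF x(1) P(4)]
    have e1: "g' \<cdot> (p \<cdot> x) = k \<cdot> (q \<cdot> x)"
      using \<pi>x[OF x(1)] x(2) minus_eq_zero[OF comp_hom[OF pxh B(2)] comp_hom[OF qxh k(1)]] by simp
    obtain v z y where c: "z \<in> Hom C v w" "epi_arr C z" "y \<in> Hom C v b" "g \<cdot> y = q \<cdot> x \<cdot> z"
      using ses_cover[OF s1 qxh] by blast
    note pxz = comp_hom[OF c(1) pxh] and hy = comp_hom[OF c(3) h(1)]
    have vo: "v \<in> Obj C" using c Hom_obj by blast
    have "g' \<cdot> (p \<cdot> x \<cdot> z) = k \<cdot> (q \<cdot> x \<cdot> z)"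
      using comp_assoc[OF c(1) pxh B(2)] e1 comp_assoc[OF c(1) qxh k(1)] by simp
    also have "\<dots> = g' \<cdot> (h \<cdot> y)"
      using c(4) comp_assoc[OF c(3) A(2) k(1)] k(2) comp_assoc[OF c(3) h(1) B(2)] by simp
    finally have "g' \<cdot> (p \<cdot> x \<cdot> z \<boxminus> h \<cdot> y) = Zero C v S"
      using comp_minus_right[OF pxz hy B(2)] minus_self[OF comp_hom[OF hy B(2)]] by simp
    then obtain u where u: "u \<in> Hom C v a" "f' \<cdot> u = p \<cdot> x \<cdot> z \<boxminus> h \<cdot> y"
      using ses_lift[OF s2 minus_hom[OF pxz hy]] by blast
    note fu = comp_hom[OF u(1) A(1)]
    \<comment> \<open>The lift \<open>y\<close> is correct only in its component at
      \<open>c\<close>. Its error in the component at \<open>J\<close> is killed by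
      \<open>g'\<close>, hence comes from \<open>u\<close> into \<open>a\<close>, and adding
      \<open>f u\<close> repairs it without changing the image in \<open>c\<close>.\<close>
    define y' where "y' = f \<cdot> u \<boxplus> y"
    have y': "y' \<in> Hom C v b" unfolding y'_def using add_hom[OF fu c(3)] .
    have "h \<cdot> y' = p \<cdot> x \<cdot> z"
      unfolding y'_def using comp_add_right[OF fu c(3) h(1)] comp_assoc[OF u(1) A(1) h(1)] h(2) u(2)
        minus_add[OF pxz hy] by simp
    moreover have "g \<cdot> y' = q \<cdot> x \<cdot> z"
      unfolding y'_def using comp_add_right[OF fu c(3) A(2)] comp_assoc[OF u(1) A(1,2)] A(5)
        comp_zero_left[OF u(1) o(3)] add_zero_left[OF comp_hom[OF c(3) A(2)]] c(4) by simp
    ultimately have "m \<cdot> y' = x \<cdot> z"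
      using biproduct_eq[OF bp comp_hom[OF y' m(1)] comp_hom[OF c(1) x(1)]] px[OF y']
        comp_assoc[OF c(1) x(1) P(3)] comp_assoc[OF c(1) x(1) P(4)] by simp
    then show "covers C m x" unfolding covers_iff[OF m(1) x(1)] using c y' by blast
  qed
  then show ?thesis using that \<pi>i by blast
qed

section \<open>The long exact sequence in terms of \<open>ext_acyclic\<close>\<close>

lemma injective_zero_object:
  assumes z: "zero_object C z"
  shows "injective_object C z"
proof -
  have zo: "z \<in> Obj C" using z by (simp add: zero_object_def)
  have "\<exists>h\<in>Hom C (Cod C f) z. h \<cdot> f = g" if "mono_arr C f" "g \<in> Hom C (Dom C f) z" for f g
  proof -
    have f: "f \<in> Hom C (Dom C f) (Cod C f)" using that by (simp add: mono_arr_def Hom_iff)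
    have h: "Zero C (Cod C f) z \<in> Hom C (Cod C f) z" using zero_hom Hom_obj f zo by blast
    then show ?thesis using zero_object_eq_to[OF z comp_hom[OF f h] that(2)] by blast
  qed
  then show ?thesis unfolding injective_object_def using zo by blast
qed

lemma injective_biproduct:
  assumes bp: "biproduct C s a b i j p q" and a: "injective_object C a" and b: "injective_object C b"
  shows "injective_object C s"
proof -
  note P = biproductD[OF bp]
  have "\<exists>h\<in>Hom C (Cod C f) s. h \<cdot> f = g" if f: "mono_arr C f" and g: "g \<in> Hom C (Dom C f) s" for f g
  proof -
    have fh: "f \<in> Hom C (Dom C f) (Cod C f)" using f by (simp add: mono_arr_def Hom_iff)
    obtain u where u: "u \<in> Hom C (Cod C f) a" "u \<cdot> f = p \<cdot> g"
      using injective_extend[OF a f fh comp_hom[OF g P(3)]] by blast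
    obtain v where v: "v \<in> Hom C (Cod C f) b" "v \<cdot> f = q \<cdot> g"
      using injective_extend[OF b f fh comp_hom[OF g P(4)]] by blast
    obtain h where h: "h \<in> Hom C (Cod C f) s" "p \<cdot> h = u" "q \<cdot> h = v"
      using biproduct_pair[OF bp u(1) v(1)] by blast
    have "h \<cdot> f = g"
      using biproduct_eq[OF bp comp_hom[OF fh h(1)] g] comp_assoc[OF fh h(1) P(3)]
        comp_assoc[OF fh h(1) P(4)] h u v by simp
    then show ?thesis using h by blast
  qed
  then show ?thesis unfolding injective_object_def using P Hom_obj by blast
qed

text \<open>Coresolve \<open>J\<close> by itself: the cokernel of the identity is the zero object,
  again injective, and every arrow into it lifts.\<close>

lemma ext_acyclic_injective:
  "injective_object C J \<Longrightarrow> ext_acyclic C A i J"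
proof (induction i arbitrary: J)
  case (Suc i)
  obtain z where z: "zero_object C z" using ex_zero_object by blast
  have zo: "z \<in> Obj C" and J: "J \<in> Obj C" using z Suc.prems by (auto simp: zero_object_def injective_object_def)
  obtain Q i' j p q where bp: "biproduct C J z J i' j p q" using zero_object_summand[OF z J] by blast
  note s = biproduct_ses[OF biproduct_swap[OF bp]] note P = sesD[OF s]
  have "lifts C X p" for X
  proof (rule liftsI[OF P(2)])
    fix f assume f: "f \<in> Hom C X z"
    have h: "Zero C X J \<in> Hom C X J" using zero_hom Hom_obj f J by blast
    show "\<exists>h\<in>Hom C X J. p \<cdot> h = f" using zero_object_eq_to[OF z comp_hom[OF h P(2)] f] h by blast
  qed
  then show ?case using s Suc.prems Suc.IH[OF injective_zero_object[OF z]] unfolding ext_acyclic.simps by blast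
qed simp

text \<open>The identity of \<open>J\<close> is added to the first step of a coresolution of
  \<open>c\<close>: \<open>Q\<close> embeds into the sum of \<open>J\<close> and \<open>K\<close>
  with the same cokernel \<open>S\<close>.\<close>

lemma ext_acyclic_add_injective:
  assumes c: "ext_acyclic C A (Suc n) c" and J: "injective_object C J" and bp: "biproduct C Q J c i j p q"
  shows "ext_acyclic C A (Suc n) Q"
proof -
  obtain K S f g where K: "injective_object C K" "ses C c f K g S" "\<forall>X\<in>A. lifts C X g" "ext_acyclic C A n S"
    using c by auto
  note P = biproductD[OF bp] note B = sesD[OF K(2)]
  have "J \<in> Obj C" "K \<in> Obj C" using P B Hom_obj by blast+
  then obtain R i' j' p' q' where bp': "biproduct C R J K i' j' p' q'" using ex_biproduct by blast
  note P' = biproductD[OF bp']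
  obtain m where m: "m \<in> Hom C Q R" "p' \<cdot> m = p" "q' \<cdot> m = f \<cdot> q"
    using biproduct_pair[OF bp' P(3) comp_hom[OF P(4) B(1)]] by blast
  note gq = comp_hom[OF P'(4) B(2)]
  have px: "p' \<cdot> (m \<cdot> x) = p \<cdot> x" "q' \<cdot> (m \<cdot> x) = f \<cdot> (q \<cdot> x)" if "x \<in> Hom C w Q" for w x
    using comp_assoc[OF that m(1) P'(3)] comp_assoc[OF that m(1) P'(4)] m comp_assoc[OF that P(4) B(1)] by simp_all
  have mono: "mono_arr C m"
  proof (rule monoI[OF m(1)])
    fix w x assume x: "x \<in> Hom C w Q" "m \<cdot> x = Zero C w R"
    have w: "w \<in> Obj C" using x Hom_obj by blast
    have "p \<cdot> x = Zero C w J" "f \<cdot> (q \<cdot> x) = Zero C w K"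
      using px[OF x(1)] x(2) comp_zero_right[OF P'(3) w] comp_zero_right[OF P'(4) w] by simp_all
    then have "p \<cdot> x = Zero C w J" "q \<cdot> x = Zero C w c"
      using monoD0[OF B(3,1) comp_hom[OF x(1) P(4)]] by blast+
    moreover have "Zero C w Q \<in> Hom C w Q" using zero_hom w x(1) Hom_obj by blast
    ultimately show "x = Zero C w Q"
      using biproduct_eq[OF bp x(1), of "Zero C w Q"] comp_zero_right[OF P(3) w] comp_zero_right[OF P(4) w] by simp
  qed
  have "is_kernel C (g \<cdot> q') m"
  proof (rule kernelI[OF gq m(1) mono])
    have "g \<cdot> q' \<cdot> m = g \<cdot> f \<cdot> q" using comp_assoc[OF m(1) P'(4) B(2)] m(3) comp_assoc[OF P(4) B(1,2)] by simp
    then show "g \<cdot> q' \<cdot> m = Zero C Q S" using B(5) comp_zero_left[OF P(4) Hom_obj(2)[OF B(2)]] by simp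
    fix t x assume x: "x \<in> Hom C t R" "g \<cdot> q' \<cdot> x = Zero C t S"
    have "g \<cdot> (q' \<cdot> x) = Zero C t S" using x comp_assoc[OF x(1) P'(4) B(2)] by simp
    then obtain y where y: "y \<in> Hom C t c" "f \<cdot> y = q' \<cdot> x" using ses_lift[OF K(2) comp_hom[OF x(1) P'(4)]] by blast
    obtain w where w: "w \<in> Hom C t Q" "p \<cdot> w = p' \<cdot> x" "q \<cdot> w = y"
      using biproduct_pair[OF bp comp_hom[OF x(1) P'(3)] y(1)] by blast
    have "m \<cdot> w = x" using biproduct_eq[OF bp' comp_hom[OF w(1) m(1)] x(1)] px[OF w(1)] w y by simp
    then show "\<exists>u\<in>Hom C t Q. m \<cdot> u = x" using w by blast
  qed
  moreover have "epi_arr C (g \<cdot> q')" using epi_comp[OF biproduct_epi(2)[OF bp'] P'(4) B(4,2)] .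
  ultimately have s: "ses C Q m R (g \<cdot> q') S" unfolding ses_def using m gq by blast
  have "lifts C X (g \<cdot> q')" if X: "X \<in> A" for X
  proof (rule liftsI[OF gq])
    fix x assume "x \<in> Hom C X S"
    then obtain y where y: "y \<in> Hom C X K" "g \<cdot> y = x" using liftsD[OF _ B(2)] K(3) X by blast
    have "g \<cdot> q' \<cdot> (j' \<cdot> y) = g \<cdot> (q' \<cdot> (j' \<cdot> y))"
      using comp_assoc[OF comp_hom[OF y(1) P'(2)] P'(4) B(2)] .
    also have "\<dots> = x" using comp_assoc[OF y(1) P'(2,4)] P'(6) comp_ide_left[OF y(1)] y(2) by simp
    finally show "\<exists>h\<in>Hom C X R. g \<cdot> q' \<cdot> h = x" using comp_hom[OF y(1) P'(2)] by blast
  qed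
  then show ?thesis using s K(4) injective_biproduct[OF bp' J K(1)] unfolding ext_acyclic.simps by blast
qed

text \<open>Embedding \<open>b\<close> into \<open>J\<close> also embeds \<open>a\<close>, with
  cokernel \<open>P\<close> an extension of \<open>S\<close> by \<open>c\<close>. Closure under
  extensions at level \<open>n\<close> is a premise because the proof of that closure at level
  \<open>Suc n\<close> calls this lemma with its induction hypothesis.\<close>

lemma ext_acyclic_kernel_aux:
  assumes ext: "\<And>a f b g c. \<lbrakk>ses C a f b g c; ext_acyclic C A n a; ext_acyclic C A n c\<rbrakk> \<Longrightarrow> ext_acyclic C A n b"
    and s1: "ses C a f b g c" and b: "ext_acyclic C A (Suc n) b" and c: "ext_acyclic C A n c"
    and l: "\<forall>X\<in>A. lifts C X g"
  shows "ext_acyclic C A (Suc n) a"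
proof -
  obtain J S f' g' where J: "injective_object C J" "ses C b f' J g' S" "\<forall>X\<in>A. lifts C X g'" "ext_acyclic C A n S"
    using b by auto
  obtain P r s t where P: "ses C a (f' \<cdot> f) J r P" "ses C c s P t S" "s \<cdot> g = r \<cdot> f'" "t \<cdot> r = g'"
    by (rule third_isomorphism[OF s1 J(2)])
  note A = sesD[OF s1] note B = sesD[OF J(2)] note R = sesD[OF P(1)] note T = sesD[OF P(2)]
  have "lifts C X r" if X: "X \<in> A" for X
  proof (rule liftsI[OF R(2)])
    fix x assume x: "x \<in> Hom C X P"
    \<comment> \<open>Lift the image of \<open>x\<close> in \<open>S\<close> to \<open>J\<close>;
      what remains of \<open>x\<close> lies in \<open>c\<close> and lifts through
      \<open>b\<close>.\<close>
    obtain y where y: "y \<in> Hom C X J" "g' \<cdot> y = t \<cdot> x" using liftsD[OF _ B(2) comp_hom[OF x T(2)]] J(3) X by blast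
    note ry = comp_hom[OF y(1) R(2)]
    have "t \<cdot> (x \<boxminus> r \<cdot> y) = Zero C X S"
      using comp_minus_right[OF x ry T(2)] comp_assoc[OF y(1) R(2) T(2)] P(4) y(2) minus_self[OF comp_hom[OF x T(2)]]
      by simp
    then obtain n where n: "n \<in> Hom C X c" "s \<cdot> n = x \<boxminus> r \<cdot> y" using ses_lift[OF P(2) minus_hom[OF x ry]] by blast
    obtain m where m: "m \<in> Hom C X b" "g \<cdot> m = n" using liftsD[OF _ A(2) n(1)] l X by blast
    note fm = comp_hom[OF m(1) B(1)]
    have "r \<cdot> (f' \<cdot> m \<boxplus> y) = x"
      using comp_add_right[OF fm y(1) R(2)] comp_assoc[OF m(1) B(1) R(2)] P(3) comp_assoc[OF m(1) A(2) T(1)]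
        m(2) n(2) minus_add[OF x ry] by simp
    then show "\<exists>h\<in>Hom C X J. r \<cdot> h = x" using add_hom[OF fm y(1)] by blast
  qed
  then show ?thesis using ext[OF P(2) c J(4)] P(1) J(1) unfolding ext_acyclic.simps by blast
qed

text \<open>By the pushout along \<open>a \<rightarrow> J\<close>, \<open>b\<close> is the kernel of
  an arrow from the sum of \<open>J\<close> and \<open>c\<close> onto the cosyzygy \<open>S\<close>
  of \<open>a\<close>, and arrows into \<open>S\<close> lift already to \<open>J\<close>.\<close>

lemma ext_acyclic_extension:
  "\<lbrakk>ses C a f b g c; ext_acyclic C A n a; ext_acyclic C A n c\<rbrakk> \<Longrightarrow> ext_acyclic C A n b"
proof (induction n arbitrary: a f b g c)
  case (Suc n)
  obtain J S f' g' where J: "injective_object C J" "ses C a f' J g' S" "\<forall>X\<in>A. lifts C X g'" "ext_acyclic C A n S"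
    using Suc.prems(2) by auto
  note A = sesD[OF Suc.prems(1)] note B = sesD[OF J(2)]
  have "J \<in> Obj C" "c \<in> Obj C" using A B Hom_obj by blast+
  then obtain Q i j p q where bp: "biproduct C Q J c i j p q" using ex_biproduct by blast
  note P = biproductD[OF bp]
  obtain m \<pi> where m: "ses C b m Q \<pi> S" "\<pi> \<cdot> i = g'" using pushout_injective[OF Suc.prems(1) J(2,1) bp] by blast
  note M = sesD[OF m(1)]
  have "lifts C X \<pi>" if X: "X \<in> A" for X
  proof (rule liftsI[OF M(2)])
    fix x assume "x \<in> Hom C X S"
    then obtain y where y: "y \<in> Hom C X J" "g' \<cdot> y = x" using liftsD[OF _ B(2)] J(3) X by blast
    have "\<pi> \<cdot> (i \<cdot> y) = x" using comp_assoc[OF y(1) P(1) M(2)] m(2) y(2) by simp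
    then show "\<exists>h\<in>Hom C X Q. \<pi> \<cdot> h = x" using comp_hom[OF y(1) P(1)] by blast
  qed
  then have *: "\<forall>X\<in>A. lifts C X \<pi>" by blast
  show ?case
    by (rule ext_acyclic_kernel_aux[OF _ m(1) ext_acyclic_add_injective[OF Suc.prems(3) J(1) bp] J(4) *])
      (rule Suc.IH)
qed simp

text \<open>Plays the part of Ext^j(X, c) \<rightarrow> Ext^(j+1)(X, a) \<rightarrow> Ext^(j+1)(X,
  b) in the long exact sequence; the lifting hypothesis covers \<open>j = 0\<close>.\<close>

lemma ext_acyclic_kernel:
  assumes "ses C a f b g c" "ext_acyclic C A (Suc n) b" "ext_acyclic C A n c" "\<forall>X\<in>A. lifts C X g"
  shows "ext_acyclic C A (Suc n) a"
  by (rule ext_acyclic_kernel_aux[OF _ assms]) (rule ext_acyclic_extension)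

text \<open>Plays the part of Ext^j(X, b) \<rightarrow> Ext^j(X, c) \<rightarrow> Ext^(j+1)(X, a),
  whence the loss of one degree. The sum \<open>Q\<close> of \<open>J\<close> and \<open>c\<close>
  is an extension of \<open>S\<close> by \<open>b\<close>, hence acyclic, and \<open>c\<close> is
  the kernel of its split projection to \<open>J\<close>.\<close>

lemma ext_acyclic_cokernel:
  assumes s: "ses C a f b g c" and a: "ext_acyclic C A (Suc n) a" and b: "ext_acyclic C A n b"
  shows "ext_acyclic C A n c"
proof (cases n)
  case (Suc n')
  obtain J S f' g' where J: "injective_object C J" "ses C a f' J g' S" "ext_acyclic C A n S"
    using a by auto
  note A = sesD[OF s] note B = sesD[OF J(2)]
  have "J \<in> Obj C" "c \<in> Obj C" using A B Hom_obj by blast+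
  then obtain Q i j p q where bp: "biproduct C Q J c i j p q" using ex_biproduct by blast
  note P = biproductD[OF bp]
  obtain m \<pi> where m: "ses C b m Q \<pi> S" using pushout_injective[OF s J(2,1) bp] by blast
  have Q: "ext_acyclic C A (Suc n') Q" using ext_acyclic_extension[OF m b J(3)] Suc by simp
  have "lifts C X p" for X
  proof (rule liftsI[OF P(3)])
    fix x assume x: "x \<in> Hom C X J"
    have "p \<cdot> (i \<cdot> x) = x" using comp_assoc[OF x P(1,3)] P(5) comp_ide_left[OF x] by simp
    then show "\<exists>h\<in>Hom C X Q. p \<cdot> h = x" using comp_hom[OF x P(1)] by blast
  qed
  then show ?thesis
    using ext_acyclic_kernel[OF biproduct_ses[OF biproduct_swap[OF bp]] Q ext_acyclic_injective[OF J(1)]] Suc by blast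
qed simp

text \<open>Extending \<open>f\<close> over \<open>E\<close> to \<open>u\<close> induces
  \<open>v : X \<rightarrow> S\<close>. A lift \<open>w\<close> of \<open>v\<close> turns
  \<open>u - w h\<close> into a retraction \<open>r\<close> of \<open>k\<close>, and
  \<open>1 - k r\<close> descends to the section.\<close>

lemma lifts_split:
  assumes s1: "ses C K f J g S" and J: "injective_object C J" and l: "lifts C X g"
    and s2: "ses C K k E h X"
  shows "\<exists>s\<in>Hom C X E. h \<cdot> s = Ide C X"
proof -
  note A = sesD[OF s1] note B = sesD[OF s2]
  have o: "K \<in> Obj C" "E \<in> Obj C" "J \<in> Obj C" "X \<in> Obj C" using A B Hom_obj by blast+
  obtain u where u: "u \<in> Hom C E J" "u \<cdot> k = f" using injective_extend[OF J B(3,1) A(1)] by blast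
  have "g \<cdot> u \<cdot> k = Zero C K S" using comp_assoc[OF B(1) u(1) A(2)] u(2) A(5) by simp
  then obtain v where v: "v \<in> Hom C X S" "v \<cdot> h = g \<cdot> u" using ses_desc[OF s2 comp_hom[OF u(1) A(2)]] by blast
  obtain w where w: "w \<in> Hom C X J" "g \<cdot> w = v" using liftsD[OF l A(2) v(1)] by blast
  note wh = comp_hom[OF B(2) w(1)]
  have "g \<cdot> (u \<boxminus> w \<cdot> h) = Zero C E S"
    using comp_minus_right[OF u(1) wh A(2)] comp_assoc[OF B(2) w(1) A(2)] w(2) v(2) minus_self[OF comp_hom[OF u(1) A(2)]]
    by simp
  then obtain r where r: "r \<in> Hom C E K" "f \<cdot> r = u \<boxminus> w \<cdot> h" using ses_lift[OF s1 minus_hom[OF u(1) wh]] by blast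
  have "f \<cdot> (r \<cdot> k) = f \<cdot> Ide C K"
    using comp_assoc[OF B(1) r(1) A(1)] r(2) comp_minus_left[OF B(1) u(1) wh] u(2) comp_assoc[OF B(1,2) w(1)] B(5)
      comp_zero_right[OF w(1) o(1)] minus_zero[OF A(1)] comp_ide_right[OF A(1)] by simp
  then have rk: "r \<cdot> k = Ide C K" using monoD[OF A(3,1) comp_hom[OF B(1) r(1)] ide_hom[OF o(1)]] by blast
  note iE = ide_hom[OF o(2)] and kr = comp_hom[OF r(1) B(1)]
  have "(Ide C E \<boxminus> k \<cdot> r) \<cdot> k = Zero C K E"
    using comp_minus_left[OF B(1) iE kr] comp_ide_left[OF B(1)] comp_assoc[OF B(1) r(1) B(1)] rk comp_ide_right[OF B(1)]
      minus_self[OF B(1)] by simp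
  then obtain s where s: "s \<in> Hom C X E" "s \<cdot> h = Ide C E \<boxminus> k \<cdot> r" using ses_desc[OF s2 minus_hom[OF iE kr]] by blast
  have "h \<cdot> s \<cdot> h = Ide C X \<cdot> h"
    using comp_assoc[OF B(2) s(1) B(2)] s(2) comp_minus_right[OF iE kr B(2)] comp_ide_right[OF B(2)]
      comp_assoc[OF r(1) B(1,2)] B(5) comp_zero_left[OF r(1) o(4)] minus_zero[OF B(2)] comp_ide_left[OF B(2)] by simp
  then show ?thesis using epiD[OF B(4,2) comp_hom[OF s(1) B(2)] ide_hom[OF o(4)]] s(1) by blast
qed

text \<open>Vanishing of Ext^1(-, K) passes to extensions: the lift over \<open>X'\<close> extends
  to \<open>X\<close> because \<open>J\<close> is injective, and the remaining error factors through
  \<open>X''\<close>.\<close>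

lemma lifts_extension:
  assumes s1: "ses C X' a X b X''" and s2: "ses C K f J g S" and J: "injective_object C J"
    and l: "lifts C X' g" "lifts C X'' g"
  shows "lifts C X g"
proof -
  note A = sesD[OF s1] note B = sesD[OF s2]
  show ?thesis
  proof (rule liftsI[OF B(2)])
    fix x assume x: "x \<in> Hom C X S"
    obtain y where y: "y \<in> Hom C X' J" "g \<cdot> y = x \<cdot> a" using liftsD[OF l(1) B(2) comp_hom[OF A(1) x]] by blast
    obtain y' where y': "y' \<in> Hom C X J" "y' \<cdot> a = y" using injective_extend[OF J A(3,1) y(1)] by blast
    note gy = comp_hom[OF y'(1) B(2)]
    have "(x \<boxminus> g \<cdot> y') \<cdot> a = Zero C X' S"
      using comp_minus_left[OF A(1) x gy] comp_assoc[OF A(1) y'(1) B(2)] y' y(2) minus_self[OF comp_hom[OF A(1) x]] by simp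
    then obtain z where z: "z \<in> Hom C X'' S" "z \<cdot> b = x \<boxminus> g \<cdot> y'" using ses_desc[OF s1 minus_hom[OF x gy]] by blast
    obtain w where w: "w \<in> Hom C X'' J" "g \<cdot> w = z" using liftsD[OF l(2) B(2) z(1)] by blast
    note wb = comp_hom[OF A(2) w(1)]
    have "g \<cdot> (w \<cdot> b \<boxplus> y') = x"
      using comp_add_right[OF wb y'(1) B(2)] comp_assoc[OF A(2) w(1) B(2)] w(2) z(2) minus_add[OF x gy] by simp
    then show "\<exists>h\<in>Hom C X J. g \<cdot> h = x" using add_hom[OF wb y'(1)] by blast
  qed
qed

end

section \<open>Yoneda Ext and injective coresolutions\<close>

text \<open>An extension with \<open>k + 1\<close> arrows has \<open>k + 2\<close> objects; the else
  branch supplies the last one, so that chain maps are indexed uniformly from \<open>0\<close> to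
  \<open>Suc k\<close>.\<close>

definition ext_ob :: "('o, 'm) cat \<Rightarrow> 'm list \<Rightarrow> nat \<Rightarrow> 'o" where
  "ext_ob C fs j = (if j < length fs then Dom C (fs ! j) else Cod C (last fs))"

lemma is_singleton_Ext_iff:
  "is_singleton (Ext C k X Y) \<longleftrightarrow> extensions C k X Y \<noteq> {} \<and>
     (\<forall>fs\<in>extensions C k X Y. \<forall>gs\<in>extensions C k X Y. equivclp (ext_morphism C k X Y) fs gs)"
proof -
  let ?S = "extensions C k X Y"
  let ?r = "{(fs, gs). fs \<in> ?S \<and> gs \<in> ?S \<and> equivclp (ext_morphism C k X Y) fs gs}"
  have eq: "equiv ?S ?r"
  proof (rule equivI)
    show "refl_on ?S ?r" by (auto intro: refl_onI)
    show "sym ?r" by (auto intro!: symI intro: equivclp_sym)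
    show "trans ?r" by (auto intro!: transI intro: equivclp_trans)
    show "?r \<subseteq> ?S \<times> ?S" by auto
  qed
  show ?thesis
  proof
    assume "is_singleton (Ext C k X Y)"
    then obtain c where c: "?S // ?r = {c}" unfolding Ext_def is_singleton_def by blast
    have "?r `` {fs} = c" if "fs \<in> ?S" for fs using quotientI[OF that, of ?r] c by blast
    then have "(fs, gs) \<in> ?r" if "fs \<in> ?S" "gs \<in> ?S" for fs gs
      using that eq_equiv_class_iff[OF eq that] by blast
    moreover have "?S \<noteq> {}" using c by (auto simp: quotient_def)
    ultimately show "?S \<noteq> {} \<and> (\<forall>fs\<in>?S. \<forall>gs\<in>?S. equivclp (ext_morphism C k X Y) fs gs)" by blast
  next
    assume R: "?S \<noteq> {} \<and> (\<forall>fs\<in>?S. \<forall>gs\<in>?S. equivclp (ext_morphism C k X Y) fs gs)"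
    then obtain fs where fs: "fs \<in> ?S" by blast
    have "?S // ?r = {?r `` {fs}}"
    proof (intro equalityI subsetI)
      fix c assume "c \<in> ?S // ?r"
      then obtain gs where gs: "gs \<in> ?S" "c = ?r `` {gs}" by (rule quotientE)
      have "(gs, fs) \<in> ?r" using R gs(1) fs by blast
      then show "c \<in> {?r `` {fs}}" using equiv_class_eq[OF eq] gs(2) by blast
    qed (use quotientI[OF fs, of ?r] in blast)
    then show "is_singleton (Ext C k X Y)" unfolding Ext_def is_singleton_def by blast
  qed
qed

text \<open>A chain map that is the identity at the left end. When the middle terms of
  \<open>ds\<close> are injective, \<open>ds\<close> is a truncated coresolution with cosyzygy
  \<open>S\<close>, and \<open>f\<close> represents the class of \<open>fs\<close> in Ext^k(X, Y),
  read as arrows \<open>X \<rightarrow> S\<close> modulo those that factor through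
  \<open>ds ! k\<close>.\<close>

definition comparison :: "('o, 'm) cat \<Rightarrow> nat \<Rightarrow> 'm list \<Rightarrow> 'm list \<Rightarrow> 'm \<Rightarrow> bool" where
  "comparison C k fs gs f \<longleftrightarrow> (\<exists>u :: nat \<Rightarrow> 'm. u 0 = Ide C (ext_ob C fs 0) \<and> u (Suc k) = f \<and>
     (\<forall>j\<le>Suc k. u j \<in> Hom C (ext_ob C fs j) (ext_ob C gs j)) \<and>
     (\<forall>j\<le>k. u (Suc j) \<cdot>\<^bsub>C\<^esub> (fs ! j) = (gs ! j) \<cdot>\<^bsub>C\<^esub> u j))"

context abelian_category
begin

section \<open>Comparing extensions with an injective coresolution\<close>

lemma extensionsD:
  assumes "fs \<in> extensions C k X Y"
  shows "length fs = Suc k" "ext_ob C fs 0 = Y" "ext_ob C fs (Suc k) = X"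
    "\<And>j. j \<le> k \<Longrightarrow> fs ! j \<in> Hom C (ext_ob C fs j) (ext_ob C fs (Suc j))"
    "mono_arr C (fs ! 0)" "epi_arr C (fs ! k)"
    "\<And>j. j < k \<Longrightarrow> exact_at C (fs ! j) (fs ! Suc j)"
proof -
  have b: "length fs = k + 1" "exact_bounded C fs" "Dom C (hd fs) = Y" "Cod C (last fs) = X"
    using assms unfolding extensions_def by auto
  show l: "length fs = Suc k" using b by simp
  then have ne: "fs \<noteq> []" by auto
  have hl: "hd fs = fs ! 0" "last fs = fs ! k" using l ne by (auto simp: hd_conv_nth last_conv_nth)
  show "ext_ob C fs 0 = Y" "ext_ob C fs (Suc k) = X" using b l hl by (auto simp: ext_ob_def)
  show "mono_arr C (fs ! 0)" "epi_arr C (fs ! k)" using b hl unfolding exact_bounded_iff by auto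
  show ex: "exact_at C (fs ! j) (fs ! Suc j)" if "j < k" for j
    using b that unfolding exact_bounded_iff exact_list_def by auto
  show "fs ! j \<in> Hom C (ext_ob C fs j) (ext_ob C fs (Suc j))" if j: "j \<le> k" for j
  proof (cases "j = k")
    case True
    then show ?thesis using \<open>epi_arr C (fs ! k)\<close> l hl unfolding epi_arr_def ext_ob_def by (auto simp: Hom_iff)
  next
    case False
    then show ?thesis using exact_at_arr[OF ex[of j]] j l unfolding ext_ob_def by (auto simp: Hom_iff)
  qed
qed

lemma extensionsI:
  assumes "length fs = Suc k" "mono_arr C (fs ! 0)" "epi_arr C (fs ! k)" "Dom C (fs ! 0) = Y" "Cod C (fs ! k) = X"
    and "\<And>j. j < k \<Longrightarrow> exact_at C (fs ! j) (fs ! Suc j)"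
  shows "fs \<in> extensions C k X Y"
proof -
  have ne: "fs \<noteq> []" using assms(1) by auto
  have "hd fs = fs ! 0" "last fs = fs ! k" using assms(1) ne by (auto simp: hd_conv_nth last_conv_nth)
  then show ?thesis using assms ne unfolding extensions_def exact_bounded_iff exact_list_def by auto
qed

lemma ext_morphism_comparison:
  assumes "ext_morphism C k X Y fs gs"
  shows "comparison C k fs gs (Ide C X)"
proof -
  obtain u where u: "u 0 = Ide C Y" "u (k + 1) = Ide C X"
    "\<And>j. 1 \<le> j \<and> j \<le> k \<Longrightarrow> u j \<in> Hom C (Dom C (fs ! j)) (Dom C (gs ! j))"
    "\<And>j. j\<le>k \<Longrightarrow> u (Suc j) \<cdot> (fs ! j) = (gs ! j) \<cdot> u j"
    and e: "fs \<in> extensions C k X Y" "gs \<in> extensions C k X Y"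
    using assms unfolding ext_morphism_def by blast
  note F = extensionsD[OF e(1)] and G = extensionsD[OF e(2)]
  have o: "Y \<in> Obj C" "X \<in> Obj C" using F(4)[of 0] F(4)[of k] F(2,3) Hom_obj by fastforce+
  have "u j \<in> Hom C (ext_ob C fs j) (ext_ob C gs j)" if j: "j \<le> Suc k" for j
  proof -
    consider "j = 0" | "j = Suc k" | "1 \<le> j \<and> j \<le> k" using j by linarith
    then show ?thesis
    proof cases
      case 3
      then show ?thesis using u(3)[of j] F(1) G(1) by (simp add: ext_ob_def)
    qed (use u F(2,3) G(2,3) ide_hom o in auto)
  qed
  then show ?thesis unfolding comparison_def using u F(2) by (intro exI[of _ u]) simp
qed

lemma comparison_comp:
  assumes e: "fs \<in> extensions C k X Y" "gs \<in> extensions C k X Y" "ds \<in> extensions C k S Y"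
    and c1: "comparison C k fs gs (Ide C X)" and c2: "comparison C k gs ds f"
  shows "comparison C k fs ds f"
proof -
  note F = extensionsD[OF e(1)] and G = extensionsD[OF e(2)] and D = extensionsD[OF e(3)]
  obtain u where u: "u 0 = Ide C (ext_ob C fs 0)" "u (Suc k) = Ide C X"
    "\<And>j. j\<le>Suc k \<Longrightarrow> u j \<in> Hom C (ext_ob C fs j) (ext_ob C gs j)"
    "\<And>j. j\<le>k \<Longrightarrow> u (Suc j) \<cdot> (fs ! j) = (gs ! j) \<cdot> u j"
    using c1 unfolding comparison_def by blast
  obtain v where v: "v 0 = Ide C (ext_ob C gs 0)" "v (Suc k) = f"
    "\<And>j. j\<le>Suc k \<Longrightarrow> v j \<in> Hom C (ext_ob C gs j) (ext_ob C ds j)"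
    "\<And>j. j\<le>k \<Longrightarrow> v (Suc j) \<cdot> (gs ! j) = (ds ! j) \<cdot> v j"
    using c2 unfolding comparison_def by blast
  define w where "w j = v j \<cdot> u j" for j
  have "w 0 = Ide C (ext_ob C fs 0)"
    unfolding w_def u v F(2) G(2) using F(2) comp_ide_left[OF u(3)[of 0]] u(1) G(2) by simp
  moreover have "w (Suc k) = f" unfolding w_def u v using comp_ide_right v(2) v(3)[of "Suc k"] G(3) by auto
  moreover have "w j \<in> Hom C (ext_ob C fs j) (ext_ob C ds j)" if "j \<le> Suc k" for j
    unfolding w_def using comp_hom[OF u(3) v(3)] that by blast
  moreover have "w (Suc j) \<cdot> (fs ! j) = (ds ! j) \<cdot> w j" if j: "j \<le> k" for j
  proof -
    have j': "Suc j \<le> Suc k" "j \<le> Suc k" using j by auto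
    show ?thesis unfolding w_def
      using comp_assoc[OF F(4)[OF j] u(3)[OF j'(1)] v(3)[OF j'(1)]] u(4)[OF j]
        comp_assoc[OF u(3)[OF j'(2)] G(4)[OF j] v(3)[OF j'(1)]] v(4)[OF j]
        comp_assoc[OF u(3)[OF j'(2)] v(3)[OF j'(2)] D(4)[OF j]] by simp
  qed
  ultimately show ?thesis unfolding comparison_def by blast
qed

text \<open>The middle components come from injectivity. The right end \<open>S\<close> need not be
  injective, so the final component descends along the epimorphism \<open>fs ! k\<close>
  instead.\<close>

lemma comparison_exists:
  assumes fs: "fs \<in> extensions C k X Y" and ds: "ds \<in> extensions C k S Y"
    and inj: "\<And>j. \<lbrakk>1 \<le> j; j \<le> k\<rbrakk> \<Longrightarrow> injective_object C (ext_ob C ds j)" and k: "1 \<le> k"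
  shows "\<exists>f\<in>Hom C X S. comparison C k fs ds f"
proof -
  note F = extensionsD[OF fs] and D = extensionsD[OF ds]
  have zero: "(ds ! Suc j \<cdot> v) \<cdot> fs ! j = Zero C (ext_ob C fs j) (ext_ob C ds (Suc (Suc j)))"
    if j: "j < k" and u: "u \<in> Hom C (ext_ob C fs j) (ext_ob C ds j)"
      and v: "v \<in> Hom C (ext_ob C fs (Suc j)) (ext_ob C ds (Suc j))"
      and e: "v \<cdot> fs ! j = ds ! j \<cdot> u" for j u v
  proof -
    have j': "j \<le> k" "Suc j \<le> k" using j by auto
    have "ds ! Suc j \<cdot> ds ! j = Zero C (ext_ob C ds j) (ext_ob C ds (Suc (Suc j)))"
      using D(7)[OF j] unfolding exact_at_iff[OF D(4)[OF j'(1)] D(4)[OF j'(2)]] by blast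
    then show ?thesis
      using comp_assoc[OF F(4)[OF j'(1)] v D(4)[OF j'(2)]] e comp_assoc[OF u D(4)[OF j'(1)] D(4)[OF j'(2)]]
        comp_zero_left[OF u] Hom_obj(2)[OF D(4)[OF j'(2)]] by simp
  qed
  have "\<exists>u. u 0 = Ide C Y \<and> (\<forall>j\<le>m. u j \<in> Hom C (ext_ob C fs j) (ext_ob C ds j)) \<and>
     (\<forall>j<m. u (Suc j) \<cdot> (fs ! j) = (ds ! j) \<cdot> u j)" if "m \<le> k" for m
    using that
  proof (induction m)
    case 0
    have "Y \<in> Obj C" using F(4)[of 0] F(2) Hom_obj by fastforce
    then show ?case using F(2) D(2) ide_hom by auto
  next
    case (Suc m)
    then obtain u where u: "u 0 = Ide C Y" "\<And>j. j\<le>m \<Longrightarrow> u j \<in> Hom C (ext_ob C fs j) (ext_ob C ds j)"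
       "\<And>j. j<m \<Longrightarrow> u (Suc j) \<cdot> (fs ! j) = (ds ! j) \<cdot> u j" by auto
    have m: "m \<le> k" using Suc by simp
    have J: "injective_object C (ext_ob C ds (Suc m))" using inj Suc.prems by simp
    have h: "ds ! m \<cdot> u m \<in> Hom C (ext_ob C fs m) (ext_ob C ds (Suc m))" using comp_hom[OF u(2) D(4)[OF m]] by simp
    \<comment> \<open>At \<open>m = 0\<close> the extension is along the monomorphism
      \<open>fs ! 0\<close>. Later arrows are merely exact, so the arrow to be extended must vanish
      on the preceding one, which the square just built ensures.\<close>
    have "\<exists>v\<in>Hom C (ext_ob C fs (Suc m)) (ext_ob C ds (Suc m)). v \<cdot> fs ! m = ds ! m \<cdot> u m"
    proof (cases m)
      case 0
      then show ?thesis using injective_extend[OF J F(5)] F(4)[OF m] h by simp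
    next
      case (Suc l)
      have l: "l < k" "l \<le> k" using Suc m by auto
      have "(ds ! m \<cdot> u m) \<cdot> fs ! l = Zero C (ext_ob C fs l) (ext_ob C ds (Suc m))"
        using zero[OF l(1) u(2)[of l] _ u(3)[of l]] u(2)[of m] Suc by simp
      then show ?thesis
        using exact_extend_injective[OF F(7)[OF l(1)] F(4)[OF l(2)] _ J] F(4)[OF m] h Suc by simp
    qed
    then obtain v where v: "v \<in> Hom C (ext_ob C fs (Suc m)) (ext_ob C ds (Suc m))" "v \<cdot> fs ! m = ds ! m \<cdot> u m" by blast
    show ?case
      by (rule exI[of _ "u(Suc m := v)"]) (use u v in \<open>auto simp: le_Suc_eq less_Suc_eq\<close>)
  qed
  from this[of k] obtain u where u: "u 0 = Ide C Y" "\<And>j. j\<le>k \<Longrightarrow> u j \<in> Hom C (ext_ob C fs j) (ext_ob C ds j)"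
       "\<And>j. j<k \<Longrightarrow> u (Suc j) \<cdot> (fs ! j) = (ds ! j) \<cdot> u j" by auto
  obtain l where l: "k = Suc l" using k by (cases k) auto
  then have l': "l < k" "l \<le> k" by auto
  have h: "ds ! k \<cdot> u k \<in> Hom C (ext_ob C fs k) S" using comp_hom[OF u(2) D(4)[of k]] D(3) by simp
  have fk: "fs ! k \<in> Hom C (ext_ob C fs k) X" using F(4)[of k] F(3) by simp
  have "(ds ! k \<cdot> u k) \<cdot> fs ! l = Zero C (ext_ob C fs l) S"
    using zero[of l "u l" "u k"] u(2)[of l] u(2)[of k] u(3)[of l] l D(3) by simp
  then obtain f where f: "f \<in> Hom C X S" "f \<cdot> fs ! k = ds ! k \<cdot> u k"
    using exact_desc_epi[of "fs ! l" "fs ! k", OF _ F(4)[OF l'(2), folded l] fk F(6) h] F(7)[OF l'(1)] l by auto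
  have "comparison C k fs ds f"
    unfolding comparison_def
    by (rule exI[of _ "u(Suc k := f)"]) (use u f F(2,3) D(3) in \<open>auto simp: le_Suc_eq less_Suc_eq\<close>)
  then show ?thesis using f by blast
qed

text \<open>A chain map that vanishes on \<open>Y\<close> is null-homotopic, and the last component of the homotopy
  is the lift.\<close>

lemma null_homotopic_lift:
  assumes fs: "fs \<in> extensions C k X Y" and ds: "ds \<in> extensions C k S Y"
    and inj: "\<And>j. \<lbrakk>1 \<le> j; j \<le> k\<rbrakk> \<Longrightarrow> injective_object C (ext_ob C ds j)"
    and w0: "w 0 = Zero C Y Y" and w: "\<And>j. j \<le> Suc k \<Longrightarrow> w j \<in> Hom C (ext_ob C fs j) (ext_ob C ds j)"
    and sq: "\<And>j. j \<le> k \<Longrightarrow> w (Suc j) \<cdot> (fs ! j) = (ds ! j) \<cdot> w j"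
  shows "\<exists>s\<in>Hom C X (ext_ob C ds k). ds ! k \<cdot> s = w (Suc k)"
proof -
  note F = extensionsD[OF fs] and D = extensionsD[OF ds]
  have step: "\<exists>s\<in>Hom C (ext_ob C fs (Suc m)) (ext_ob C ds m).
      (w (Suc m) \<boxminus> ds ! m \<cdot> s) \<cdot> fs ! m = Zero C (ext_ob C fs m) (ext_ob C ds (Suc m))" if "m \<le> k" for m
    using that
  proof (induction m)
    case 0
    have o: "Y \<in> Obj C" "ext_ob C fs (Suc 0) \<in> Obj C"
      using F(4)[of 0] F(2) Hom_obj[OF F(4)[of 0]] by auto
    have w1: "w (Suc 0) \<in> Hom C (ext_ob C fs (Suc 0)) (ext_ob C ds (Suc 0))" using w by simp
    have d0: "ds ! 0 \<in> Hom C Y (ext_ob C ds (Suc 0))" using D(4)[of 0] D(2) by simp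
    \<comment> \<open>The homotopy starts with the zero arrow into \<open>Y\<close>, which is
      possible without injectivity of \<open>Y\<close> because \<open>w 0 = 0\<close>.\<close>
    have "(w (Suc 0) \<boxminus> ds ! 0 \<cdot> Zero C (ext_ob C fs (Suc 0)) Y) \<cdot> fs ! 0 = ds ! 0 \<cdot> w 0"
      using comp_zero_right[OF d0 o(2)] minus_zero[OF w1] sq[of 0] by simp
    also have "\<dots> = Zero C (ext_ob C fs 0) (ext_ob C ds (Suc 0))"
      using w0 comp_zero_right[OF d0 o(1)] F(2) by simp
    finally show ?case using zero_hom[OF o(2,1)] D(2) by auto
  next
    case (Suc m)
    then obtain s where s: "s \<in> Hom C (ext_ob C fs (Suc m)) (ext_ob C ds m)"
      "(w (Suc m) \<boxminus> ds ! m \<cdot> s) \<cdot> fs ! m = Zero C (ext_ob C fs m) (ext_ob C ds (Suc m))" by auto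
    have m: "m < k" "m \<le> k" "Suc m \<le> k" using Suc by auto
    have J: "injective_object C (ext_ob C ds (Suc m))" using inj m by simp
    have w1: "w (Suc m) \<in> Hom C (ext_ob C fs (Suc m)) (ext_ob C ds (Suc m))"
      and w2: "w (Suc (Suc m)) \<in> Hom C (ext_ob C fs (Suc (Suc m))) (ext_ob C ds (Suc (Suc m)))" using w m by auto
    note ds' = comp_hom[OF s(1) D(4)[OF m(2)]]
    obtain t where t: "t \<in> Hom C (ext_ob C fs (Suc (Suc m))) (ext_ob C ds (Suc m))"
      "t \<cdot> fs ! Suc m = w (Suc m) \<boxminus> ds ! m \<cdot> s"
      using exact_extend_injective[OF F(7)[OF m(1)] F(4)[OF m(2)] F(4)[OF m(3)] J minus_hom[OF w1 ds'] s(2)] by blast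
    note f2 = F(4)[OF m(3)] and d2 = D(4)[OF m(3)]
    note dt = comp_hom[OF t(1) d2]
    have o: "ext_ob C fs (Suc m) \<in> Obj C" "ext_ob C ds (Suc (Suc m)) \<in> Obj C" using f2 d2 Hom_obj by blast+
    have dd: "ds ! Suc m \<cdot> ds ! m = Zero C (ext_ob C ds m) (ext_ob C ds (Suc (Suc m)))"
      using D(7)[OF m(1)] unfolding exact_at_iff[OF D(4)[OF m(2)] d2] by blast
    have "(w (Suc (Suc m)) \<boxminus> ds ! Suc m \<cdot> t) \<cdot> fs ! Suc m
        = ds ! Suc m \<cdot> w (Suc m) \<boxminus> ds ! Suc m \<cdot> (w (Suc m) \<boxminus> ds ! m \<cdot> s)"
      using comp_minus_left[OF f2 w2 dt] sq[OF m(3)] comp_assoc[OF f2 t(1) d2] t(2) by simp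
    also have "\<dots> = ds ! Suc m \<cdot> (ds ! m \<cdot> s)"
      using comp_minus_right[OF w1 ds' d2] minus_minus_self[OF comp_hom[OF w1 d2] comp_hom[OF ds' d2]] by simp
    also have "\<dots> = Zero C (ext_ob C fs (Suc m)) (ext_ob C ds (Suc (Suc m)))"
      using comp_assoc[OF s(1) D(4)[OF m(2)] d2] dd comp_zero_left[OF s(1) o(2)] by simp
    finally show ?case using t(1) by blast
  qed
  obtain s where s: "s \<in> Hom C (ext_ob C fs (Suc k)) (ext_ob C ds k)"
    "(w (Suc k) \<boxminus> ds ! k \<cdot> s) \<cdot> fs ! k = Zero C (ext_ob C fs k) (ext_ob C ds (Suc k))" using step[of k] by auto
  note ds' = comp_hom[OF s(1) D(4)[OF order_refl]]
  note wk = w[OF order_refl]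
  \<comment> \<open>At the right end the arrow \<open>fs ! k\<close> is epi, so the homotopy
    relation after it holds before it as well.\<close>
  have "w (Suc k) = ds ! k \<cdot> s"
    using minus_eq_zero[OF wk ds'] epi_precomp_zero[OF F(6) F(4)[OF order_refl] minus_hom[OF wk ds'] s(2)] by blast
  then show ?thesis using s(1) F(3) by auto
qed

text \<open>The difference of two comparisons vanishes on \<open>Y\<close>, since both are the
  identity there, so it is null-homotopic.\<close>

lemma comparison_unique:
  assumes fs: "fs \<in> extensions C k X Y" and ds: "ds \<in> extensions C k S Y"
    and inj: "\<And>j. \<lbrakk>1 \<le> j; j \<le> k\<rbrakk> \<Longrightarrow> injective_object C (ext_ob C ds j)"
    and c: "comparison C k fs ds f" "comparison C k fs ds g"
  shows "\<exists>s\<in>Hom C X (ext_ob C ds k). ds ! k \<cdot> s = f \<boxminus> g"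
proof -
  note F = extensionsD[OF fs] and D = extensionsD[OF ds]
  obtain u where u: "u 0 = Ide C (ext_ob C fs 0)" "u (Suc k) = f"
    "\<And>j. j\<le>Suc k \<Longrightarrow> u j \<in> Hom C (ext_ob C fs j) (ext_ob C ds j)"
    "\<And>j. j\<le>k \<Longrightarrow> u (Suc j) \<cdot> (fs ! j) = (ds ! j) \<cdot> u j"
    using c(1) unfolding comparison_def by blast
  obtain v where v: "v 0 = Ide C (ext_ob C fs 0)" "v (Suc k) = g"
    "\<And>j. j\<le>Suc k \<Longrightarrow> v j \<in> Hom C (ext_ob C fs j) (ext_ob C ds j)"
    "\<And>j. j\<le>k \<Longrightarrow> v (Suc j) \<cdot> (fs ! j) = (ds ! j) \<cdot> v j"
    using c(2) unfolding comparison_def by blast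
  have Y: "Y \<in> Obj C" using F(4)[of 0] F(2) Hom_obj by fastforce
  have "\<exists>s\<in>Hom C X (ext_ob C ds k). ds ! k \<cdot> s = u (Suc k) \<boxminus> v (Suc k)"
  proof (rule null_homotopic_lift[OF fs ds inj, where w = "\<lambda>j. u j \<boxminus> v j"])
    show "u 0 \<boxminus> v 0 = Zero C Y Y" using u(1) v(1) F(2) minus_self[OF ide_hom[OF Y]] by simp
    show "u j \<boxminus> v j \<in> Hom C (ext_ob C fs j) (ext_ob C ds j)" if "j \<le> Suc k" for j
      using minus_hom u(3) v(3) that by blast
    show "(u (Suc j) \<boxminus> v (Suc j)) \<cdot> fs ! j = ds ! j \<cdot> (u j \<boxminus> v j)" if j: "j \<le> k" for j
    proof -
      have j': "Suc j \<le> Suc k" "j \<le> Suc k" using j by auto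
      show ?thesis
        using comp_minus_left[OF F(4)[OF j] u(3)[OF j'(1)] v(3)[OF j'(1)]] u(4)[OF j] v(4)[OF j]
          comp_minus_right[OF u(3)[OF j'(2)] v(3)[OF j'(2)] D(4)[OF j]] by simp
    qed
  qed
  then show ?thesis using u v by simp
qed

text \<open>Comparisons pull back along a morphism of extensions; this is the opposite direction.
  Any comparison \<open>f\<close> of \<open>gs\<close> becomes one of \<open>fs\<close>, so
  \<open>f\<close> differs from zero by some \<open>ds ! k\<close> after \<open>s\<close>, and this
  homotopy is subtracted.\<close>

lemma comparison_zero_transfer:
  assumes fs: "fs \<in> extensions C k X Y" and gs: "gs \<in> extensions C k X Y" and ds: "ds \<in> extensions C k S Y"
    and inj: "\<And>j. \<lbrakk>1 \<le> j; j \<le> k\<rbrakk> \<Longrightarrow> injective_object C (ext_ob C ds j)" and k: "1 \<le> k"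
    and c: "comparison C k fs gs (Ide C X)" and c0: "comparison C k fs ds (Zero C X S)"
  shows "comparison C k gs ds (Zero C X S)"
proof -
  note G = extensionsD[OF gs] and D = extensionsD[OF ds]
  obtain f where f: "f \<in> Hom C X S" "comparison C k gs ds f" using comparison_exists[OF gs ds inj k] by blast
  obtain s where s: "s \<in> Hom C X (ext_ob C ds k)" "ds ! k \<cdot> s = f"
    using comparison_unique[OF fs ds inj comparison_comp[OF fs gs ds c f(2)] c0] minus_zero[OF f(1)] by auto
  obtain u where u: "u 0 = Ide C (ext_ob C gs 0)" "u (Suc k) = f"
    "\<And>j. j\<le>Suc k \<Longrightarrow> u j \<in> Hom C (ext_ob C gs j) (ext_ob C ds j)"
    "\<And>j. j\<le>k \<Longrightarrow> u (Suc j) \<cdot> (gs ! j) = (ds ! j) \<cdot> u j"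
    using f(2) unfolding comparison_def by blast
  obtain l where l: "k = Suc l" using k by (cases k) auto
  have gk: "gs ! k \<in> Hom C (ext_ob C gs k) X" and gl: "gs ! l \<in> Hom C (ext_ob C gs l) (ext_ob C gs k)"
    and dk: "ds ! k \<in> Hom C (ext_ob C ds k) S" and uk: "u k \<in> Hom C (ext_ob C gs k) (ext_ob C ds k)"
    using G(4)[of k] G(3) G(4)[of l] l D(4)[of k] D(3) u(3)[of k] by auto
  have o: "X \<in> Obj C" "S \<in> Obj C" "ext_ob C gs l \<in> Obj C" using gk gl dk Hom_obj by blast+
  note sg = comp_hom[OF gk s(1)]
  have 1: "ds ! k \<cdot> (u k \<boxminus> s \<cdot> gs ! k) = Zero C X S \<cdot> gs ! k"
    using comp_minus_right[OF uk sg dk] u(4)[of k] u(2) comp_assoc[OF gk s(1) dk] s(2)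
      minus_self[OF comp_hom[OF gk f(1)]] comp_zero_left[OF gk o(2)] by simp
  have "gs ! k \<cdot> gs ! l = Zero C (ext_ob C gs l) X"
    using G(7)[of l] l exact_at_iff[OF gl gk] by auto
  then have 2: "(u k \<boxminus> s \<cdot> gs ! k) \<cdot> gs ! l = ds ! l \<cdot> u l"
    using comp_minus_left[OF gl uk sg] comp_assoc[OF gl gk s(1)] comp_zero_right[OF s(1) o(3)]
      minus_zero[OF comp_hom[OF gl uk]] u(4)[of l] l by simp
  \<comment> \<open>Only the last two components change. The corrected square at \<open>l\<close>
    survives because \<open>gs ! k\<close> after \<open>gs ! l\<close> is zero.\<close>
  let ?u = "u(Suc k := Zero C X S, k := u k \<boxminus> s \<cdot> gs ! k)"
  have "?u 0 = Ide C (ext_ob C gs 0)" "?u (Suc k) = Zero C X S" using u(1) l by auto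
  moreover have "?u j \<in> Hom C (ext_ob C gs j) (ext_ob C ds j)" if "j \<le> Suc k" for j
    using that u(3) minus_hom[OF uk sg] zero_hom[OF o(1,2)] G(3) D(3) by auto
  moreover have "?u (Suc j) \<cdot> (gs ! j) = (ds ! j) \<cdot> ?u j" if jk: "j \<le> k" for j
  proof -
    consider "j = k" | "j = l" | "j < l" using jk l by linarith
    then show ?thesis
      by cases (use 1 2 u(4)[of j] l in auto)
  qed
  ultimately show ?thesis unfolding comparison_def by blast
qed

text \<open>Each link of a zigzag is passed by transfer if it points forwards and by composition if
  it points backwards.\<close>

lemma comparison_zero_equivclp:
  assumes ds: "ds \<in> extensions C k S Y"
    and inj: "\<And>j. \<lbrakk>1 \<le> j; j \<le> k\<rbrakk> \<Longrightarrow> injective_object C (ext_ob C ds j)" and k: "1 \<le> k"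
    and eq: "equivclp (ext_morphism C k X Y) fs gs" and c0: "comparison C k fs ds (Zero C X S)"
  shows "comparison C k gs ds (Zero C X S)"
  using eq c0
proof (induction rule: equivclp_induct)
  case (step gs hs)
  note IH = step.IH[OF step.prems]
  show ?case
  proof (cases "ext_morphism C k X Y gs hs")
    case True
    then have "gs \<in> extensions C k X Y" "hs \<in> extensions C k X Y" by (auto simp: ext_morphism_def)
    then show ?thesis using comparison_zero_transfer[OF _ _ ds inj k ext_morphism_comparison[OF True] IH] by blast
  next
    case False
    then have m: "ext_morphism C k X Y hs gs" using step.hyps by blast
    then have "gs \<in> extensions C k X Y" "hs \<in> extensions C k X Y" by (auto simp: ext_morphism_def)
    then show ?thesis using comparison_comp[OF _ _ ds ext_morphism_comparison[OF m] IH] by blast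
  qed
qed

text \<open>The right end of \<open>ds\<close> is replaced by its pullback \<open>P\<close> along
  \<open>f\<close>; the arrow into \<open>P\<close> is determined by zero in \<open>X\<close> and
  \<open>ds ! l\<close> in the old object.\<close>

lemma pullback_extension:
  assumes ds: "ds \<in> extensions C k S Y" and k: "1 \<le> k" and f: "f \<in> Hom C X S"
  shows "\<exists>fs\<in>extensions C k X Y. comparison C k fs ds f"
proof -
  note D = extensionsD[OF ds]
  obtain l where l: "k = Suc l" using k by (cases k) auto
  have dk: "ds ! k \<in> Hom C (ext_ob C ds k) S" and dl: "ds ! l \<in> Hom C (ext_ob C ds l) (ext_ob C ds k)"
    using D(4)[of k] D(3) D(4)[of l] l by auto
  obtain P p q where pb: "is_pullback C (ds ! k) f P p q" and epi: "epi_arr C (ds ! k) \<Longrightarrow> epi_arr C p"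
    using pullback[OF dk f] by blast
  note P = is_pullbackD[OF pb dk f]
  have o: "ext_ob C ds l \<in> Obj C" "X \<in> Obj C" "P \<in> Obj C" "ext_ob C ds k \<in> Obj C" "S \<in> Obj C"
    using dl P f dk Hom_obj by blast+
  have exk: "exact_at C (ds ! l) (ds ! k)" using D(7)[of l] l by simp
  have "ds ! k \<cdot> ds ! l = f \<cdot> Zero C (ext_ob C ds l) X"
    using exk comp_zero_right[OF f o(1)] unfolding exact_at_iff[OF dl dk] by simp
  then obtain m where m: "m \<in> Hom C (ext_ob C ds l) P" "p \<cdot> m = Zero C (ext_ob C ds l) X" "q \<cdot> m = ds ! l"
    using P(4)[OF zero_hom[OF o(1,2)] dl] by blast
  have m0: "x = Zero C w P" if "x \<in> Hom C w P" "p \<cdot> x = Zero C w X" "q \<cdot> x = Zero C w (ext_ob C ds k)" for w x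
  proof -
    have "w \<in> Obj C" using that Hom_obj by blast
    then show ?thesis using P(5)[OF that(1) zero_hom[OF _ o(3)]] that(2,3) comp_zero_right[OF P(1)] comp_zero_right[OF P(2)] by simp
  qed
  have exm: "exact_at C m p"
    unfolding exact_at_iff[OF m(1) P(1)]
  proof (intro conjI m(2) allI ballI impI)
    fix t x assume x: "x \<in> Hom C t P" "p \<cdot> x = Zero C t X"
    have t: "t \<in> Obj C" using x Hom_obj by blast
    note qx = comp_hom[OF x(1) P(2)]
    have "ds ! k \<cdot> (q \<cdot> x) = Zero C t S"
      using comp_assoc[OF x(1) P(2) dk] P(3) comp_assoc[OF x(1) P(1) f] x(2) comp_zero_right[OF f t] by simp
    then have "covers C (ds ! l) (q \<cdot> x)" using exk qx unfolding exact_at_iff[OF dl dk] by blast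
    then obtain s e y where e: "e \<in> Hom C s t" "y \<in> Hom C s (ext_ob C ds l)" "epi_arr C e" "ds ! l \<cdot> y = (q \<cdot> x) \<cdot> e"
      unfolding covers_iff[OF dl qx] by blast
    have "m \<cdot> y = x \<cdot> e"
    proof (rule P(5)[OF comp_hom[OF e(2) m(1)] comp_hom[OF e(1) x(1)]])
      show "p \<cdot> (m \<cdot> y) = p \<cdot> (x \<cdot> e)"
        using comp_assoc[OF e(2) m(1) P(1)] m(2) comp_zero_left[OF e(2) o(2)] comp_assoc[OF e(1) x(1) P(1)] x(2)
          comp_zero_left[OF e(1) o(2)] by simp
      show "q \<cdot> (m \<cdot> y) = q \<cdot> (x \<cdot> e)"
        using comp_assoc[OF e(2) m(1) P(2)] m(3) comp_assoc[OF e(1) x(1) P(2)] e(4) by simp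
    qed
    then show "covers C m x" unfolding covers_iff[OF m(1) x(1)] using e by blast
  qed
  \<comment> \<open>With \<open>k = Suc l\<close>, only the arrows at \<open>l\<close> and
    \<open>k\<close> touch \<open>P\<close>. The comparison map is accordingly the identity up to
    \<open>l\<close>, followed by \<open>q\<close> and \<open>f\<close>.\<close>
  let ?fs = "ds[l := m, k := p]"
  have len: "length ?fs = Suc k" using D(1) by simp
  have nth: "?fs ! l = m" "?fs ! k = p" "\<And>j. j < l \<Longrightarrow> ?fs ! j = ds ! j" using D(1) l by auto
  have fs: "?fs \<in> extensions C k X Y"
  proof (rule extensionsI[OF len])
    show "mono_arr C (?fs ! 0)"
    proof (cases "l = 0")
      case True
      then show ?thesis using mono_cancel[OF _ m(1) P(2)] m(3) D(5) nth(1) by auto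
    next
      case False
      then show ?thesis using nth(3)[of 0] D(5) by simp
    qed
    show "epi_arr C (?fs ! k)" using nth(2) epi D(6) by simp
    show "Dom C (?fs ! 0) = Y"
    proof (cases "l = 0")
      case True
      then show ?thesis using nth(1) m(1) D(2) by (auto simp: Hom_iff)
    next
      case False
      then show ?thesis using nth(3)[of 0] D(4)[of 0] D(2) by (simp add: Hom_iff)
    qed
    show "Cod C (?fs ! k) = X" using nth(2) P(1) by (simp add: Hom_iff)
    fix j assume j: "j < k"
    consider "j = l" | "Suc j = l" | "Suc j < l" using j l by linarith
    then show "exact_at C (?fs ! j) (?fs ! Suc j)"
    proof cases
      case 1
      then show ?thesis using nth exm l by simp
    next
      case 2
      have dj: "ds ! j \<in> Hom C (ext_ob C ds j) (ext_ob C ds l)" using D(4)[of j] 2 l by simp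
      have exl: "exact_at C (ds ! j) (ds ! l)" using D(7)[of j] 2 l by simp
      have jo: "ext_ob C ds j \<in> Obj C" using dj Hom_obj by blast
      have "exact_at C (ds ! j) m"
        unfolding exact_at_iff[OF dj m(1)]
      proof (intro conjI allI ballI impI)
        have "q \<cdot> (m \<cdot> ds ! j) = Zero C (ext_ob C ds j) (ext_ob C ds k)"
          using comp_assoc[OF dj m(1) P(2)] m(3) exl unfolding exact_at_iff[OF dj dl] by simp
        moreover have "p \<cdot> (m \<cdot> ds ! j) = Zero C (ext_ob C ds j) X"
          using comp_assoc[OF dj m(1) P(1)] m(2) comp_zero_left[OF dj o(2)] by simp
        ultimately show "m \<cdot> ds ! j = Zero C (ext_ob C ds j) P" using m0[OF comp_hom[OF dj m(1)]] by blast
        fix t x assume x: "x \<in> Hom C t (ext_ob C ds l)" "m \<cdot> x = Zero C t P"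
        have "ds ! l \<cdot> x = Zero C t (ext_ob C ds k)"
          using comp_assoc[OF x(1) m(1) P(2)] m(3) x(2) comp_zero_right[OF P(2) Hom_obj(1)[OF x(1)]] by simp
        then show "covers C (ds ! j) x" using exl x(1) unfolding exact_at_iff[OF dj dl] by blast
      qed
      then show ?thesis using nth 2 by auto
    next
      case 3
      then show ?thesis using nth(3)[of j] nth(3)[of "Suc j"] D(7)[of j] l by simp
    qed
  qed
  note F = extensionsD[OF fs]
  have ob: "ext_ob C ?fs j = ext_ob C ds j" if "j \<le> l" for j
  proof -
    have "?fs ! j \<in> Hom C (ext_ob C ?fs j) (ext_ob C ?fs (Suc j))" using F(4)[of j] that l by simp
    moreover have "?fs ! j \<in> Hom C (ext_ob C ds j) (if j = l then P else ext_ob C ds (Suc j))"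
      using nth(1) nth(3)[of j] m(1) D(4)[of j] that l by (cases "j = l") auto
    ultimately show ?thesis by (auto simp: Hom_iff)
  qed
  have obk: "ext_ob C ?fs k = P" using F(4)[of k] nth(2) P(1) by (auto simp: Hom_iff)
  have obo: "ext_ob C ds j \<in> Obj C" if "j \<le> k" for j using D(4)[OF that] Hom_obj by blast
  define u where "u j = (if j \<le> l then Ide C (ext_ob C ds j) else if j = k then q else f)" for j
  have uv: "u j = Ide C (ext_ob C ds j)" if "j \<le> l" for j using that by (simp add: u_def)
  have uk: "u k = q" "u (Suc k) = f" unfolding u_def using l by auto
  have "u 0 = Ide C (ext_ob C ?fs 0)" using uv ob by simp
  moreover have "u j \<in> Hom C (ext_ob C ?fs j) (ext_ob C ds j)" if jk: "j \<le> Suc k" for j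
  proof -
    consider "j = Suc k" | "j = k" | "j \<le> l" using jk l by linarith
    then show ?thesis
    proof cases
      case 3
      then show ?thesis using uv ob ide_hom obo l by simp
    qed (use uk F(3) D(3) f P(2) obk in auto)
  qed
  moreover have "u (Suc j) \<cdot> (?fs ! j) = (ds ! j) \<cdot> u j" if jk: "j \<le> k" for j
  proof -
    consider "j = k" | "j = l" | "j < l" using jk l by linarith
    then show ?thesis
    proof cases
      case 1
      then show ?thesis using uk nth P(3) by simp
    next
      case 2
      then show ?thesis using uk uv[of l] nth m(3) l comp_ide_right[OF dl] by simp
    next
      case 3
      then have "ds ! j \<in> Hom C (ext_ob C ds j) (ext_ob C ds (Suc j))" using D(4)[of j] l by simp
      then show ?thesis using 3 uv[of j] uv[of "Suc j"] nth(3) comp_ide_right comp_ide_left by simp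
    qed
  qed
  ultimately have "comparison C k ?fs ds f" unfolding comparison_def using uk by blast
  then show ?thesis using fs by blast
qed

text \<open>Pulling back along \<open>f\<close> and along zero gives two extensions of
  \<open>X\<close> by \<open>Y\<close>. Their equivalence makes zero a comparison for the first one
  too, so \<open>f\<close> and zero differ by an arrow through \<open>ds ! k\<close>. No group law
  on Ext is involved.\<close>

lemma Ext_vanishing_lifts:
  assumes ds: "ds \<in> extensions C k S Y"
    and inj: "\<And>j. \<lbrakk>1 \<le> j; j \<le> k\<rbrakk> \<Longrightarrow> injective_object C (ext_ob C ds j)" and k: "1 \<le> k"
    and ext: "is_singleton (Ext C k X Y)"
  shows "lifts C X (ds ! k)"
proof -
  note D = extensionsD[OF ds]
  have dk: "ds ! k \<in> Hom C (ext_ob C ds k) S" using D(4)[of k] D(3) by simp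
  show ?thesis
  proof (rule liftsI[OF dk])
    fix f assume f: "f \<in> Hom C X S"
    have z: "Zero C X S \<in> Hom C X S" using zero_hom f Hom_obj by blast
    obtain fs where fs: "fs \<in> extensions C k X Y" "comparison C k fs ds f" using pullback_extension[OF ds k f] by blast
    obtain gs where gs: "gs \<in> extensions C k X Y" "comparison C k gs ds (Zero C X S)"
      using pullback_extension[OF ds k z] by blast
    have "equivclp (ext_morphism C k X Y) gs fs" using ext fs gs unfolding is_singleton_Ext_iff by blast
    then have c: "comparison C k fs ds (Zero C X S)" using comparison_zero_equivclp[OF ds inj k _ gs(2)] by blast
    show "\<exists>h\<in>Hom C X (ext_ob C ds k). ds ! k \<cdot> h = f"
      using comparison_unique[OF fs(1) ds inj fs(2) c] minus_zero[OF f] by simp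
  qed
qed

text \<open>Yoneda splicing. If \<open>J\<close> is injective, this lengthens a truncated
  coresolution of \<open>Y\<close> by one term.\<close>

lemma splice_extension:
  assumes ds: "ds \<in> extensions C k S Y" and s: "ses C S i J p T"
  defines "es \<equiv> ds[k := i \<cdot> ds ! k] @ [p]"
  shows "es \<in> extensions C (Suc k) T Y" "es ! Suc k = p" "ext_ob C es (Suc k) = J"
    "\<And>j. j \<le> k \<Longrightarrow> ext_ob C es j = ext_ob C ds j"
proof -
  note D = extensionsD[OF ds] and A = sesD[OF s]
  have dk: "ds ! k \<in> Hom C (ext_ob C ds k) S" using D(4)[of k] D(3) by simp
  note id = comp_hom[OF dk A(1)]
  have nth: "es ! Suc k = p" "es ! k = i \<cdot> ds ! k" "\<And>j. j < k \<Longrightarrow> es ! j = ds ! j"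
    unfolding es_def using D(1) by (auto simp: nth_append)
  show "es ! Suc k = p" by (rule nth(1))
  have len: "length es = Suc (Suc k)" unfolding es_def using D(1) by simp
  show "ext_ob C es (Suc k) = J" unfolding ext_ob_def using len nth(1) A(2) by (simp add: Hom_iff)
  show "ext_ob C es j = ext_ob C ds j" if "j \<le> k" for j
    using nth that len D(1) id dk unfolding ext_ob_def by (cases "j = k") (auto simp: Hom_iff)
  show "es \<in> extensions C (Suc k) T Y"
  proof (rule extensionsI[OF len])
    show "mono_arr C (es ! 0)"
    proof (cases "k = 0")
      case True
      then show ?thesis using nth(2) mono_comp[OF _ dk A(3,1)] D(5) by simp
    next
      case False
      then show ?thesis using nth(3) D(5) by simp
    qed
    show "epi_arr C (es ! Suc k)" "Cod C (es ! Suc k) = T" using nth(1) A by (auto simp: Hom_iff)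
    show "Dom C (es ! 0) = Y"
    proof (cases "k = 0")
      case True
      then show ?thesis using nth(2) id D(2) by (auto simp: Hom_iff)
    next
      case False
      then show ?thesis using nth(3)[of 0] D(4)[of 0] D(2) by (simp add: Hom_iff)
    qed
    fix j assume j: "j < Suc k"
    consider "j = k" | "Suc j = k" | "Suc j < k" using j by linarith
    then show "exact_at C (es ! j) (es ! Suc j)"
    proof cases
      case 1
      have "exact_at C (i \<cdot> ds ! k) p"
        unfolding exact_at_iff[OF id A(2)]
      proof (intro conjI allI ballI impI)
        show "p \<cdot> (i \<cdot> ds ! k) = Zero C (ext_ob C ds k) T"
          using comp_assoc[OF dk A(1,2)] A(5) comp_zero_left[OF dk Hom_obj(2)[OF A(2)]] by simp
        fix t x assume x: "x \<in> Hom C t J" "p \<cdot> x = Zero C t T"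
        obtain y where y: "y \<in> Hom C t S" "i \<cdot> y = x" using ses_lift[OF s x] by blast
        obtain v e z where e: "e \<in> Hom C v t" "z \<in> Hom C v (ext_ob C ds k)" "epi_arr C e" "ds ! k \<cdot> z = y \<cdot> e"
          using epi_covers[OF D(6) dk y(1)] unfolding covers_iff[OF dk y(1)] by blast
        have "(i \<cdot> ds ! k) \<cdot> z = x \<cdot> e"
          using comp_assoc[OF e(2) dk A(1)] e(4) comp_assoc[OF e(1) y(1) A(1)] y(2) by simp
        then show "covers C (i \<cdot> ds ! k) x" unfolding covers_iff[OF id x(1)] using e by blast
      qed
      then show ?thesis using nth 1 by simp
    next
      case 2
      have dj: "ds ! j \<in> Hom C (ext_ob C ds j) (ext_ob C ds k)" using D(4)[of j] 2 by simp
      have ex: "exact_at C (ds ! j) (ds ! k)" using D(7)[of j] 2 by simp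
      have "exact_at C (ds ! j) (i \<cdot> ds ! k)"
        unfolding exact_at_iff[OF dj id]
      proof (intro conjI allI ballI impI)
        show "(i \<cdot> ds ! k) \<cdot> ds ! j = Zero C (ext_ob C ds j) J"
          using comp_assoc[OF dj dk A(1)] ex comp_zero_right[OF A(1) Hom_obj(1)[OF dj]] unfolding exact_at_iff[OF dj dk] by simp
        fix t x assume x: "x \<in> Hom C t (ext_ob C ds k)" "(i \<cdot> ds ! k) \<cdot> x = Zero C t J"
        have "i \<cdot> (ds ! k \<cdot> x) = Zero C t J" using x comp_assoc[OF x(1) dk A(1)] by simp
        then have "ds ! k \<cdot> x = Zero C t S" using monoD0[OF A(3,1) comp_hom[OF x(1) dk]] by blast
        then show "covers C (ds ! j) x" using ex x(1) unfolding exact_at_iff[OF dj dk] by blast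
      qed
      then show ?thesis using nth 2 by auto
    next
      case 3
      then show ?thesis using nth(3)[of j] nth(3)[of "Suc j"] D(7)[of j] by simp
    qed
  qed
qed

lemma Ext_vanishing_acyclic:
  assumes enough: "enough_injectives C" and Y: "Y \<in> Obj C"
    and ext: "\<And>i X. \<lbrakk>1 \<le> i; i \<le> n; X \<in> A\<rbrakk> \<Longrightarrow> is_singleton (Ext C i X Y)"
  shows "ext_acyclic C A n Y"
proof -
  \<comment> \<open>After \<open>k\<close> steps \<open>ds\<close> is a truncated coresolution with
    cosyzygy \<open>S\<close>; the remaining \<open>m\<close> degrees of vanishing belong to
    \<open>S\<close>. Splicing one more injective uses Ext in degree \<open>k + 1\<close>.\<close>
  have *: "ext_acyclic C A m S" if "ds \<in> extensions C k S Y" "k + m = n"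
    "\<And>j. \<lbrakk>1 \<le> j; j \<le> k\<rbrakk> \<Longrightarrow> injective_object C (ext_ob C ds j)" for m k ds S
    using that
  proof (induction m arbitrary: k ds S)
    case (Suc m)
    note D = extensionsD[OF Suc.prems(1)]
    have "S \<in> Obj C" using D(4)[of k] D(3) Hom_obj by fastforce
    then obtain J i where J: "injective_object C J" "i \<in> Hom C S J" "mono_arr C i"
      using enough unfolding enough_injectives_def by blast
    obtain T p where s: "ses C S i J p T" using mono_ses[OF J(3,2)] by blast
    define es where "es = ds[k := i \<cdot> ds ! k] @ [p]"
    note E = splice_extension[OF Suc.prems(1) s, folded es_def]
    have inj: "injective_object C (ext_ob C es j)" if "1 \<le> j" "j \<le> Suc k" for j
      using that E(3,4) J(1) Suc.prems(3) by (cases "j = Suc k") auto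
    have "lifts C X p" if "X \<in> A" for X
      using Ext_vanishing_lifts[OF E(1) inj _ ext[OF _ _ that]] Suc.prems(2) E(2) by simp
    moreover have "ext_acyclic C A m T" using Suc.IH[OF E(1) _ inj] Suc.prems(2) by simp
    ultimately show ?case using J(1) s unfolding ext_acyclic.simps by blast
  qed simp
  \<comment> \<open>The coresolution before any step: the single identity arrow, with no middle term
    to be injective.\<close>
  have "[Ide C Y] \<in> extensions C 0 Y Y"
    by (rule extensionsI) (use mono_ide[OF Y] epi_ide[OF Y] ide_hom[OF Y] in \<open>auto simp: Hom_iff\<close>)
  then show ?thesis using *[of "[Ide C Y]" 0 Y n] by simp
qed

section \<open>Dimension shifting along a finite resolution\<close>

lemma ext_acyclic_Suc: "ext_acyclic C A (Suc n) Y \<Longrightarrow> ext_acyclic C A n Y"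
proof (induction n arbitrary: Y)
  case (Suc n)
  then obtain J S f g where "injective_object C J" "ses C Y f J g S" "\<forall>X\<in>A. lifts C X g" "ext_acyclic C A (Suc n) S"
    unfolding ext_acyclic.simps(2)[of C A "Suc n"] by blast
  moreover from this have "ext_acyclic C A n S" using Suc.IH by blast
  ultimately show ?case unfolding ext_acyclic.simps by blast
qed simp

lemma ext_acyclic_le: "\<lbrakk>ext_acyclic C A n Y; m \<le> n\<rbrakk> \<Longrightarrow> ext_acyclic C A m Y"
  by (induction n) (auto simp: le_Suc_eq dest: ext_acyclic_Suc simp del: ext_acyclic.simps)

text \<open>Walking from the left end of the resolution, each image loses one degree of acyclicity
  as a cokernel. There are at most \<open>n\<close> terms in \<open>B\<close>, so at least one
  degree is left at \<open>K\<close>.\<close>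

lemma finite_resol_acyclic:
  assumes n: "1 \<le> n" and B: "\<And>Y. Y \<in> B \<Longrightarrow> ext_acyclic C A n Y" and K: "K \<in> finite_resol C B (n - 1)"
  shows "ext_acyclic C A 1 K"
proof -
  obtain fs where fs: "length fs \<le> n" "exact_bounded C fs" "Cod C (last fs) = K" "\<And>f. f \<in> set fs \<Longrightarrow> Dom C f \<in> B"
    using K n unfolding finite_resol_def by auto
  define r where "r = length fs - 1"
  have ne: "fs \<noteq> []" using fs(2) by (simp add: exact_bounded_def)
  then have len: "length fs = Suc r" unfolding r_def by simp
  have E: "fs \<in> extensions C r K (Dom C (hd fs))" unfolding extensions_def using len fs by simp
  note F = extensionsD[OF E]
  have inB: "ext_ob C fs j \<in> B" if "j \<le> r" for j using that fs(4) len by (simp add: ext_ob_def)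
  \<comment> \<open>Here \<open>i\<close> is the image of the \<open>j\<close>-th arrow. It is the
    kernel at the next term, so the following image is a cokernel of an object known from the
    previous step.\<close>
  have "\<exists>i k e. k \<in> Hom C i (ext_ob C fs (Suc j)) \<and> mono_arr C k \<and> e \<in> Hom C (ext_ob C fs j) i \<and> epi_arr C e \<and>
     fs ! j = k \<cdot> e \<and> ext_acyclic C A (n - j) i" if "j \<le> r" for j
    using that
  proof (induction j)
    case 0
    have f0: "fs ! 0 \<in> Hom C (ext_ob C fs 0) (ext_ob C fs (Suc 0))" using F(4)[of 0] by simp
    have o: "ext_ob C fs 0 \<in> Obj C" using f0 Hom_obj by blast
    show ?case using f0 F(5) ide_hom[OF o] epi_ide[OF o] comp_ide_right[OF f0] B[OF inB[of 0]]
      by (metis diff_zero zero_le)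
  next
    case (Suc j)
    then obtain i k e where k: "k \<in> Hom C i (ext_ob C fs (Suc j))" "mono_arr C k" "e \<in> Hom C (ext_ob C fs j) i" "epi_arr C e"
     "fs ! j = k \<cdot> e" "ext_acyclic C A (n - j) i" by auto
    have j: "j < r" "j \<le> r" "Suc j \<le> r" using Suc by auto
    note f = F(4)[OF j(2)] and g = F(4)[OF j(3)]
    obtain k' e' i' where k': "k' \<in> Hom C i' (ext_ob C fs (Suc (Suc j)))" "e' \<in> Hom C (ext_ob C fs (Suc j)) i'"
      "mono_arr C k'" "epi_arr C e'" "fs ! Suc j = k' \<cdot> e'" using image_factorization[OF g] by blast
    have ex: "exact_at C (fs ! j) (fs ! Suc j)" using F(7)[OF j(1)] .
    have "is_kernel C e' k"
    proof (rule kernelI_covers[OF k(1) k'(2) k(2)])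
      have "k' \<cdot> (e' \<cdot> (k \<cdot> e)) = Zero C (ext_ob C fs j) (ext_ob C fs (Suc (Suc j)))"
        using ex comp_assoc[OF f k'(2,1)] k(5) k'(5) unfolding exact_at_iff[OF f g] by simp
      then have "e' \<cdot> (k \<cdot> e) = Zero C (ext_ob C fs j) i'"
        using monoD0[OF k'(3,1) comp_hom[OF comp_hom[OF k(3,1)] k'(2)]] by blast
      then show "e' \<cdot> k = Zero C i i'"
        using comp_assoc[OF k(3,1) k'(2)] epi_precomp_zero[OF k(4,3) comp_hom[OF k(1) k'(2)]] by simp
      fix t x assume x: "x \<in> Hom C t (ext_ob C fs (Suc j))" "e' \<cdot> x = Zero C t i'"
      have "fs ! Suc j \<cdot> x = Zero C t (ext_ob C fs (Suc (Suc j)))"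
        using comp_assoc[OF x(1) k'(2,1)] k'(5) x(2) comp_zero_right[OF k'(1) Hom_obj(1)[OF x(1)]] by simp
      then have "covers C (fs ! j) x" using ex x(1) unfolding exact_at_iff[OF f g] by blast
      then obtain v d z where d: "d \<in> Hom C v t" "z \<in> Hom C v (ext_ob C fs j)" "epi_arr C d" "fs ! j \<cdot> z = x \<cdot> d"
        unfolding covers_iff[OF f x(1)] by blast
      have "k \<cdot> (e \<cdot> z) = x \<cdot> d" using comp_assoc[OF d(2) k(3,1)] k(5) d(4) by simp
      then show "covers C k x" unfolding covers_iff[OF k(1) x(1)] using d comp_hom[OF d(2) k(3)] by blast
    qed
    then have s: "ses C i k (ext_ob C fs (Suc j)) e' i'" unfolding ses_def using k k' by blast
    have n': "n - j = Suc (n - Suc j)" using j len fs(1) by simp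
    have "ext_acyclic C A (n - Suc j) (ext_ob C fs (Suc j))" using ext_acyclic_le[OF B[OF inB[OF j(3)]]] by simp
    then have "ext_acyclic C A (n - Suc j) i'" using ext_acyclic_cokernel[OF s] k(6) n' by simp
    then show ?case using k' by blast
  qed
  from this[of r] obtain i k e where k: "k \<in> Hom C i K" "mono_arr C k" "e \<in> Hom C (ext_ob C fs r) i" "epi_arr C e"
     "fs ! r = k \<cdot> e" "ext_acyclic C A (n - r) i" using F(3) by auto
  have epi: "epi_arr C k" using epi_cancel[OF _ k(3,1)] k(5) F(6) by simp
  obtain z where z: "zero_object C z" using ex_zero_object by blast
  have o: "z \<in> Obj C" "i \<in> Obj C" using z k Hom_obj by (auto simp: zero_object_def)
  note zi = zero_hom[OF o]
  \<comment> \<open>The last image \<open>i\<close> is isomorphic to \<open>K\<close>. Invariance of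
    \<open>ext_acyclic\<close> under isomorphism is obtained from the short exact sequence with
    kernel zero.\<close>
  have "is_kernel C k (Zero C z i)"
  proof (rule kernelI[OF k(1) zi])
    show "mono_arr C (Zero C z i)" by (rule monoI[OF zi]) (use zero_object_eq_to[OF z] zero_hom o Hom_obj in blast)
    show "k \<cdot> Zero C z i = Zero C z K" using comp_zero_right[OF k(1) o(1)] .
    fix t x assume x: "x \<in> Hom C t i" "k \<cdot> x = Zero C t K"
    have t: "t \<in> Obj C" using x Hom_obj by blast
    have "x = Zero C t i" using monoD0[OF k(2,1) x] .
    then show "\<exists>u\<in>Hom C t z. Zero C z i \<cdot> u = x"
      using zero_hom[OF t o(1)] comp_zero_left[OF zero_hom[OF t o(1)] o(2)] by blast
  qed
  then have s: "ses C z (Zero C z i) i k K" unfolding ses_def using zi k epi by blast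
  have "1 \<le> n - r" using len fs(1) by simp
  then show ?thesis
    using ext_acyclic_cokernel[OF s ext_acyclic_injective[OF injective_zero_object[OF z]] ext_acyclic_le[OF k(6)]] by blast
qed

end

section \<open>Exact functors\<close>

text \<open>Read off the definition alone: \<open>exact_bounded_iff\<close> is available in abelian
  categories, whereas this has to apply to \<open>Ch C\<close>.\<close>

lemma exact_bounded_exact_at:
  assumes "exact_bounded C fs" "Suc j < length fs"
  shows "exact_at C (fs ! j) (fs ! Suc j)"
proof -
  obtain z where "exact_list C ([Zero C z (Dom C (hd fs))] @ fs @ [Zero C (Cod C (last fs)) z])"
    using assms(1) unfolding exact_bounded_def by blast
  then have "exact_list C fs"
    unfolding exact_list_successively by (auto simp: successively_append_iff successively_Cons)
  then show ?thesis using assms(2) unfolding exact_list_def by blast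
qed

context preadditive_category
begin

text \<open>An equation between arrows characterises zero objects, hence additive functors preserve
  them.\<close>

lemma zero_objectI:
  assumes z: "z \<in> Obj C" and e: "Ide C z = Zero C z z"
  shows "zero_object C z"
proof -
  have "Hom C a z = {Zero C a z} \<and> Hom C z a = {Zero C z a}" if a: "a \<in> Obj C" for a
  proof -
    have "f = Zero C a z" if "f \<in> Hom C a z" for f
      using comp_ide_left[OF that] comp_zero_left[OF that z] e by simp
    moreover have "f = Zero C z a" if "f \<in> Hom C z a" for f
      using comp_ide_right[OF that] comp_zero_right[OF that z] e by simp
    ultimately show ?thesis using zero_hom a z by blast
  qed
  then show ?thesis using z unfolding zero_object_def is_singleton_def by blast
qed

lemma zero_object_ide: "zero_object C z \<Longrightarrow> Ide C z = Zero C z z"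
  using zero_object_eq_to ide_hom zero_hom by (meson zero_object_def)

end

text \<open>Both sides are just preadditive, which is what is established for \<open>Ch C\<close>;
  exactness means preservation of those kernels and cokernels that exist.\<close>

locale exact_functor = C: preadditive_category C + D: preadditive_category D
  for C :: "('o, 'm) cat" and D :: "('p, 'n) cat" +
  fixes Fo :: "'o \<Rightarrow> 'p" and Fm :: "'m \<Rightarrow> 'n"
  assumes F_hom: "f \<in> Hom C a b \<Longrightarrow> Fm f \<in> Hom D (Fo a) (Fo b)"
    and F_ide: "a \<in> Obj C \<Longrightarrow> Fm (Ide C a) = Ide D (Fo a)"
    and F_comp: "\<lbrakk>f \<in> Hom C a b; g \<in> Hom C b c\<rbrakk> \<Longrightarrow> Fm (g \<cdot>\<^bsub>C\<^esub> f) = Fm g \<cdot>\<^bsub>D\<^esub> Fm f"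
    and F_add: "\<lbrakk>f \<in> Hom C a b; g \<in> Hom C a b\<rbrakk> \<Longrightarrow> Fm (Add C f g) = Add D (Fm f) (Fm g)"
    and F_kernel: "is_kernel C f k \<Longrightarrow> is_kernel D (Fm f) (Fm k)"
    and F_cokernel: "is_cokernel C f k \<Longrightarrow> is_cokernel D (Fm f) (Fm k)"
begin

lemma F_obj: "a \<in> Obj C \<Longrightarrow> Fo a \<in> Obj D"
  using F_hom[OF C.ide_hom] D.Hom_obj by blast

lemma F_zero:
  assumes "a \<in> Obj C" "b \<in> Obj C"
  shows "Fm (Zero C a b) = Zero D (Fo a) (Fo b)"
proof -
  note z = C.zero_hom[OF assms]
  note Fz = F_hom[OF z]
  have "Add D (Fm (Zero C a b)) (Fm (Zero C a b)) = Add D (Zero D (Fo a) (Fo b)) (Fm (Zero C a b))"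
    using F_add[OF z z] C.add_zero_left[OF z] D.add_zero_left[OF Fz] by simp
  then show ?thesis using D.add_cancel_right[OF Fz D.zero_hom[OF D.Hom_obj[OF Fz]] Fz] by blast
qed

lemma F_dom: "f \<in> Arr C \<Longrightarrow> Dom D (Fm f) = Fo (Dom C f)"
  and F_cod: "f \<in> Arr C \<Longrightarrow> Cod D (Fm f) = Fo (Cod C f)"
  using F_hom[OF Hom_Arr] by (auto simp: Hom_iff)

lemma F_zero_object:
  assumes "zero_object C z"
  shows "zero_object D (Fo z)"
proof -
  have z: "z \<in> Obj C" using assms by (simp add: zero_object_def)
  show ?thesis
    using D.zero_objectI[OF F_obj[OF z]] F_ide[OF z] F_zero[OF z z] C.zero_object_ide[OF assms] by simp
qed

lemma F_biproduct:
  assumes "biproduct C s a b i j p q"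
  shows "biproduct D (Fo s) (Fo a) (Fo b) (Fm i) (Fm j) (Fm p) (Fm q)"
proof -
  note B = C.biproductD[OF assms]
  have o: "s \<in> Obj C" "a \<in> Obj C" "b \<in> Obj C" using B C.Hom_obj by blast+
  show ?thesis
    unfolding biproduct_def
    using F_hom[OF B(1)] F_hom[OF B(2)] F_hom[OF B(3)] F_hom[OF B(4)]
      F_comp[OF B(1,3)] F_comp[OF B(2,4)] F_comp[OF B(2,3)] F_comp[OF B(1,4)] B(5-9)
      F_comp[OF B(3,1)] F_comp[OF B(4,2)] F_add[OF C.comp_hom[OF B(3,1)] C.comp_hom[OF B(4,2)]]
      F_ide[OF o(1)] F_ide[OF o(2)] F_ide[OF o(3)] F_zero[OF o(2,3)] F_zero[OF o(3,2)] by simp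
qed

lemma F_exact_at: "exact_at C f g \<Longrightarrow> exact_at D (Fm f) (Fm g)"
  unfolding exact_at_def is_image_def using F_kernel F_cokernel by blast

lemma F_exact_list:
  assumes "exact_list C fs"
  shows "exact_list D (map Fm fs)"
  using assms F_exact_at unfolding exact_list_def by auto

lemma exact_bounded_arr:
  assumes "exact_bounded C fs" "f \<in> set fs"
  shows "f \<in> Arr C"
proof -
  obtain z where z: "exact_list C ([Zero C z (Dom C (hd fs))] @ fs @ [Zero C (Cod C (last fs)) z])"
    using assms unfolding exact_bounded_def by blast
  obtain j where j: "j < length fs" "fs ! j = f" using assms(2) by (auto simp: in_set_conv_nth)
  \<comment> \<open>The leading zero arrow shifts indices by one, and the trailing one gives every
    arrow of \<open>fs\<close>, including the last, a right neighbour.\<close>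
  have "exact_at C (([Zero C z (Dom C (hd fs))] @ fs @ [Zero C (Cod C (last fs)) z]) ! Suc j)
      (([Zero C z (Dom C (hd fs))] @ fs @ [Zero C (Cod C (last fs)) z]) ! Suc (Suc j))"
    using z j(1) unfolding exact_list_def by auto
  then show ?thesis using exact_at_arr(1) j by (fastforce simp: nth_append)
qed

lemma F_exact_bounded:
  assumes "exact_bounded C fs"
  shows "exact_bounded D (map Fm fs)"
proof -
  obtain z where z: "zero_object C z" "exact_list C ([Zero C z (Dom C (hd fs))] @ fs @ [Zero C (Cod C (last fs)) z])"
    and ne: "fs \<noteq> []" using assms unfolding exact_bounded_def by blast
  have a: "hd fs \<in> Arr C" "last fs \<in> Arr C" using exact_bounded_arr[OF assms] ne by auto
  have o: "z \<in> Obj C" "Dom C (hd fs) \<in> Obj C" "Cod C (last fs) \<in> Obj C"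
    using z a C.dom_obj C.cod_obj by (auto simp: zero_object_def)
  have "map Fm ([Zero C z (Dom C (hd fs))] @ fs @ [Zero C (Cod C (last fs)) z]) =
    [Zero D (Fo z) (Dom D (hd (map Fm fs)))] @ map Fm fs @ [Zero D (Cod D (last (map Fm fs))) (Fo z)]"
    using ne a o F_zero F_dom F_cod by (simp add: hd_map last_map)
  then show ?thesis unfolding exact_bounded_def
    using F_exact_list[OF z(2)] F_zero_object[OF z(1)] ne by auto
qed

lemma F_short_exact: "short_exact C f g \<Longrightarrow> short_exact D (Fm f) (Fm g)"
  unfolding short_exact_def using F_exact_bounded by fastforce

lemma F_finite_resol:
  assumes "c \<in> finite_resol C Y k" "\<And>y. y \<in> Y \<Longrightarrow> Fo y \<in> Y'"
  shows "Fo c \<in> finite_resol D Y' k"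
proof -
  obtain fs where fs: "length fs \<le> k + 1" "exact_bounded C fs" "Cod C (last fs) = c" "\<forall>f\<in>set fs. Dom C f \<in> Y"
    using assms(1) unfolding finite_resol_def by blast
  have ne: "fs \<noteq> []" using fs by (simp add: exact_bounded_def)
  have "Cod D (last (map Fm fs)) = Fo c"
    using F_cod exact_bounded_arr[OF fs(2)] fs(3) ne by (simp add: last_map)
  moreover have "\<forall>g\<in>set (map Fm fs). Dom D g \<in> Y'"
    using F_dom exact_bounded_arr[OF fs(2)] fs(4) assms(2) by auto
  ultimately show ?thesis unfolding finite_resol_def using F_exact_bounded[OF fs(2)] fs(1)
    by (intro CollectI exI[of _ "map Fm fs"]) auto
qed

lemma F_extensions:
  assumes "fs \<in> extensions C k X Y"
  shows "map Fm fs \<in> extensions D k (Fo X) (Fo Y)"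
proof -
  have fs: "length fs = k + 1" "exact_bounded C fs" "Dom C (hd fs) = Y" "Cod C (last fs) = X"
    using assms unfolding extensions_def by auto
  have ne: "fs \<noteq> []" using fs by auto
  then have "hd fs \<in> Arr C" "last fs \<in> Arr C" using exact_bounded_arr[OF fs(2)] by auto
  then show ?thesis unfolding extensions_def
    using fs ne F_exact_bounded[OF fs(2)] F_dom F_cod by (simp add: hd_map last_map)
qed

lemma F_ext_morphism:
  assumes "ext_morphism C k X Y fs gs"
  shows "ext_morphism D k (Fo X) (Fo Y) (map Fm fs) (map Fm gs)"
proof -
  obtain u where u: "u 0 = Ide C Y" "u (k + 1) = Ide C X"
    "\<And>j. 1 \<le> j \<and> j \<le> k \<Longrightarrow> u j \<in> Hom C (Dom C (fs ! j)) (Dom C (gs ! j))"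
    "\<And>j. j\<le>k \<Longrightarrow> u (Suc j) \<cdot>\<^bsub>C\<^esub> (fs ! j) = (gs ! j) \<cdot>\<^bsub>C\<^esub> u j"
    and e: "fs \<in> extensions C k X Y" "gs \<in> extensions C k X Y"
    using assms unfolding ext_morphism_def by blast
  have arr: "fs ! j \<in> Arr C" "gs ! j \<in> Arr C" if "j \<le> k" for j
    using that exact_bounded_arr[of fs "fs ! j"] exact_bounded_arr[of gs "gs ! j"] e
    unfolding extensions_def by auto
  have len: "length fs = Suc k" "length gs = Suc k" using e unfolding extensions_def by auto
  have ends: "Dom C (fs ! 0) = Y" "Cod C (fs ! k) = X" "Dom C (gs ! 0) = Y" "Cod C (gs ! k) = X"
    using e len unfolding extensions_def
    by (auto simp: hd_conv_nth last_conv_nth simp flip: length_greater_0_conv)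
  have o: "Y \<in> Obj C" "X \<in> Obj C" using ends arr[of 0] arr[of k] C.dom_obj C.cod_obj by auto
  have mid: "Cod C (hs ! j) = Dom C (hs ! Suc j)" if "hs \<in> extensions C k X Y" "j < k" for hs j
    using that exact_at_arr(3)[OF exact_bounded_exact_at[of C hs j]] unfolding extensions_def by auto
  have uh: "u j \<in> Hom C (Dom C (fs ! j)) (Dom C (gs ! j))" if "j \<le> k" for j
    using that u(1,3) ends C.ide_hom[OF o(1)] by (cases "j = 0") auto
  have uh': "u (Suc j) \<in> Hom C (Cod C (fs ! j)) (Cod C (gs ! j))" if "j \<le> k" for j
    using that u(2) uh[of "Suc j"] ends C.ide_hom[OF o(2)] mid[OF e(1)] mid[OF e(2)] by (cases "j = k") auto
  have "Fm (u (Suc j)) \<cdot>\<^bsub>D\<^esub> (map Fm fs ! j) = (map Fm gs ! j) \<cdot>\<^bsub>D\<^esub> Fm (u j)" if j: "j \<le> k" for j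
    using F_comp[OF Hom_Arr[OF arr(1)[OF j]] uh'[OF j]] F_comp[OF uh[OF j] Hom_Arr[OF arr(2)[OF j]]] u(4)[OF j] len j
    by simp
  moreover have "Fm (u j) \<in> Hom D (Dom D (map Fm fs ! j)) (Dom D (map Fm gs ! j))" if "1 \<le> j \<and> j \<le> k" for j
    using F_hom[OF u(3)[OF that]] F_dom arr that len by simp
  ultimately show ?thesis unfolding ext_morphism_def
    using F_extensions e u(1,2) F_ide o by (intro conjI exI[of _ "Fm \<circ> u"]) auto
qed

lemma F_equivclp:
  assumes "equivclp (ext_morphism C k X Y) fs gs"
  shows "equivclp (ext_morphism D k (Fo X) (Fo Y)) (map Fm fs) (map Fm gs)"
  using assms
proof (induction rule: equivclp_induct)
  case (step gs hs)
  then show ?case using F_ext_morphism equivclp_into_equivclp by metis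
qed simp

end

text \<open>If \<open>G \<circ> F\<close> is the identity, then \<open>G\<close> carries a zigzag between the images of two extensions
  back to the extensions themselves.\<close>

lemma Ext_singleton_retract:
  assumes F: "exact_functor C D Fo Fm" and G: "exact_functor D C Go Gm"
    and o: "\<And>a. a \<in> Obj C \<Longrightarrow> Go (Fo a) = a" and m: "\<And>f. f \<in> Arr C \<Longrightarrow> Gm (Fm f) = f"
    and X: "X \<in> Obj C" and Y: "Y \<in> Obj C" and e: "is_singleton (Ext D k (Fo X) (Fo Y))"
  shows "is_singleton (Ext C k X Y)"
  unfolding is_singleton_Ext_iff
proof (intro conjI ballI)
  interpret F: exact_functor C D Fo Fm by (rule F)
  interpret G: exact_functor D C Go Gm by (rule G)
  obtain gs where "gs \<in> extensions D k (Fo X) (Fo Y)" using e unfolding is_singleton_Ext_iff by blast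
  from G.F_extensions[OF this] show "extensions C k X Y \<noteq> {}" using o[OF X] o[OF Y] by auto
  have id: "map Gm (map Fm fs) = fs" if "fs \<in> extensions C k X Y" for fs
    using that m F.exact_bounded_arr[of fs] unfolding extensions_def by (simp add: map_idI)
  fix fs gs assume fg: "fs \<in> extensions C k X Y" "gs \<in> extensions C k X Y"
  then have "equivclp (ext_morphism D k (Fo X) (Fo Y)) (map Fm fs) (map Fm gs)"
    using e F.F_extensions unfolding is_singleton_Ext_iff by blast
  from G.F_equivclp[OF this] show "equivclp (ext_morphism C k X Y) fs gs"
    by (simp only: id[OF fg(1)] id[OF fg(2)] o[OF X] o[OF Y])
qed

section \<open>Disks and evaluation\<close>

lemma Ch_simps [simp]:
  "Obj (Ch C) = {X. is_chain_cpx C X}" "Arr (Ch C) = {F. is_chain_map C F}" "Dom (Ch C) = Src" "Cod (Ch C) = Tgt"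
  "Ide (Ch C) X = Chain_Map X X (\<lambda>m. Ide C (Ob X m))"
  "Comp (Ch C) G F = Chain_Map (Src F) (Tgt G) (\<lambda>m. Comps G m \<cdot>\<^bsub>C\<^esub> Comps F m)"
  "Add (Ch C) F G = Chain_Map (Src F) (Tgt F) (\<lambda>m. Add C (Comps F m) (Comps G m))"
  "Zero (Ch C) X Y = Chain_Map X Y (\<lambda>m. Zero C (Ob X m) (Ob Y m))"
  by (simp_all add: Ch_def)

lemma Hom_Ch_iff:
  "F \<in> Hom (Ch C) X Y \<longleftrightarrow> Src F = X \<and> Tgt F = Y \<and> is_chain_cpx C X \<and> is_chain_cpx C Y \<and>
     (\<forall>m. Comps F m \<in> Hom C (Ob X m) (Ob Y m) \<and> Diff Y m \<cdot>\<^bsub>C\<^esub> Comps F m = Comps F (m - 1) \<cdot>\<^bsub>C\<^esub> Diff X m)"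
  unfolding Hom_iff[of F] by (auto simp: is_chain_map_def)

lemma Hom_ChD:
  assumes "F \<in> Hom (Ch C) X Y"
  shows "Src F = X" "Tgt F = Y" "is_chain_cpx C X" "is_chain_cpx C Y" "Comps F m \<in> Hom C (Ob X m) (Ob Y m)"
    "Diff Y m \<cdot>\<^bsub>C\<^esub> Comps F m = Comps F (m - 1) \<cdot>\<^bsub>C\<^esub> Diff X m"
  using assms unfolding Hom_Ch_iff by auto

lemma chain_map_eqI:
  assumes "F \<in> Hom (Ch C) X Y" "G \<in> Hom (Ch C) X Y" "\<And>m. Comps F m = Comps G m"
  shows "F = G"
  using assms Hom_ChD(1,2)[OF assms(1)] Hom_ChD(1,2)[OF assms(2)] by (intro chain_map.expand) auto

lemma is_chain_cpxD:
  assumes "is_chain_cpx C X"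
  shows "Ob X m \<in> Obj C" "Diff X m \<in> Hom C (Ob X m) (Ob X (m - 1))"
    "Diff X (m - 1) \<cdot>\<^bsub>C\<^esub> Diff X m = Zero C (Ob X m) (Ob X (m - 2))"
  using assms unfolding is_chain_cpx_def by auto

text \<open>Up to sign the cone of the identity of \<open>a\<close> placed in degree
  \<open>n - 1\<close>. The zero object \<open>z\<close> is a parameter since \<open>C\<close> comes
  with no chosen one.\<close>

definition disk :: "('o, 'm) cat \<Rightarrow> 'o \<Rightarrow> int \<Rightarrow> 'o \<Rightarrow> ('o, 'm) chain_cpx" where
  "disk C z n a = (let ob = (\<lambda>m. if m = n \<or> m = n - 1 then a else z) in
     Chain_Cpx ob (\<lambda>m. if m = n then Ide C a else Zero C (ob m) (ob (m - 1))))"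

text \<open>The bijection Hom(a, X_n) = Hom(D^n a, X): the disk is left adjoint to evaluation in its
  upper degree.\<close>

definition from_disk ::
    "('o, 'm) cat \<Rightarrow> 'o \<Rightarrow> int \<Rightarrow> 'o \<Rightarrow> ('o, 'm) chain_cpx \<Rightarrow> 'm \<Rightarrow> ('o, 'm) chain_map" where
  "from_disk C z n a X h = Chain_Map (disk C z n a) X
     (\<lambda>m. if m = n then h else if m = n - 1 then Diff X n \<cdot>\<^bsub>C\<^esub> h else Zero C z (Ob X m))"

text \<open>The bijection Hom(X_(n-1), a) = Hom(X, D^n a): the disk is right adjoint to evaluation
  in its lower degree.\<close>

definition to_disk ::
    "('o, 'm) cat \<Rightarrow> 'o \<Rightarrow> int \<Rightarrow> 'o \<Rightarrow> ('o, 'm) chain_cpx \<Rightarrow> 'm \<Rightarrow> ('o, 'm) chain_map" where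
  "to_disk C z n a X h = Chain_Map X (disk C z n a)
     (\<lambda>m. if m = n - 1 then h else if m = n then h \<cdot>\<^bsub>C\<^esub> Diff X n else Zero C (Ob X m) z)"

text \<open>Defined through the adjunction, so that functor laws need checking in degree
  \<open>n\<close> only.\<close>

definition disk_map :: "('o, 'm) cat \<Rightarrow> 'o \<Rightarrow> int \<Rightarrow> 'm \<Rightarrow> ('o, 'm) chain_map" where
  "disk_map C z n f = from_disk C z n (Dom C f) (disk C z n (Cod C f)) f"

lemma disk_Ob: "Ob (disk C z n a) m = (if m = n \<or> m = n - 1 then a else z)"
  by (simp add: disk_def Let_def)

lemma disk_Diff:
  "Diff (disk C z n a) m = (if m = n then Ide C a else Zero C (Ob (disk C z n a) m) (Ob (disk C z n a) (m - 1)))"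
  by (simp add: disk_def Let_def)

context preadditive_category
begin

section \<open>The preadditive structure on complexes\<close>

lemma Ch_category: "category (Ch C)"
proof
  fix f assume "f \<in> Arr (Ch C)"
  then show "Dom (Ch C) f \<in> Obj (Ch C)" "Cod (Ch C) f \<in> Obj (Ch C)" by (auto simp: is_chain_map_def)
next
  fix X assume X: "X \<in> Obj (Ch C)"
  then have *: "is_chain_cpx C X" by simp
  show "Ide (Ch C) X \<in> Hom (Ch C) X X"
    unfolding Hom_Ch_iff using * is_chain_cpxD(1)[OF *] is_chain_cpxD(2)[OF *] ide_hom comp_ide_left comp_ide_right
    by (metis Ch_simps(5) chain_map.sel)
next
  fix X Y Z F G assume F: "F \<in> Hom (Ch C) X Y" and G: "G \<in> Hom (Ch C) Y Z"
  note f = Hom_ChD[OF F] and g = Hom_ChD[OF G]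
  have "Diff Z m \<cdot> (Comps G m \<cdot> Comps F m) = Comps G (m - 1) \<cdot> Comps F (m - 1) \<cdot> Diff X m" for m
    using comp_assoc[OF f(5) g(5) is_chain_cpxD(2)[OF g(4)], of m] g(6)[of m]
      comp_assoc[OF f(5)[of m] is_chain_cpxD(2)[OF g(3)] g(5)[of "m - 1"]] f(6)[of m]
      comp_assoc[OF is_chain_cpxD(2)[OF f(3), of m] f(5)[of "m - 1"] g(5)[of "m - 1"]] by simp
  then show "G \<cdot>\<^bsub>Ch C\<^esub> F \<in> Hom (Ch C) X Z" unfolding Hom_Ch_iff using f g comp_hom[OF f(5) g(5)] by simp
next
  fix W X Y Z F G H assume F: "F \<in> Hom (Ch C) W X" and G: "G \<in> Hom (Ch C) X Y" and H: "H \<in> Hom (Ch C) Y Z"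
  show "H \<cdot>\<^bsub>Ch C\<^esub> G \<cdot>\<^bsub>Ch C\<^esub> F = H \<cdot>\<^bsub>Ch C\<^esub> (G \<cdot>\<^bsub>Ch C\<^esub> F)"
    using comp_assoc[OF Hom_ChD(5)[OF F] Hom_ChD(5)[OF G] Hom_ChD(5)[OF H]] by simp
next
  fix F X Y assume F: "F \<in> Hom (Ch C) X Y"
  note f = Hom_ChD[OF F]
  show "Ide (Ch C) Y \<cdot>\<^bsub>Ch C\<^esub> F = F" "F \<cdot>\<^bsub>Ch C\<^esub> Ide (Ch C) X = F"
    using f comp_ide_left[OF f(5)] comp_ide_right[OF f(5)] by (intro chain_map.expand; simp)+
qed

lemma Ch_hom_group:
  assumes X: "is_chain_cpx C X" and Y: "is_chain_cpx C Y"
  shows "comm_group (hom_group (Ch C) X Y)"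
proof (rule comm_groupI; unfold hom_group_simps)
  note dx = is_chain_cpxD[OF X] and dy = is_chain_cpxD[OF Y]
  have z: "Zero C (Ob X m) (Ob Y k) \<in> Hom C (Ob X m) (Ob Y k)" for m k using zero_hom dx dy by blast
  show Z: "Zero (Ch C) X Y \<in> Hom (Ch C) X Y"
    unfolding Hom_Ch_iff using X Y z comp_zero_right[OF dy(2) dx(1)] comp_zero_left[OF dx(2) dy(1)] by simp
  fix F assume F: "F \<in> Hom (Ch C) X Y"
  note f = Hom_ChD[OF F]
  show "Add (Ch C) (Zero (Ch C) X Y) F = F" using f add_zero_left[OF f(5)] by (intro chain_map.expand) simp
  let ?N = "Chain_Map X Y (\<lambda>m. Zero C (Ob X m) (Ob Y m) \<boxminus> Comps F m)"
  have "?N \<in> Hom (Ch C) X Y"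
    unfolding Hom_Ch_iff
    using X Y minus_hom[OF z f(5)] comp_minus_right[OF z f(5) dy(2)] comp_minus_left[OF dx(2) z f(5)] f(6)
      comp_zero_right[OF dy(2) dx(1)] comp_zero_left[OF dx(2) dy(1)] by simp
  moreover have "Add (Ch C) ?N F = Zero (Ch C) X Y" using minus_add[OF z f(5)] by simp
  ultimately show "\<exists>N\<in>Hom (Ch C) X Y. Add (Ch C) N F = Zero (Ch C) X Y" by blast
  fix G assume G: "G \<in> Hom (Ch C) X Y"
  note g = Hom_ChD[OF G]
  show "Add (Ch C) F G \<in> Hom (Ch C) X Y"
    unfolding Hom_Ch_iff
    using f g add_hom[OF f(5) g(5)] comp_add_right[OF f(5) g(5) dy(2)] comp_add_left[OF dx(2) f(5) g(5)] by simp
  show "Add (Ch C) F G = Add (Ch C) G F" using f g add_comm[OF f(5) g(5)] by simp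
  fix H assume H: "H \<in> Hom (Ch C) X Y"
  show "Add (Ch C) (Add (Ch C) F G) H = Add (Ch C) F (Add (Ch C) G H)"
    using f g Hom_ChD[OF H] add_assoc[OF f(5) g(5) Hom_ChD(5)[OF H]] by simp
qed

lemma Ch_preadditive: "preadditive_category (Ch C)"
proof (intro preadditive_category.intro preadditive_category_axioms.intro Ch_category)
  fix X Y assume "X \<in> Obj (Ch C)" "Y \<in> Obj (Ch C)"
  then show "comm_group (hom_group (Ch C) X Y)" using Ch_hom_group by simp
next
  fix X Y Z F G H assume F: "F \<in> Hom (Ch C) X Y" and G: "G \<in> Hom (Ch C) Y Z" and H: "H \<in> Hom (Ch C) Y Z"
  show "Add (Ch C) G H \<cdot>\<^bsub>Ch C\<^esub> F = Add (Ch C) (G \<cdot>\<^bsub>Ch C\<^esub> F) (H \<cdot>\<^bsub>Ch C\<^esub> F)"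
    using comp_add_left[OF Hom_ChD(5)[OF F] Hom_ChD(5)[OF G] Hom_ChD(5)[OF H]] by simp
next
  fix X Y Z F G H assume F: "F \<in> Hom (Ch C) X Y" and G: "G \<in> Hom (Ch C) X Y" and H: "H \<in> Hom (Ch C) Y Z"
  show "H \<cdot>\<^bsub>Ch C\<^esub> Add (Ch C) F G = Add (Ch C) (H \<cdot>\<^bsub>Ch C\<^esub> F) (H \<cdot>\<^bsub>Ch C\<^esub> G)"
    using comp_add_right[OF Hom_ChD(5)[OF F] Hom_ChD(5)[OF G] Hom_ChD(5)[OF H]] Hom_ChD(1,2)[OF F] by simp
qed

lemma disk_Diff_hom:
  assumes z: "z \<in> Obj C" and a: "a \<in> Obj C"
  shows "Diff (disk C z n a) m \<in> Hom C (Ob (disk C z n a) m) (Ob (disk C z n a) (m - 1))"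
  using zero_hom ide_hom z a by (simp add: disk_Diff disk_Ob)

lemma disk_cpx:
  assumes z: "z \<in> Obj C" and a: "a \<in> Obj C"
  shows "is_chain_cpx C (disk C z n a)"
proof -
  let ?X = "disk C z n a"
  note h = disk_Diff_hom[OF z a, of n]
  have o: "Ob ?X m \<in> Obj C" for m using z a by (simp add: disk_Ob)
  have "Diff ?X (m - 1) \<cdot> Diff ?X m = Zero C (Ob ?X m) (Ob ?X (m - 2))" for m
  proof (cases "m = n")
    case True
    then have "Diff ?X (m - 1) = Zero C (Ob ?X (m - 1)) (Ob ?X (m - 2))" unfolding disk_Diff by simp
    then show ?thesis using comp_zero_left[OF h o] by simp
  next
    case False
    then have "Diff ?X m = Zero C (Ob ?X m) (Ob ?X (m - 1))" unfolding disk_Diff by simp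
    moreover have "Diff ?X (m - 1) \<in> Hom C (Ob ?X (m - 1)) (Ob ?X (m - 2))" using h[of "m - 1"] by simp
    ultimately show ?thesis using comp_zero_right o by simp
  qed
  then show ?thesis unfolding is_chain_cpx_def using h o by blast
qed

end

locale pointed_preadditive = preadditive_category +
  fixes z
  assumes zero: "zero_object C z"
begin

lemma z_obj: "z \<in> Obj C"
  using zero by (simp add: zero_object_def)

sublocale Ch: preadditive_category "Ch C"
  by (rule Ch_preadditive)

lemma disk_obj: "a \<in> Obj C \<Longrightarrow> is_chain_cpx C (disk C z n a)"
  using disk_cpx z_obj by blast

section \<open>The adjunctions between disks and evaluation\<close>

lemma from_disk_hom:
  assumes X: "is_chain_cpx C X" and h: "h \<in> Hom C a (Ob X n)"
  shows "from_disk C z n a X h \<in> Hom (Ch C) (disk C z n a) X"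
proof -
  note D = is_chain_cpxD[OF X]
  have a: "a \<in> Obj C" using h Hom_obj by blast
  note dh = comp_hom[OF h D(2)[of n]]
  have c: "Comps (from_disk C z n a X h) m \<in> Hom C (Ob (disk C z n a) m) (Ob X m)" for m
    using h dh zero_hom[OF z_obj D(1)] by (auto simp: from_disk_def disk_Ob)
  have "Diff X m \<cdot> Comps (from_disk C z n a X h) m = Comps (from_disk C z n a X h) (m - 1) \<cdot> Diff (disk C z n a) m" for m
  proof -
    note l = comp_hom[OF c D(2), of m] and r = comp_hom[OF disk_Diff_hom[OF z_obj a] c[of "m - 1"]]
    consider "m = n" | "m = n - 1" | "Ob (disk C z n a) m = z"
      by (cases "m = n"; cases "m = n - 1") (auto simp: disk_Ob)
    then show ?thesis
    proof cases
      case 1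
      then show ?thesis using comp_ide_right[OF dh] by (simp add: from_disk_def disk_Diff)
    next
      case 2
      have "Diff X m \<cdot> (Diff X n \<cdot> h) = Zero C a (Ob X (m - 1))"
        using comp_assoc[OF h D(2), of "Diff X m" "Ob X (m - 1)"] D(2)[of m] D(3)[of n] comp_zero_left[OF h D(1)] 2 by simp
      then show ?thesis
        using 2 comp_zero_right[OF zero_hom[OF z_obj D(1)] a] by (simp add: from_disk_def disk_Diff disk_Ob)
    next
      case 3
      then show ?thesis using zero_object_eq_from[OF zero] l r by simp
    qed
  qed
  then show ?thesis unfolding Hom_Ch_iff using X c disk_obj[OF a] by (simp add: from_disk_def)
qed

lemma to_disk_hom:
  assumes X: "is_chain_cpx C X" and h: "h \<in> Hom C (Ob X (n - 1)) a"
  shows "to_disk C z n a X h \<in> Hom (Ch C) X (disk C z n a)"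
proof -
  note D = is_chain_cpxD[OF X]
  have a: "a \<in> Obj C" using h Hom_obj by blast
  note dh = comp_hom[OF D(2)[of n] h]
  have c: "Comps (to_disk C z n a X h) m \<in> Hom C (Ob X m) (Ob (disk C z n a) m)" for m
    using h dh zero_hom[OF D(1) z_obj] by (auto simp: to_disk_def disk_Ob)
  have "Diff (disk C z n a) m \<cdot> Comps (to_disk C z n a X h) m = Comps (to_disk C z n a X h) (m - 1) \<cdot> Diff X m" for m
  proof -
    note l = comp_hom[OF c disk_Diff_hom[OF z_obj a], of m] and r = comp_hom[OF D(2) c[of "m - 1"]]
    consider "m = n" | "m = n + 1" | "Ob (disk C z n a) (m - 1) = z"
      by (cases "m = n"; cases "m = n + 1") (auto simp: disk_Ob)
    then show ?thesis
    proof cases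
      case 1
      then show ?thesis using comp_ide_left[OF dh] by (simp add: to_disk_def disk_Diff)
    next
      case 2
      have "(h \<cdot> Diff X n) \<cdot> Diff X m = Zero C (Ob X m) a"
        using comp_assoc[OF D(2)[of m] _ h] D(2)[of n] D(3)[of m] comp_zero_right[OF h D(1)] 2 by simp
      then show ?thesis
        using 2 comp_zero_left[OF zero_hom[OF D(1) z_obj] a] by (simp add: to_disk_def disk_Diff disk_Ob)
    next
      case 3
      then show ?thesis using zero_object_eq_to[OF zero] l r by simp
    qed
  qed
  then show ?thesis unfolding Hom_Ch_iff using X c disk_obj[OF a] by (simp add: to_disk_def)
qed

text \<open>The identity differential determines the component in degree \<open>n - 1\<close> from
  that in degree \<open>n\<close>; all others start at the zero object.\<close>

lemma from_disk_eqI: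
  assumes F: "F \<in> Hom (Ch C) (disk C z n a) X" and G: "G \<in> Hom (Ch C) (disk C z n a) X"
    and e: "Comps F n = Comps G n"
  shows "F = G"
proof (rule chain_map_eqI[OF F G])
  note f = Hom_ChD[OF F] and g = Hom_ChD[OF G]
  fix m
  consider "m = n" | "m = n - 1" | "Ob (disk C z n a) m = z"
      by (cases "m = n"; cases "m = n - 1") (auto simp: disk_Ob)
  then show "Comps F m = Comps G m"
  proof cases
    case 2
    have "Comps H (n - 1) = Diff X n \<cdot> Comps H n" if "H \<in> Hom (Ch C) (disk C z n a) X" for H
      using Hom_ChD(6)[OF that, of n] Hom_ChD(5)[OF that, of "n - 1"] comp_ide_right by (simp add: disk_Diff disk_Ob)
    then show ?thesis using F G e 2 by simp
  next
    case 3
    then show ?thesis using zero_object_eq_from[OF zero] f(5)[of m] g(5)[of m] by simp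
  qed (use e in simp)
qed

lemma to_disk_eqI:
  assumes F: "F \<in> Hom (Ch C) X (disk C z n a)" and G: "G \<in> Hom (Ch C) X (disk C z n a)"
    and e: "Comps F (n - 1) = Comps G (n - 1)"
  shows "F = G"
proof (rule chain_map_eqI[OF F G])
  note f = Hom_ChD[OF F] and g = Hom_ChD[OF G]
  fix m
  consider "m = n - 1" | "m = n" | "Ob (disk C z n a) m = z"
      by (cases "m = n"; cases "m = n - 1") (auto simp: disk_Ob)
  then show "Comps F m = Comps G m"
  proof cases
    case 2
    have "Comps H n = Comps H (n - 1) \<cdot> Diff X n" if "H \<in> Hom (Ch C) X (disk C z n a)" for H
      using Hom_ChD(6)[OF that, of n] Hom_ChD(5)[OF that, of n] comp_ide_left by (simp add: disk_Diff disk_Ob)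
    then show ?thesis using F G e 2 by simp
  next
    case 3
    then show ?thesis using zero_object_eq_to[OF zero] f(5)[of m] g(5)[of m] by simp
  qed (use e in simp)
qed

lemma disk_map_hom:
  assumes "f \<in> Hom C a b"
  shows "disk_map C z n f \<in> Hom (Ch C) (disk C z n a) (disk C z n b)"
    and "Comps (disk_map C z n f) n = f" and "Comps (disk_map C z n f) (n - 1) = f"
proof -
  have "b \<in> Obj C" using assms Hom_obj by blast
  then show "disk_map C z n f \<in> Hom (Ch C) (disk C z n a) (disk C z n b)"
    using from_disk_hom[OF disk_obj, of b f a n n] assms by (simp add: disk_map_def disk_Ob Hom_iff)
  show "Comps (disk_map C z n f) n = f" by (simp add: disk_map_def from_disk_def)
  show "Comps (disk_map C z n f) (n - 1) = f"
    using assms comp_ide_left[OF assms] by (simp add: disk_map_def from_disk_def disk_Diff Hom_iff)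
qed

text \<open>Kernels are tested in degree \<open>n - 1\<close>, through maps into disks, and
  cokernels in degree \<open>n\<close>, through maps out of disks.\<close>

lemma disk_functor: "exact_functor C (Ch C) (disk C z n) (disk_map C z n)"
proof unfold_locales
  note M = disk_map_hom[where n = n]
  fix f a b assume f: "f \<in> Hom C a b"
  show "disk_map C z n f \<in> Hom (Ch C) (disk C z n a) (disk C z n b)" using M f by blast
  {
    fix g c assume g: "g \<in> Hom C b c"
    show "disk_map C z n (g \<cdot> f) = disk_map C z n g \<cdot>\<^bsub>Ch C\<^esub> disk_map C z n f"
      using M(2)[OF f] M(2)[OF g] M(2)[OF comp_hom[OF f g]]
      by (intro from_disk_eqI[OF M(1)[OF comp_hom[OF f g]] Ch.comp_hom[OF M(1)[OF f] M(1)[OF g]]]) simp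
  next
    fix g assume g: "g \<in> Hom C a b"
    show "disk_map C z n (f \<boxplus> g) = Add (Ch C) (disk_map C z n f) (disk_map C z n g)"
      using M(2)[OF f] M(2)[OF g] M(2)[OF add_hom[OF f g]]
      by (intro from_disk_eqI[OF M(1)[OF add_hom[OF f g]] Ch.add_hom[OF M(1)[OF f] M(1)[OF g]]]) simp
  }
next
  note M = disk_map_hom[where n = n]
  fix a assume a: "a \<in> Obj C"
  show "disk_map C z n (Ide C a) = Ide (Ch C) (disk C z n a)"
  proof (rule from_disk_eqI[OF M(1)[OF ide_hom[OF a]]])
    show "Ide (Ch C) (disk C z n a) \<in> Hom (Ch C) (disk C z n a) (disk C z n a)"
      by (rule Ch.ide_hom) (use disk_obj[OF a] in simp)
  qed (use M(2)[OF ide_hom[OF a]] in \<open>simp add: disk_Ob\<close>)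
next
  note M = disk_map_hom[where n = n]
  fix f k assume k: "is_kernel C f k"
  have f: "f \<in> Hom C (Dom C f) (Cod C f)" using k by (simp add: is_kernel_def Hom_iff)
  note kh = kernel_hom[OF k f] note mono = kernel_mono[OF k]
  show "is_kernel (Ch C) (disk_map C z n f) (disk_map C z n k)"
  proof (rule Ch.kernelI[OF M(1)[OF f] M(1)[OF kh]])
    have o: "disk C z n (Dom C k) \<in> Obj (Ch C)" "disk C z n (Cod C f) \<in> Obj (Ch C)"
      using disk_obj Hom_obj[OF f] Hom_obj[OF kh] by simp_all
    show "disk_map C z n f \<cdot>\<^bsub>Ch C\<^esub> disk_map C z n k = Zero (Ch C) (disk C z n (Dom C k)) (disk C z n (Cod C f))"
      using M(2)[OF f] M(2)[OF kh] kernel_zero[OF k f kh]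
      by (intro from_disk_eqI[OF Ch.comp_hom[OF M(1)[OF kh] M(1)[OF f]] Ch.zero_hom[OF o]]) (simp add: disk_Ob)
    show "mono_arr (Ch C) (disk_map C z n k)"
    proof (rule Ch.monoI[OF M(1)[OF kh]])
      fix W x assume x: "x \<in> Hom (Ch C) W (disk C z n (Dom C k))"
        and e: "disk_map C z n k \<cdot>\<^bsub>Ch C\<^esub> x = Zero (Ch C) W (disk C z n (Dom C f))"
      have "k \<cdot> Comps x (n - 1) = Zero C (Ob W (n - 1)) (Dom C f)"
        using arg_cong[OF e, of "\<lambda>F. Comps F (n - 1)"] M(3)[OF kh] by (simp add: disk_Ob)
      moreover have xn: "Comps x (n - 1) \<in> Hom C (Ob W (n - 1)) (Dom C k)"
        using Hom_ChD(5)[OF x, of "n - 1"] by (simp add: disk_Ob)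
      ultimately have "Comps x (n - 1) = Zero C (Ob W (n - 1)) (Dom C k)" using monoD0[OF mono kh] by blast
      then show "x = Zero (Ch C) W (disk C z n (Dom C k))"
        by (intro to_disk_eqI[OF x Ch.zero_hom[OF Ch.Hom_obj[OF x]]]) (simp add: disk_Ob)
    qed
    fix W x assume x: "x \<in> Hom (Ch C) W (disk C z n (Dom C f))"
      and e: "disk_map C z n f \<cdot>\<^bsub>Ch C\<^esub> x = Zero (Ch C) W (disk C z n (Cod C f))"
    have xn: "Comps x (n - 1) \<in> Hom C (Ob W (n - 1)) (Dom C f)"
      using Hom_ChD(5)[OF x, of "n - 1"] by (simp add: disk_Ob)
    have "f \<cdot> Comps x (n - 1) = Zero C (Ob W (n - 1)) (Cod C f)"
      using arg_cong[OF e, of "\<lambda>F. Comps F (n - 1)"] M(3)[OF f] by (simp add: disk_Ob)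
    then obtain u where u: "u \<in> Hom C (Ob W (n - 1)) (Dom C k)" "k \<cdot> u = Comps x (n - 1)"
      using kernel_lift[OF k f kh xn] by blast
    have U: "to_disk C z n (Dom C k) W u \<in> Hom (Ch C) W (disk C z n (Dom C k))"
      using to_disk_hom[OF Hom_ChD(3)[OF x] u(1)] .
    have "disk_map C z n k \<cdot>\<^bsub>Ch C\<^esub> to_disk C z n (Dom C k) W u = x"
      using u(2) M(3)[OF kh] by (intro to_disk_eqI[OF Ch.comp_hom[OF U M(1)[OF kh]] x]) (simp add: to_disk_def)
    then show "\<exists>u\<in>Hom (Ch C) W (disk C z n (Dom C k)). disk_map C z n k \<cdot>\<^bsub>Ch C\<^esub> u = x" using U by blast
  qed
next
  note M = disk_map_hom[where n = n]
  fix f q assume q: "is_cokernel C f q"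
  have f: "f \<in> Hom C (Dom C f) (Cod C f)" using q by (simp add: is_cokernel_def Hom_iff)
  note qh = cokernel_hom[OF q f] note epi = cokernel_epi[OF q]
  show "is_cokernel (Ch C) (disk_map C z n f) (disk_map C z n q)"
  proof (rule Ch.cokernelI[OF M(1)[OF f] M(1)[OF qh]])
    have o: "disk C z n (Dom C f) \<in> Obj (Ch C)" "disk C z n (Cod C q) \<in> Obj (Ch C)"
      using disk_obj Hom_obj[OF f] Hom_obj[OF qh] by simp_all
    show "disk_map C z n q \<cdot>\<^bsub>Ch C\<^esub> disk_map C z n f = Zero (Ch C) (disk C z n (Dom C f)) (disk C z n (Cod C q))"
      using M(2)[OF f] M(2)[OF qh] cokernel_zero[OF q f qh]
      by (intro from_disk_eqI[OF Ch.comp_hom[OF M(1)[OF f] M(1)[OF qh]] Ch.zero_hom[OF o]]) (simp add: disk_Ob)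
    show "epi_arr (Ch C) (disk_map C z n q)"
    proof (rule Ch.epiI[OF M(1)[OF qh]])
      fix W x assume x: "x \<in> Hom (Ch C) (disk C z n (Cod C q)) W"
        and e: "x \<cdot>\<^bsub>Ch C\<^esub> disk_map C z n q = Zero (Ch C) (disk C z n (Cod C f)) W"
      have "Comps x n \<cdot> q = Zero C (Cod C f) (Ob W n)"
        using arg_cong[OF e, of "\<lambda>F. Comps F n"] M(2)[OF qh] by (simp add: disk_Ob)
      moreover have xn: "Comps x n \<in> Hom C (Cod C q) (Ob W n)"
        using Hom_ChD(5)[OF x, of n] by (simp add: disk_Ob)
      ultimately have "Comps x n = Zero C (Cod C q) (Ob W n)" using epiD0[OF epi qh] by blast
      then show "x = Zero (Ch C) (disk C z n (Cod C q)) W"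
        by (intro from_disk_eqI[OF x Ch.zero_hom[OF Ch.Hom_obj[OF x]]]) (simp add: disk_Ob)
    qed
    fix W x assume x: "x \<in> Hom (Ch C) (disk C z n (Cod C f)) W"
      and e: "x \<cdot>\<^bsub>Ch C\<^esub> disk_map C z n f = Zero (Ch C) (disk C z n (Dom C f)) W"
    have xn: "Comps x n \<in> Hom C (Cod C f) (Ob W n)"
      using Hom_ChD(5)[OF x, of n] by (simp add: disk_Ob)
    have "Comps x n \<cdot> f = Zero C (Dom C f) (Ob W n)"
      using arg_cong[OF e, of "\<lambda>F. Comps F n"] M(2)[OF f] by (simp add: disk_Ob)
    then obtain u where u: "u \<in> Hom C (Cod C q) (Ob W n)" "u \<cdot> q = Comps x n"
      using cokernel_desc[OF q f qh xn] by blast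
    have U: "from_disk C z n (Cod C q) W u \<in> Hom (Ch C) (disk C z n (Cod C q)) W"
      using from_disk_hom[OF Hom_ChD(4)[OF x] u(1)] .
    have "from_disk C z n (Cod C q) W u \<cdot>\<^bsub>Ch C\<^esub> disk_map C z n q = x"
      using u(2) M(2)[OF qh] by (intro from_disk_eqI[OF Ch.comp_hom[OF M(1)[OF qh] U] x]) (simp add: from_disk_def)
    then show "\<exists>u\<in>Hom (Ch C) (disk C z n (Cod C q)) W. u \<cdot>\<^bsub>Ch C\<^esub> disk_map C z n q = x" using U by blast
  qed
qed

text \<open>Evaluation preserves kernels and cokernels because it has both a left and a right adjoint,
  given by disks.\<close>

lemma evaluation_functor: "exact_functor (Ch C) C (\<lambda>X. Ob X n) (\<lambda>F. Comps F n)"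
proof unfold_locales
  fix F K assume K: "is_kernel (Ch C) F K"
  define X Y Z where "X = Src F" and "Y = Tgt F" and "Z = Src K"
  have F: "F \<in> Hom (Ch C) X Y" using K unfolding X_def Y_def by (simp add: is_kernel_def Hom_iff)
  have Kh: "K \<in> Hom (Ch C) Z X" using Ch.kernel_hom[OF K F] unfolding Z_def by simp
  note f = Hom_ChD(5)[OF F, of n] and k = Hom_ChD(5)[OF Kh, of n]
  note mono = Ch.kernel_mono[OF K]
  show "is_kernel C (Comps F n) (Comps K n)"
  proof (rule kernelI[OF f k])
    show "Comps F n \<cdot> Comps K n = Zero C (Ob Z n) (Ob Y n)"
      using arg_cong[OF Ch.kernel_zero[OF K F Kh], of "\<lambda>F. Comps F n"] by simp
    show "mono_arr C (Comps K n)"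
    proof (rule monoI[OF k])
      fix t x assume x: "x \<in> Hom C t (Ob Z n)" "Comps K n \<cdot> x = Zero C t (Ob X n)"
      note U = from_disk_hom[OF Hom_ChD(3)[OF Kh] x(1)]
      have o: "disk C z n t \<in> Obj (Ch C)" "X \<in> Obj (Ch C)" using Ch.Hom_obj U Kh by blast+
      have "K \<cdot>\<^bsub>Ch C\<^esub> from_disk C z n t Z x = Zero (Ch C) (disk C z n t) X"
        using x(2) by (intro from_disk_eqI[OF Ch.comp_hom[OF U Kh] Ch.zero_hom[OF o]]) (simp add: from_disk_def disk_Ob)
      then have "from_disk C z n t Z x = Zero (Ch C) (disk C z n t) Z" using Ch.monoD0[OF mono Kh U] by blast
      then have "Comps (from_disk C z n t Z x) n = Comps (Zero (Ch C) (disk C z n t) Z) n" by (rule arg_cong)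
      then show "x = Zero C t (Ob Z n)" by (simp add: from_disk_def disk_Ob)
    qed
    fix t x assume x: "x \<in> Hom C t (Ob X n)" "Comps F n \<cdot> x = Zero C t (Ob Y n)"
    note U = from_disk_hom[OF Hom_ChD(3)[OF F] x(1)]
    have o: "disk C z n t \<in> Obj (Ch C)" "Y \<in> Obj (Ch C)" using Ch.Hom_obj U F by blast+
    have "F \<cdot>\<^bsub>Ch C\<^esub> from_disk C z n t X x = Zero (Ch C) (disk C z n t) Y"
      using x(2) by (intro from_disk_eqI[OF Ch.comp_hom[OF U F] Ch.zero_hom[OF o]]) (simp add: from_disk_def disk_Ob)
    then obtain V where V: "V \<in> Hom (Ch C) (disk C z n t) Z" "K \<cdot>\<^bsub>Ch C\<^esub> V = from_disk C z n t X x"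
      using Ch.kernel_lift[OF K F Kh U] by blast
    have "Comps K n \<cdot> Comps V n = x"
      using arg_cong[OF V(2), of "\<lambda>F. Comps F n"] by (simp add: from_disk_def)
    moreover have "Comps V n \<in> Hom C t (Ob Z n)" using Hom_ChD(5)[OF V(1), of n] by (simp add: disk_Ob)
    ultimately show "\<exists>u\<in>Hom C t (Ob Z n). Comps K n \<cdot> u = x" by blast
  qed
next
  fix F Q assume Q: "is_cokernel (Ch C) F Q"
  define X Y Z where "X = Src F" and "Y = Tgt F" and "Z = Tgt Q"
  have F: "F \<in> Hom (Ch C) X Y" using Q unfolding X_def Y_def by (simp add: is_cokernel_def Hom_iff)
  have Qh: "Q \<in> Hom (Ch C) Y Z" using Ch.cokernel_hom[OF Q F] unfolding Z_def by simp
  note f = Hom_ChD(5)[OF F, of n] and q = Hom_ChD(5)[OF Qh, of n]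
  note epi = Ch.cokernel_epi[OF Q]
  \<comment> \<open>The right adjoint of evaluation in degree \<open>n\<close> is the disk whose
    lower degree is \<open>n\<close>, hence the index \<open>n + 1\<close>.\<close>
  let ?d = "disk C z (n + 1)" and ?t = "to_disk C z (n + 1)"
  have T: "?t t W x \<in> Hom (Ch C) W (?d t)" if "is_chain_cpx C W" "x \<in> Hom C (Ob W n) t" for t W x
    using to_disk_hom[OF that(1), of x "n + 1" t] that(2) by simp
  have tn: "Comps (?t t W x) n = x" for t W x by (simp add: to_disk_def)
  have dn: "Ob (?d t) n = t" for t by (simp add: disk_Ob)
  have eqI: "G = H" if "G \<in> Hom (Ch C) W (?d t)" "H \<in> Hom (Ch C) W (?d t)" "Comps G n = Comps H n" for G H W t
    using to_disk_eqI[OF that(1,2)] that(3) by simp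
  show "is_cokernel C (Comps F n) (Comps Q n)"
  proof (rule cokernelI[OF f q])
    show "Comps Q n \<cdot> Comps F n = Zero C (Ob X n) (Ob Z n)"
      using arg_cong[OF Ch.cokernel_zero[OF Q F Qh], of "\<lambda>F. Comps F n"] by simp
    show "epi_arr C (Comps Q n)"
    proof (rule epiI[OF q])
      fix t x assume x: "x \<in> Hom C (Ob Z n) t" "x \<cdot> Comps Q n = Zero C (Ob Y n) t"
      note U = T[OF Hom_ChD(4)[OF Qh] x(1)]
      have o: "Y \<in> Obj (Ch C)" "?d t \<in> Obj (Ch C)" using Ch.Hom_obj U Qh by blast+
      have "?t t Z x \<cdot>\<^bsub>Ch C\<^esub> Q = Zero (Ch C) Y (?d t)"
        using x(2) by (intro eqI[OF Ch.comp_hom[OF Qh U] Ch.zero_hom[OF o]]) (simp add: tn dn)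
      then have "?t t Z x = Zero (Ch C) Z (?d t)" using Ch.epiD0[OF epi Qh U] by blast
      then have "Comps (?t t Z x) n = Comps (Zero (Ch C) Z (?d t)) n" by (rule arg_cong)
      then show "x = Zero C (Ob Z n) t" by (simp add: tn dn)
    qed
    fix t x assume x: "x \<in> Hom C (Ob Y n) t" "x \<cdot> Comps F n = Zero C (Ob X n) t"
    note U = T[OF Hom_ChD(4)[OF F] x(1)]
    have o: "X \<in> Obj (Ch C)" "?d t \<in> Obj (Ch C)" using Ch.Hom_obj U F by blast+
    have "?t t Y x \<cdot>\<^bsub>Ch C\<^esub> F = Zero (Ch C) X (?d t)"
      using x(2) by (intro eqI[OF Ch.comp_hom[OF F U] Ch.zero_hom[OF o]]) (simp add: tn dn)
    then obtain V where V: "V \<in> Hom (Ch C) Z (?d t)" "V \<cdot>\<^bsub>Ch C\<^esub> Q = ?t t Y x"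
      using Ch.cokernel_desc[OF Q F Qh U] by blast
    have "Comps V n \<cdot> Comps Q n = x"
      using arg_cong[OF V(2), of "\<lambda>F. Comps F n"] by (simp add: tn)
    moreover have "Comps V n \<in> Hom C (Ob Z n) t" using Hom_ChD(5)[OF V(1), of n] by (simp add: dn)
    ultimately show "\<exists>u\<in>Hom C (Ob Z n) t. u \<cdot> Comps Q n = x" by blast
  qed
qed (auto simp: Hom_ChD(5))

end

section \<open>The hom complex of a contractible complex\<close>

definition contraction :: "('o, 'm) cat \<Rightarrow> ('o, 'm) chain_cpx \<Rightarrow> (int \<Rightarrow> 'm) \<Rightarrow> bool" where
  "contraction C X s \<longleftrightarrow> (\<forall>k. s k \<in> Hom C (Ob X k) (Ob X (k + 1)) \<and>
     Add C (Diff X (k + 1) \<cdot>\<^bsub>C\<^esub> s k) (s (k - 1) \<cdot>\<^bsub>C\<^esub> Diff X k) = Ide C (Ob X k))"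

context preadditive_category
begin

lemma carrier_hom_cpx: "f \<in> carrier (hom_cpx C X Y m) \<longleftrightarrow> (\<forall>k. f k \<in> Hom C (Ob X k) (Ob Y (m + k)))"
  by (auto simp: hom_cpx_def)

lemma one_hom_cpx: "\<one>\<^bsub>hom_cpx C X Y m\<^esub> = (\<lambda>k. Zero C (Ob X k) (Ob Y (m + k)))"
  by (auto simp: hom_cpx_def)

lemma minus_neg:
  assumes a: "a \<in> Hom C x y" and b: "b \<in> Hom C x y"
  shows "a \<boxminus> (Zero C x y \<boxminus> b) = a \<boxplus> b"
proof -
  have z: "Zero C x y \<in> Hom C x y" using zero_hom Hom_obj a by blast
  note n = minus_hom[OF z b]
  have "a \<boxplus> b \<boxplus> (Zero C x y \<boxminus> b) = a"
    using add_assoc[OF a b n] add_comm[OF b n] minus_add[OF z b] add_zero_right[OF a] by simp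
  then show ?thesis using minus_eq_iff[OF a n add_hom[OF a b]] by simp
qed

text \<open>A normal form for the sign computations below: the target index \<open>m - 1 + k\<close>
  becomes \<open>m + k - 1\<close>, and the group inverse becomes subtraction.\<close>

lemma hom_diff_comps:
  assumes X: "is_chain_cpx C X" and Y: "is_chain_cpx C Y" and f: "\<And>k. f k \<in> Hom C (Ob X k) (Ob Y (m + k))"
  shows "Diff Y (m + k) \<cdot> f k \<in> Hom C (Ob X k) (Ob Y (m + k - 1))"
    and "f (k - 1) \<cdot> Diff X k \<in> Hom C (Ob X k) (Ob Y (m + k - 1))"
    and "hom_diff C X Y m f k =
      (if even m then Diff Y (m + k) \<cdot> f k \<boxminus> f (k - 1) \<cdot> Diff X k else Diff Y (m + k) \<cdot> f k \<boxplus> f (k - 1) \<cdot> Diff X k)"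
    and "hom_diff C X Y m f k \<in> Hom C (Ob X k) (Ob Y (m + k - 1))"
proof -
  show 1: "Diff Y (m + k) \<cdot> f k \<in> Hom C (Ob X k) (Ob Y (m + k - 1))"
    using comp_hom[OF f is_chain_cpxD(2)[OF Y]] .
  have "f (k - 1) \<in> Hom C (Ob X (k - 1)) (Ob Y (m + k - 1))" using f[of "k - 1"] by (simp add: add_diff_eq)
  then show 2: "f (k - 1) \<cdot> Diff X k \<in> Hom C (Ob X k) (Ob Y (m + k - 1))"
    using comp_hom is_chain_cpxD(2)[OF X] by blast
  have e: "m - 1 + k = m + k - 1" by simp
  show 3: "hom_diff C X Y m f k =
      (if even m then Diff Y (m + k) \<cdot> f k \<boxminus> f (k - 1) \<cdot> Diff X k else Diff Y (m + k) \<cdot> f k \<boxplus> f (k - 1) \<cdot> Diff X k)"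
    unfolding hom_diff_def Let_def e minus_arr_eq[OF 1] by simp
  show "hom_diff C X Y m f k \<in> Hom C (Ob X k) (Ob Y (m + k - 1))"
    unfolding 3 using add_hom[OF 1 2] minus_hom[OF 1 2] by simp
qed

lemma hom_diff_hom_diff:
  assumes X: "is_chain_cpx C X" and Y: "is_chain_cpx C Y" and f: "f \<in> carrier (hom_cpx C X Y (m + 1))"
  shows "hom_diff C X Y (m + 1) f \<in> carrier (hom_cpx C X Y m)"
    and "hom_diff C X Y m (hom_diff C X Y (m + 1) f) = \<one>\<^bsub>hom_cpx C X Y (m - 1)\<^esub>"
proof -
  note dX = is_chain_cpxD[OF X] and dY = is_chain_cpxD[OF Y]
  have f': "f k \<in> Hom C (Ob X k) (Ob Y (m + 1 + k))" for k using f unfolding carrier_hom_cpx by blast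
  note D = hom_diff_comps[OF X Y f']
  define g where "g = hom_diff C X Y (m + 1) f"
  have g: "g k \<in> Hom C (Ob X k) (Ob Y (m + k))" for k unfolding g_def using D(4)[of k] by (simp add: algebra_simps)
  then show "hom_diff C X Y (m + 1) f \<in> carrier (hom_cpx C X Y m)" unfolding carrier_hom_cpx g_def by blast
  note E = hom_diff_comps[OF X Y g]
  have "hom_diff C X Y m g k = Zero C (Ob X k) (Ob Y (m - 1 + k))" for k
  proof -
    define l r where "l = Diff Y (m + k + 1) \<cdot> f k" and "r = f (k - 1) \<cdot> Diff X k"
    define l' r' where "l' = Diff Y (m + k) \<cdot> f (k - 1)" and "r' = f (k - 2) \<cdot> Diff X (k - 1)"
    have fk: "f k \<in> Hom C (Ob X k) (Ob Y (m + k + 1))" "f (k - 1) \<in> Hom C (Ob X (k - 1)) (Ob Y (m + k))"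
      "f (k - 2) \<in> Hom C (Ob X (k - 2)) (Ob Y (m + k - 1))"
      using f'[of k] f'[of "k - 1"] f'[of "k - 2"] by (simp_all add: algebra_simps)
    have dk: "Diff Y (m + k + 1) \<in> Hom C (Ob Y (m + k + 1)) (Ob Y (m + k))"
      "Diff X (k - 1) \<in> Hom C (Ob X (k - 1)) (Ob X (k - 2))"
      using dY(2)[of "m + k + 1"] dX(2)[of "k - 1"] by simp_all
    note lr = comp_hom[OF fk(1) dk(1), folded l_def] comp_hom[OF dX(2) fk(2), folded r_def]
      comp_hom[OF fk(2) dY(2), folded l'_def] comp_hom[OF dk(2) fk(3), folded r'_def]
    have gk: "g k = (if even m then l \<boxplus> r else l \<boxminus> r)" "g (k - 1) = (if even m then l' \<boxplus> r' else l' \<boxminus> r')"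
      using D(3)[of k] D(3)[of "k - 1"] unfolding g_def l_def r_def l'_def r'_def by (simp_all add: algebra_simps)
    \<comment> \<open>Of the four terms of the double differential, two contain a squared
      differential and vanish. The other two both equal \<open>p\<close> and cancel, since
      \<open>m\<close> and \<open>m + 1\<close> have opposite parity.\<close>
    define p where "p = Diff Y (m + k) \<cdot> f (k - 1) \<cdot> Diff X k"
    have p: "p \<in> Hom C (Ob X k) (Ob Y (m + k - 1))"
      unfolding p_def using comp_hom[OF dX(2)[of k] lr(3)] unfolding l'_def .
    have 1: "Diff Y (m + k) \<cdot> l = Zero C (Ob X k) (Ob Y (m + k - 1))"
      using comp_assoc[OF fk(1) dk(1) dY(2)[of "m + k"]] dY(3)[of "m + k + 1"] comp_zero_left[OF fk(1) dY(1)]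
      unfolding l_def by simp
    have 2: "Diff Y (m + k) \<cdot> r = p" unfolding r_def p_def using comp_assoc[OF dX(2) fk(2) dY(2)] by simp
    have 3: "l' \<cdot> Diff X k = p" unfolding l'_def p_def ..
    have 4: "r' \<cdot> Diff X k = Zero C (Ob X k) (Ob Y (m + k - 1))"
      using comp_assoc[OF dX(2)[of k] dk(2) fk(3)] dX(3)[of k] comp_zero_right[OF fk(3) dX(1)] unfolding r'_def by simp
    have z: "Zero C (Ob X k) (Ob Y (m + k - 1)) \<in> Hom C (Ob X k) (Ob Y (m + k - 1))" using zero_hom dX dY by blast
    have e: "m - 1 + k = m + k - 1" by simp
    show ?thesis
    proof (cases "even m")
      case True
      then show ?thesis
        using E(3)[of k] gk comp_add_right[OF lr(1,2) dY(2)] comp_add_left[OF dX(2) lr(3,4)] 1 2 3 4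
          add_zero_left[OF p] add_zero_right[OF p] minus_self[OF p] unfolding e by simp
    next
      case False
      then show ?thesis
        using E(3)[of k] gk comp_minus_right[OF lr(1,2) dY(2)] comp_minus_left[OF dX(2) lr(3,4)] 1 2 3 4
          minus_zero[OF p] minus_add[OF z p] unfolding e by simp
    qed
  qed
  then show "hom_diff C X Y m (hom_diff C X Y (m + 1) f) = \<one>\<^bsub>hom_cpx C X Y (m - 1)\<^esub>"
    unfolding one_hom_cpx g_def by blast
qed

lemma hom_cpx_exactI:
  assumes X: "is_chain_cpx C X" and Y: "is_chain_cpx C Y"
    and ex: "\<And>m f. \<lbrakk>\<And>k. f k \<in> Hom C (Ob X k) (Ob Y (m + k));
       \<And>k. hom_diff C X Y m f k = Zero C (Ob X k) (Ob Y (m + k - 1))\<rbrakk> \<Longrightarrow>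
       \<exists>g. (\<forall>k. g k \<in> Hom C (Ob X k) (Ob Y (m + 1 + k))) \<and> (\<forall>k. hom_diff C X Y (m + 1) g k = f k)"
  shows "hom_cpx_exact C X Y"
  unfolding hom_cpx_exact_def
proof (intro allI equalityI subsetI)
  fix m f
  assume "f \<in> kernel (hom_cpx C X Y m) (hom_cpx C X Y (m - 1)) (hom_diff C X Y m)"
  then have f: "\<And>k. f k \<in> Hom C (Ob X k) (Ob Y (m + k))"
    and z: "hom_diff C X Y m f = (\<lambda>k. Zero C (Ob X k) (Ob Y (m - 1 + k)))"
    unfolding kernel_def carrier_hom_cpx one_hom_cpx by auto
  have "hom_diff C X Y m f k = Zero C (Ob X k) (Ob Y (m + k - 1))" for k
    using fun_cong[OF z, of k] by (simp add: algebra_simps)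
  then obtain g where "\<And>k. g k \<in> Hom C (Ob X k) (Ob Y (m + 1 + k))" "\<And>k. hom_diff C X Y (m + 1) g k = f k"
    using ex[of f m] f by blast
  then have "g \<in> carrier (hom_cpx C X Y (m + 1))" "f = hom_diff C X Y (m + 1) g" unfolding carrier_hom_cpx by auto
  then show "f \<in> hom_diff C X Y (m + 1) ` carrier (hom_cpx C X Y (m + 1))" by blast
next
  fix m f
  assume "f \<in> hom_diff C X Y (m + 1) ` carrier (hom_cpx C X Y (m + 1))"
  then show "f \<in> kernel (hom_cpx C X Y m) (hom_cpx C X Y (m - 1)) (hom_diff C X Y m)"
    unfolding kernel_def using hom_diff_hom_diff[OF X Y] by auto
qed

lemma hom_cpx_exact_source:
  assumes X: "is_chain_cpx C X" and Y: "is_chain_cpx C Y" and s: "contraction C X s"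
  shows "hom_cpx_exact C X Y"
proof (rule hom_cpx_exactI[OF X Y])
  note dX = is_chain_cpxD[OF X] and dY = is_chain_cpxD[OF Y]
  fix m f
  assume f: "\<And>k. f k \<in> Hom C (Ob X k) (Ob Y (m + k))"
    and z: "\<And>k. hom_diff C X Y m f k = Zero C (Ob X k) (Ob Y (m + k - 1))"
  note D = hom_diff_comps[OF X Y f]
  have sh: "s k \<in> Hom C (Ob X k) (Ob X (k + 1))"
    and si: "Diff X (k + 1) \<cdot> s k \<boxplus> s (k - 1) \<cdot> Diff X k = Ide C (Ob X k)" for k
    using s unfolding contraction_def by auto
  have f1: "f (k + 1) \<in> Hom C (Ob X (k + 1)) (Ob Y (m + 1 + k))" for k using f[of "k + 1"] by (simp add: algebra_simps)
  define h where "h k = f (k + 1) \<cdot> s k" for k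
  have h: "h k \<in> Hom C (Ob X k) (Ob Y (m + 1 + k))" for k unfolding h_def using comp_hom[OF sh f1] .
  have zh: "Zero C (Ob X k) (Ob Y l) \<in> Hom C (Ob X k) (Ob Y l)" for k l using zero_hom dX dY by blast
  \<comment> \<open>\<open>g = (-1)^m f s\<close>. Moving the differential of \<open>Y\<close> past
    the cycle \<open>f\<close> costs the sign \<open>(-1)^m\<close>, which this factor compensates,
    leaving \<open>f\<close> after the contraction identity.\<close>
  define g where "g k = (if even m then h k else Zero C (Ob X k) (Ob Y (m + 1 + k)) \<boxminus> h k)" for k
  have g: "g k \<in> Hom C (Ob X k) (Ob Y (m + 1 + k))" for k unfolding g_def using h minus_hom[OF zh h] by simp
  have "hom_diff C X Y (m + 1) g k = f k" for k
  proof -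
    have d1: "Diff X (k + 1) \<in> Hom C (Ob X (k + 1)) (Ob X k)" and s1: "s (k - 1) \<in> Hom C (Ob X (k - 1)) (Ob X k)"
      using dX(2)[of "k + 1"] sh[of "k - 1"] by simp_all
    have dY1: "Diff Y (m + 1 + k) \<in> Hom C (Ob Y (m + 1 + k)) (Ob Y (m + k))" using dY(2)[of "m + 1 + k"] by simp
    define a b where "a = f k \<cdot> Diff X (k + 1)" and "b = Diff Y (m + 1 + k) \<cdot> f (k + 1)"
    have ah: "a \<in> Hom C (Ob X (k + 1)) (Ob Y (m + k))" unfolding a_def using comp_hom[OF d1 f] .
    have bh: "b \<in> Hom C (Ob X (k + 1)) (Ob Y (m + k))" unfolding b_def using comp_hom[OF f1 dY1] .
    have hd: "hom_diff C X Y m f (k + 1) = (if even m then b \<boxminus> a else b \<boxplus> a)"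
      using D(3)[of "k + 1"] unfolding a_def b_def by (simp add: algebra_simps)
    have h1: "h (k - 1) \<in> Hom C (Ob X (k - 1)) (Ob Y (m + k))" using h[of "k - 1"] by (simp add: algebra_simps)
    have p: "Diff Y (m + 1 + k) \<cdot> h k = b \<cdot> s k" unfolding h_def b_def using comp_assoc[OF sh f1 dY1] by simp
    have q: "h (k - 1) \<cdot> Diff X k = f k \<cdot> (s (k - 1) \<cdot> Diff X k)"
      unfolding h_def using comp_assoc[OF dX(2) s1 f] by simp
    note qh = comp_hom[OF dX(2) h1]
    have tot: "a \<cdot> s k \<boxplus> h (k - 1) \<cdot> Diff X k = f k"
      unfolding q a_def using comp_assoc[OF sh d1 f] comp_add_right[OF comp_hom[OF sh d1] comp_hom[OF dX(2) s1] f]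
        si[of k] comp_ide_right[OF f] by simp
    note as = comp_hom[OF sh ah]
    have z1: "hom_diff C X Y m f (k + 1) = Zero C (Ob X (k + 1)) (Ob Y (m + k))" using z[of "k + 1"] by (simp add: algebra_simps)
    show ?thesis
    proof (cases "even m")
      case True
      then have "b = a" using z1 hd minus_eq_zero[OF bh ah] by simp
      then show ?thesis using hom_diff_comps(3)[OF X Y g, of k] True p tot unfolding g_def by simp
    next
      case False
      have "b = Zero C (Ob X (k + 1)) (Ob Y (m + k)) \<boxminus> a"
        using z1 hd False minus_eq_iff[OF zh ah bh] by simp
      then have bs: "b \<cdot> s k = Zero C (Ob X k) (Ob Y (m + k)) \<boxminus> a \<cdot> s k"
        using comp_minus_left[OF sh zh ah] comp_zero_left[OF sh dY(1)] by simp
      have gk: "g k = Zero C (Ob X k) (Ob Y (m + 1 + k)) \<boxminus> h k"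
        "g (k - 1) = Zero C (Ob X (k - 1)) (Ob Y (m + k)) \<boxminus> h (k - 1)"
        unfolding g_def using False by (simp_all add: algebra_simps)
      have 1: "Diff Y (m + 1 + k) \<cdot> g k = a \<cdot> s k"
        unfolding gk using comp_minus_right[OF zh h dY1] comp_zero_right[OF dY1 dX(1)] p bs
          minus_minus_self[OF zh as] by simp
      have 2: "g (k - 1) \<cdot> Diff X k = Zero C (Ob X k) (Ob Y (m + k)) \<boxminus> h (k - 1) \<cdot> Diff X k"
        unfolding gk using comp_minus_left[OF dX(2) zh h1] comp_zero_left[OF dX(2) dY(1)] by simp
      show ?thesis using hom_diff_comps(3)[OF X Y g, of k] False 1 2 minus_neg[OF as qh] tot by simp
    qed
  qed
  then show "\<exists>g. (\<forall>k. g k \<in> Hom C (Ob X k) (Ob Y (m + 1 + k))) \<and> (\<forall>k. hom_diff C X Y (m + 1) g k = f k)"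
    using g by blast
qed

lemma hom_cpx_exact_target:
  assumes X: "is_chain_cpx C X" and Y: "is_chain_cpx C Y" and s: "contraction C Y s"
  shows "hom_cpx_exact C X Y"
proof (rule hom_cpx_exactI[OF X Y])
  note dX = is_chain_cpxD[OF X] and dY = is_chain_cpxD[OF Y]
  fix m f
  assume f: "\<And>k. f k \<in> Hom C (Ob X k) (Ob Y (m + k))"
    and z: "\<And>k. hom_diff C X Y m f k = Zero C (Ob X k) (Ob Y (m + k - 1))"
  note D = hom_diff_comps[OF X Y f]
  have sh: "s k \<in> Hom C (Ob Y k) (Ob Y (k + 1))"
    and si: "Diff Y (k + 1) \<cdot> s k \<boxplus> s (k - 1) \<cdot> Diff Y k = Ide C (Ob Y k)" for k
    using s unfolding contraction_def by auto
  have zh: "Zero C (Ob X k) (Ob Y l) \<in> Hom C (Ob X k) (Ob Y l)" for k l using zero_hom dX dY by blast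
  define g where "g k = s (m + k) \<cdot> f k" for k
  have g: "g k \<in> Hom C (Ob X k) (Ob Y (m + 1 + k))" for k
    unfolding g_def using comp_hom[OF f sh, of k] by (simp add: algebra_simps)
  have "hom_diff C X Y (m + 1) g k = f k" for k
  proof -
    have f1: "f (k - 1) \<in> Hom C (Ob X (k - 1)) (Ob Y (m + k - 1))" using f[of "k - 1"] by (simp add: algebra_simps)
    have s1: "s (m + k - 1) \<in> Hom C (Ob Y (m + k - 1)) (Ob Y (m + k))" using sh[of "m + k - 1"] by simp
    have dY1: "Diff Y (m + 1 + k) \<in> Hom C (Ob Y (m + k + 1)) (Ob Y (m + k))"
      using dY(2)[of "m + 1 + k"] by (simp add: algebra_simps)
    define a b where "a = Diff Y (m + k) \<cdot> f k" and "b = f (k - 1) \<cdot> Diff X k"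
    have ah: "a \<in> Hom C (Ob X k) (Ob Y (m + k - 1))" unfolding a_def using comp_hom[OF f dY(2)] .
    have bh: "b \<in> Hom C (Ob X k) (Ob Y (m + k - 1))" unfolding b_def using comp_hom[OF dX(2) f1] .
    have hd: "(if even m then a \<boxminus> b else a \<boxplus> b) = Zero C (Ob X k) (Ob Y (m + k - 1))"
      using D(3)[of k] z[of k] unfolding a_def b_def by simp
    have p: "Diff Y (m + 1 + k) \<cdot> g k = (Diff Y (m + 1 + k) \<cdot> s (m + k)) \<cdot> f k"
      unfolding g_def using comp_assoc[OF f sh dY1] by simp
    have g1: "g (k - 1) = s (m + k - 1) \<cdot> f (k - 1)" unfolding g_def by (simp add: algebra_simps)
    have q: "g (k - 1) \<cdot> Diff X k = s (m + k - 1) \<cdot> b" unfolding g1 b_def using comp_assoc[OF dX(2) f1 s1] by simp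
    have e: "Diff Y (m + 1 + k) = Diff Y (m + k + 1)" by (simp add: algebra_simps)
    have tot: "Diff Y (m + 1 + k) \<cdot> g k \<boxplus> s (m + k - 1) \<cdot> a = f k"
      unfolding p a_def using comp_assoc[OF f dY(2) s1] si[of "m + k"]
        comp_add_left[OF f comp_hom[OF sh dY1] comp_hom[OF dY(2) s1]] comp_ide_left[OF f] e by simp
    have ph: "Diff Y (m + 1 + k) \<cdot> g k \<in> Hom C (Ob X k) (Ob Y (m + k))"
      unfolding p using comp_hom[OF f comp_hom[OF sh dY1]] .
    note sa = comp_hom[OF ah s1]
    show ?thesis
    proof (cases "even m")
      case True
      then have "a = b" using hd minus_eq_zero[OF ah bh] by simp
      then show ?thesis using hom_diff_comps(3)[OF X Y g, of k] True q tot by simp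
    next
      case False
      have "b = Zero C (Ob X k) (Ob Y (m + k - 1)) \<boxminus> a"
        using hd False minus_eq_iff[OF zh ah bh] add_comm[OF ah bh] by simp
      then have "s (m + k - 1) \<cdot> b = Zero C (Ob X k) (Ob Y (m + k)) \<boxminus> s (m + k - 1) \<cdot> a"
        using comp_minus_right[OF zh ah s1] comp_zero_right[OF s1 dX(1)] by simp
      then show ?thesis using hom_diff_comps(3)[OF X Y g, of k] False q minus_neg[OF ph sa] tot by simp
    qed
  qed
  then show "\<exists>g. (\<forall>k. g k \<in> Hom C (Ob X k) (Ob Y (m + 1 + k))) \<and> (\<forall>k. hom_diff C X Y (m + 1) g k = f k)"
    using g by blast
qed

end

context pointed_preadditive
begin

lemma disk_contraction:
  assumes a: "a \<in> Obj C"
  shows "\<exists>s. contraction C (disk C z n a) s"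
proof -
  let ?X = "disk C z n a"
  have o: "Ob ?X k \<in> Obj C" for k using a z_obj by (simp add: disk_Ob)
  \<comment> \<open>The contraction inverts the only nontrivial differential, sending degree
    \<open>n - 1\<close> back to degree \<open>n\<close>.\<close>
  define s where "s k = (if k = n - 1 then Ide C a else Zero C (Ob ?X k) (Ob ?X (k + 1)))" for k
  have s: "s k \<in> Hom C (Ob ?X k) (Ob ?X (k + 1))" for k
    using zero_hom[OF o o, of k "k + 1"] ide_hom[OF a] by (cases "k = n - 1") (simp_all add: s_def disk_Ob)
  note d = disk_Diff_hom[OF z_obj a, of n]
  have d': "Diff ?X (k + 1) \<in> Hom C (Ob ?X (k + 1)) (Ob ?X k)" and s': "s (k - 1) \<in> Hom C (Ob ?X (k - 1)) (Ob ?X k)" for k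
    using d[of "k + 1"] s[of "k - 1"] by simp_all
  have "Diff ?X (k + 1) \<cdot> s k \<boxplus> s (k - 1) \<cdot> Diff ?X k = Ide C (Ob ?X k)" for k
  proof -
    note i = ide_hom[OF a]
    note ds = comp_hom[OF s[of k] d'[of k]] and sd = comp_hom[OF d[of k] s'[of k]]
    consider "k = n" | "k = n - 1" | "Ob ?X k = z"
      by (cases "k = n"; cases "k = n - 1") (auto simp: disk_Ob)
    then show ?thesis
    proof cases
      case 1
      have "s k = Zero C (Ob ?X k) (Ob ?X (k + 1))" using 1 by (simp add: s_def)
      then have "Diff ?X (k + 1) \<cdot> s k = Zero C (Ob ?X k) (Ob ?X k)" using comp_zero_right[OF d' o] by simp
      moreover have "s (k - 1) \<cdot> Diff ?X k = Ide C a" using 1 comp_ide_left[OF i] by (simp add: s_def disk_Diff)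
      ultimately show ?thesis using add_zero_left[OF i] 1 by (simp add: disk_Ob)
    next
      case 2
      have "Diff ?X k = Zero C (Ob ?X k) (Ob ?X (k - 1))" using 2 by (simp add: disk_Diff)
      then have "s (k - 1) \<cdot> Diff ?X k = Zero C (Ob ?X k) (Ob ?X k)" using comp_zero_right[OF s' o] by simp
      moreover have "Diff ?X (k + 1) \<cdot> s k = Ide C a" using 2 comp_ide_left[OF i] by (simp add: s_def disk_Diff)
      ultimately show ?thesis using add_zero_right[OF i] 2 by (simp add: disk_Ob)
    next
      case 3
      then show ?thesis using zero_object_eq_to[OF zero] add_hom[OF ds sd] ide_hom[OF z_obj] by simp
    qed
  qed
  then show ?thesis unfolding contraction_def using s by blast
qed

end

section \<open>Transfer of cotorsion pairs\<close>

text \<open>A cycle \<open>x\<close> is the boundary of \<open>s x\<close>, so it lifts even without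
  passing to a cover.\<close>

lemma (in abelian_category) contraction_exact:
  assumes X: "is_chain_cpx C X" and s: "contraction C X s"
  shows "exact_cpx C X"
  unfolding exact_cpx_def
proof
  fix m
  note D = is_chain_cpxD[OF X]
  have d: "Diff X (m + 1) \<in> Hom C (Ob X (m + 1)) (Ob X m)" using D(2)[of "m + 1"] by simp
  have s: "s m \<in> Hom C (Ob X m) (Ob X (m + 1))" "s (m - 1) \<in> Hom C (Ob X (m - 1)) (Ob X m)"
    "Diff X (m + 1) \<cdot> s m \<boxplus> s (m - 1) \<cdot> Diff X m = Ide C (Ob X m)"
    using s[unfolded contraction_def, rule_format, of m] s[unfolded contraction_def, rule_format, of "m - 1"] by simp_all
  show "exact_at C (Diff X (m + 1)) (Diff X m)"
    unfolding exact_at_iff[OF d D(2)]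
  proof (intro conjI allI ballI impI)
    show "Diff X m \<cdot> Diff X (m + 1) = Zero C (Ob X (m + 1)) (Ob X (m - 1))" using D(3)[of "m + 1"] by simp
    fix t x assume x: "x \<in> Hom C t (Ob X m)" "Diff X m \<cdot> x = Zero C t (Ob X (m - 1))"
    have t: "t \<in> Obj C" using x Hom_obj by blast
    note sx = comp_hom[OF x(1) s(1)]
    have "Diff X (m + 1) \<cdot> (s m \<cdot> x) = (Diff X (m + 1) \<cdot> s m \<boxplus> s (m - 1) \<cdot> Diff X m) \<cdot> x"
      using comp_add_left[OF x(1) comp_hom[OF s(1) d] comp_hom[OF D(2) s(2)]] comp_assoc[OF x(1) s(1) d]
        comp_assoc[OF x(1) D(2) s(2)] x(2) comp_zero_right[OF s(2) t] add_zero_right[OF comp_hom[OF sx d]] by simp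
    also have "\<dots> = x \<cdot> Ide C t" using s(3) comp_ide_left[OF x(1)] comp_ide_right[OF x(1)] by simp
    finally show "covers C (Diff X (m + 1)) x"
      unfolding covers_iff[OF d x(1)] using sx ide_hom[OF t] epi_ide[OF t] by blast
  qed
qed

text \<open>The sequence of cycles Z_m \<rightarrow> X_m \<rightarrow> Z_(m-1): exactness in degree
  \<open>m - 1\<close> identifies the image of the differential with the chosen cycles
  there.\<close>

lemma (in abelian_category) tilde_class_ses:
  assumes X: "X \<in> tilde_class C A"
  obtains a f g c where "a \<in> A" "c \<in> A" "ses C a f (Ob X m) g c"
proof -
  have cx: "is_chain_cpx C X" and ex: "exact_cpx C X" using X unfolding tilde_class_def by auto
  note D = is_chain_cpxD[OF cx]
  obtain k where k: "is_kernel C (Diff X m) k" "Dom C k \<in> A" using X unfolding tilde_class_def by blast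
  obtain l where l: "is_kernel C (Diff X (m - 1)) l" "Dom C l \<in> A" using X unfolding tilde_class_def by blast
  have d: "Diff X (m - 1) \<in> Hom C (Ob X (m - 1)) (Ob X (m - 2))" using D(2)[of "m - 1"] by simp
  have "exact_at C (Diff X m) (Diff X (m - 1))" using ex[unfolded exact_cpx_def, rule_format, of "m - 1"] by simp
  then obtain l' q where "is_cokernel C (Diff X m) q" "is_kernel C q l'" "is_kernel C (Diff X (m - 1)) l'"
    unfolding exact_at_def is_image_def by blast
  then have im: "is_image C (Diff X m) l" unfolding is_image_def using kernel_swap[OF _ l(1)] by blast
  note I = image_epi[OF D(2) im]
  obtain e where e: "e \<in> Hom C (Ob X m) (Dom C l)" "epi_arr C e" "Diff X m = l \<cdot> e" using I(3) by blast
  note kh = kernel_hom[OF k(1) D(2)]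
  have "is_kernel C e k"
  proof (rule kernelI[OF e(1) kh kernel_mono[OF k(1)]])
    have "l \<cdot> (e \<cdot> k) = Zero C (Dom C k) (Ob X (m - 1))"
      using comp_assoc[OF kh e(1) I(1)] e(3) kernel_zero[OF k(1) D(2) kh] by simp
    then show "e \<cdot> k = Zero C (Dom C k) (Dom C l)" using monoD0[OF I(2,1) comp_hom[OF kh e(1)]] by blast
    fix t x assume x: "x \<in> Hom C t (Ob X m)" "e \<cdot> x = Zero C t (Dom C l)"
    have "Diff X m \<cdot> x = Zero C t (Ob X (m - 1))"
      using comp_assoc[OF x(1) e(1) I(1)] e(3) x(2) comp_zero_right[OF I(1) Hom_obj(1)[OF x(1)]] by simp
    then show "\<exists>u\<in>Hom C t (Dom C k). k \<cdot> u = x" using kernel_lift[OF k(1) D(2) kh x(1)] by blast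
  qed
  then have "ses C (Dom C k) k (Ob X m) e (Dom C l)" unfolding ses_def using kh e by blast
  then show ?thesis using that k(2) l(2) by blast
qed

locale pointed_abelian = abelian_category + pointed_preadditive
begin

sublocale disk1: exact_functor C "Ch C" "disk C z 1" "disk_map C z 1"
  by (rule disk_functor)

sublocale ev1: exact_functor "Ch C" C "\<lambda>X. Ob X 1" "\<lambda>F. Comps F 1"
  by (rule evaluation_functor)

lemma disk_Ext:
  assumes "a \<in> Obj C" "b \<in> Obj C" "is_singleton (Ext (Ch C) k (disk C z 1 a) (disk C z 1 b))"
  shows "is_singleton (Ext C k a b)"
proof (rule Ext_singleton_retract[OF disk_functor evaluation_functor _ _ assms])
  show "Ob (disk C z 1 x) 1 = x" for x by (simp add: disk_Ob)
  show "Comps (disk_map C z 1 f) 1 = f" if "f \<in> Arr C" for f using disk_map_hom(2)[OF Hom_Arr[OF that]] .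
qed

section \<open>Membership of disks in the classes of complexes\<close>

lemma zero_kernel_ide:
  assumes "a \<in> Obj C" "b \<in> Obj C"
  shows "is_kernel C (Zero C a b) (Ide C a)"
proof (rule kernelI[OF zero_hom[OF assms] ide_hom[OF assms(1)] mono_ide[OF assms(1)]])
  show "Zero C a b \<cdot> Ide C a = Zero C a b" using comp_ide_right[OF zero_hom[OF assms]] .
  show "\<exists>u\<in>Hom C t a. Ide C a \<cdot> u = x" if "x \<in> Hom C t a" for t x using that comp_ide_left by blast
qed

lemma ide_kernel_zero:
  assumes a: "a \<in> Obj C"
  shows "is_kernel C (Ide C a) (Zero C z a)"
proof (rule kernelI[OF ide_hom[OF a] zero_hom[OF z_obj a]])
  show "mono_arr C (Zero C z a)"
    by (rule monoI[OF zero_hom[OF z_obj a]]) (use zero_object_eq_to[OF zero] zero_hom z_obj Hom_obj in blast)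
  show "Ide C a \<cdot> Zero C z a = Zero C z a" using comp_ide_left[OF zero_hom[OF z_obj a]] .
  fix t x assume x: "x \<in> Hom C t a" "Ide C a \<cdot> x = Zero C t a"
  have t: "t \<in> Obj C" using x Hom_obj by blast
  show "\<exists>u\<in>Hom C t z. Zero C z a \<cdot> u = x"
    using zero_hom[OF t z_obj] comp_zero_left[OF zero_hom[OF t z_obj] a] x comp_ide_left[OF x(1)] by auto
qed

text \<open>The cycles of a disk are \<open>a\<close> in degree \<open>n - 1\<close> and zero in all
  other degrees, which is why \<open>z\<close> has to belong to \<open>A\<close>.\<close>

lemma disk_tilde_class:
  assumes A: "A \<subseteq> Obj C" and z: "z \<in> A" and a: "a \<in> A"
  shows "disk C z n a \<in> tilde_class C A"
proof -
  have ao: "a \<in> Obj C" using A a by blast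
  have "\<exists>k. is_kernel C (Diff (disk C z n a) m) k \<and> Dom C k \<in> A" for m
  proof (cases "m = n")
    case True
    then have "Diff (disk C z n a) m = Ide C a" by (simp add: disk_Diff)
    moreover have "Dom C (Zero C z a) = z" using zero_hom[OF z_obj ao] by (simp add: Hom_iff)
    ultimately show ?thesis using ide_kernel_zero[OF ao] z by metis
  next
    case False
    let ?o = "Ob (disk C z n a)"
    have o: "?o j \<in> A" for j using z a by (simp add: disk_Ob)
    have "Diff (disk C z n a) m = Zero C (?o m) (?o (m - 1))" using False by (simp add: disk_Diff)
    moreover have "Dom C (Ide C (?o m)) = ?o m" using ide_hom o A by (auto simp: Hom_iff)
    ultimately show ?thesis using zero_kernel_ide o A by (metis subsetD)
  qed
  moreover obtain s where "contraction C (disk C z n a) s" using disk_contraction[OF ao] by blast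
  ultimately show ?thesis
    unfolding tilde_class_def using disk_obj[OF ao] contraction_exact by simp
qed

text \<open>The cycles of the disk in degree \<open>0\<close> are \<open>a\<close>, up to the
  isomorphism between two kernels that closure of \<open>A\<close> absorbs.\<close>

lemma tilde_class_disk:
  assumes A: "object_class C A" and a: "a \<in> Obj C" and d: "disk C z 1 a \<in> tilde_class C A"
  shows "a \<in> A"
proof -
  obtain k where k: "is_kernel C (Diff (disk C z 1 a) 0) k" "Dom C k \<in> A" using d unfolding tilde_class_def by blast
  have "Diff (disk C z 1 a) 0 = Zero C a z" by (simp add: disk_Diff disk_Ob)
  then have "is_kernel C (Diff (disk C z 1 a) 0) (Ide C a)" using zero_kernel_ide[OF a z_obj] by simp
  then have "iso_objs C (Dom C k) (Dom C (Ide C a))" using kernels_iso k by blast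
  moreover have "Dom C (Ide C a) = a" using ide_hom[OF a] by (simp add: Hom_iff)
  ultimately show ?thesis using A k(2) a unfolding object_class_def by auto
qed

lemma disk_Ch_class:
  assumes "A \<subseteq> Obj C" "z \<in> A" "a \<in> A"
  shows "disk C z n a \<in> Ch_class C A"
  using assms disk_obj[of a n] unfolding Ch_class_def by (auto simp: disk_Ob)

lemma disk_Ch_acy_left:
  assumes A: "A \<subseteq> Obj C" "z \<in> A" "a \<in> A"
  shows "disk C z n a \<in> Ch_acy_left C A B"
proof -
  have a: "a \<in> Obj C" using A by blast
  obtain s where s: "contraction C (disk C z n a) s" using disk_contraction[OF a] by blast
  have "hom_cpx_exact C (disk C z n a) W" if "W \<in> tilde_class C B" for W
    using hom_cpx_exact_source[OF disk_obj[OF a] _ s] that unfolding tilde_class_def by simp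
  then show ?thesis unfolding Ch_acy_left_def using disk_Ch_class[OF A] by blast
qed

lemma disk_Ch_acy_right:
  assumes B: "B \<subseteq> Obj C" "z \<in> B" "b \<in> B"
  shows "disk C z n b \<in> Ch_acy_right C A B"
proof -
  have b: "b \<in> Obj C" using B by blast
  obtain s where s: "contraction C (disk C z n b) s" using disk_contraction[OF b] by blast
  have "hom_cpx_exact C W (disk C z n b)" if "W \<in> tilde_class C A" for W
    using hom_cpx_exact_target[OF _ disk_obj[OF b] s] that unfolding tilde_class_def by simp
  then show ?thesis unfolding Ch_acy_right_def using disk_Ch_class[OF B] by blast
qed

text \<open>The sequence of complexes is kept beside its degree 1 part: a splitting found in degree
  1 has to be carried back to the complexes.\<close>

lemma precover:
  assumes pair: "left_cotorsion_pair (Ch C) n \<X> \<Y>" and c: "c \<in> Obj C"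
  obtains f g where "short_exact (Ch C) f g" "g \<in> Hom (Ch C) (Dom (Ch C) g) (disk C z 1 c)" "Dom (Ch C) g \<in> \<X>"
    "Dom (Ch C) f \<in> finite_resol (Ch C) \<Y> (n - 1)"
    "ses C (Ob (Dom (Ch C) f) 1) (Comps f 1) (Ob (Dom (Ch C) g) 1) (Comps g 1) c"
proof -
  have "disk C z 1 c \<in> Obj (Ch C)" using disk_obj[OF c] by simp
  then obtain f g where fg: "short_exact (Ch C) f g" "Cod (Ch C) g = disk C z 1 c" "Dom (Ch C) g \<in> \<X>"
    "Dom (Ch C) f \<in> finite_resol (Ch C) \<Y> (n - 1)"
    using pair unfolding left_cotorsion_pair_def by blast
  have arr: "f \<in> Arr (Ch C)" "g \<in> Arr (Ch C)"
    using ev1.exact_bounded_arr[of "[f, g]"] fg(1) unfolding short_exact_def by auto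
  have s: "short_exact C (Comps f 1) (Comps g 1)" using ev1.F_short_exact[OF fg(1)] .
  have "ses C (Ob (Dom (Ch C) f) 1) (Comps f 1) (Ob (Dom (Ch C) g) 1) (Comps g 1) c"
    using s ev1.F_dom[OF arr(1)] ev1.F_dom[OF arr(2)] ev1.F_cod[OF arr(2)] fg(2)
    unfolding short_exact_iff by (simp add: disk_Ob)
  moreover have "g \<in> Hom (Ch C) (Dom (Ch C) g) (disk C z 1 c)" using Hom_Arr[OF arr(2)] fg(2) by simp
  ultimately show ?thesis using that fg by blast
qed

text \<open>Precovers show that the left class contains some complex, and the zero disk is a summand
  of it. This is the source of \<open>z\<close> in \<open>A\<close> for both pairs.\<close>

lemma disk_zero_left_class:
  assumes pair: "left_cotorsion_pair (Ch C) n \<X> \<Y>"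
  shows "disk C z 1 z \<in> \<X>"
proof -
  obtain f g where "g \<in> Hom (Ch C) (Dom (Ch C) g) (disk C z 1 z)" "Dom (Ch C) g \<in> \<X>"
    using precover[OF pair z_obj] by metis
  then obtain X where X: "X \<in> Obj (Ch C)" "X \<in> \<X>" using Ch.Hom_obj by blast
  have d: "zero_object (Ch C) (disk C z 1 z)" using disk1.F_zero_object[OF zero] .
  have "summand_closed (Ch C) \<X>" using pair unfolding left_cotorsion_pair_def by blast
  then show ?thesis
    unfolding summand_closed_def using Ch.zero_object_summand[OF d X(1)] X d unfolding zero_object_def by blast
qed

lemma summand_closed_transfer:
  assumes pair: "left_cotorsion_pair (Ch C) n \<X> \<Y>"
    and X: "\<And>a. a \<in> A \<Longrightarrow> disk C z 1 a \<in> \<X>"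
    and X': "\<And>a. \<lbrakk>a \<in> Obj C; disk C z 1 a \<in> \<X>\<rbrakk> \<Longrightarrow> a \<in> A"
  shows "summand_closed C A"
  unfolding summand_closed_def
proof (intro ballI impI; elim exE)
  fix s a b i j p q
  assume s: "s \<in> A" and o: "a \<in> Obj C" "b \<in> Obj C" and bp: "biproduct C s a b i j p q"
  have "summand_closed (Ch C) \<X>" using pair unfolding left_cotorsion_pair_def by blast
  then have "disk C z 1 a \<in> \<X>"
    unfolding summand_closed_def using disk1.F_biproduct[OF bp] X[OF s] disk1.F_obj[OF o(1)] disk1.F_obj[OF o(2)] by blast
  then show "a \<in> A" using X' o by blast
qed

lemma Ext_vanishes_transfer:
  assumes pair: "left_cotorsion_pair (Ch C) n \<X> \<Y>" and A: "A \<subseteq> Obj C" and B: "B \<subseteq> Obj C"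
    and X: "\<And>a. a \<in> A \<Longrightarrow> disk C z 1 a \<in> \<X>" and Y: "\<And>b. b \<in> B \<Longrightarrow> disk C z 1 b \<in> \<Y>"
    and i: "1 \<le> i" "i \<le> n"
  shows "Ext_vanishes C i A B"
proof -
  have "Ext_vanishes (Ch C) i \<X> \<Y>" using pair i unfolding left_cotorsion_pair_def by blast
  then show ?thesis unfolding Ext_vanishes_def using disk_Ext X Y A B by (meson subsetD)
qed

text \<open>An extension \<open>x\<close> of objects of \<open>A\<close> splits off the degree one part of a precover of its disk.
  By adjunction the section extends to the disk, which is thus a summand of a member of \<open>\<X>\<close>.\<close>

lemma extension_closed_left_class:
  assumes pair: "left_cotorsion_pair (Ch C) n \<X> \<Y>" and n: "1 \<le> n" and enough: "enough_injectives C"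
    and X': "\<And>a. \<lbrakk>a \<in> Obj C; disk C z 1 a \<in> \<X>\<rbrakk> \<Longrightarrow> a \<in> A"
    and B: "B \<subseteq> Obj C" and Y: "\<And>W. W \<in> \<Y> \<Longrightarrow> Ob W 1 \<in> B"
    and ext: "\<And>i. \<lbrakk>1 \<le> i; i \<le> n\<rbrakk> \<Longrightarrow> Ext_vanishes C i A B"
    and s: "ses C a f x g c" and a: "a \<in> A" and c: "c \<in> A"
  shows "x \<in> A"
proof -
  have x: "x \<in> Obj C" using sesD(1)[OF s] Hom_obj by blast
  obtain k h where kh: "short_exact (Ch C) k h" "h \<in> Hom (Ch C) (Dom (Ch C) h) (disk C z 1 x)" "Dom (Ch C) h \<in> \<X>"
    "Dom (Ch C) k \<in> finite_resol (Ch C) \<Y> (n - 1)"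
    "ses C (Ob (Dom (Ch C) k) 1) (Comps k 1) (Ob (Dom (Ch C) h) 1) (Comps h 1) x"
    by (rule precover[OF pair x])
  have "Ob (Dom (Ch C) k) 1 \<in> finite_resol C B (n - 1)" using ev1.F_finite_resol[OF kh(4)] Y by blast
  moreover have "ext_acyclic C A n Y" if "Y \<in> B" for Y
    using Ext_vanishing_acyclic[OF enough] ext B that unfolding Ext_vanishes_def by (meson subsetD)
  ultimately have "ext_acyclic C A 1 (Ob (Dom (Ch C) k) 1)" using finite_resol_acyclic[OF n] by blast
  then obtain J S f' g' where J: "injective_object C J" "ses C (Ob (Dom (Ch C) k) 1) f' J g' S" "\<forall>X\<in>A. lifts C X g'"
    by auto
  have "lifts C x g'" using lifts_extension[OF s J(2,1)] J(3) a c by blast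
  then obtain \<sigma> where \<sigma>: "\<sigma> \<in> Hom C x (Ob (Dom (Ch C) h) 1)" "Comps h 1 \<cdot> \<sigma> = Ide C x"
    using lifts_split[OF J(2,1) _ kh(5)] by blast
  let ?X = "Dom (Ch C) h" and ?d = "disk C z 1 x"
  have U: "from_disk C z 1 x ?X \<sigma> \<in> Hom (Ch C) ?d ?X"
    using from_disk_hom[OF _ \<sigma>(1)] Hom_ChD(3)[OF kh(2)] by blast
  have dob: "?d \<in> Obj (Ch C)" using disk_obj[OF x] by simp
  have sect: "h \<cdot>\<^bsub>Ch C\<^esub> from_disk C z 1 x ?X \<sigma> = Ide (Ch C) ?d"
    using \<sigma>(2) by (intro from_disk_eqI[OF Ch.comp_hom[OF U kh(2)] Ch.ide_hom[OF dob]]) (simp add: from_disk_def disk_Ob)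
  have "exact_at (Ch C) k h"
    using exact_bounded_exact_at[of "Ch C" "[k, h]" 0] kh(1) unfolding short_exact_def by simp
  then obtain l where l: "is_kernel (Ch C) h l" unfolding exact_at_def by blast
  note lh = Ch.kernel_hom[OF l kh(2)]
  obtain q where "biproduct (Ch C) ?X ?d (Dom (Ch C) l) (from_disk C z 1 x ?X \<sigma>) l h q"
    using Ch.split_kernel_biproduct[OF l lh kh(2) U sect] by blast
  moreover have "summand_closed (Ch C) \<X>" using pair unfolding left_cotorsion_pair_def by blast
  ultimately have "?d \<in> \<X>"
    unfolding summand_closed_def using kh(3) dob Ch.Hom_obj(1)[OF lh] by blast
  then show ?thesis using X' x by blast
qed

text \<open>What both pairs have in common: disks carry \<open>A\<close> and \<open>B\<close> into
  the two classes, membership of a disk is reflected to \<open>A\<close>, and degree 1 brings both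
  classes back.\<close>

lemma left_cotorsion_pair_transfer:
  assumes pair: "left_cotorsion_pair (Ch C) n \<X> \<Y>" and A: "A \<subseteq> Obj C" and B: "B \<subseteq> Obj C"
    and X: "\<And>a. a \<in> A \<Longrightarrow> disk C z 1 a \<in> \<X>" and Y: "\<And>b. b \<in> B \<Longrightarrow> disk C z 1 b \<in> \<Y>"
    and X': "\<And>a. \<lbrakk>a \<in> Obj C; disk C z 1 a \<in> \<X>\<rbrakk> \<Longrightarrow> a \<in> A"
    and X1: "\<And>W. W \<in> \<X> \<Longrightarrow> Ob W 1 \<in> A" and Y1: "\<And>W. W \<in> \<Y> \<Longrightarrow> Ob W 1 \<in> B"
  shows "left_cotorsion_pair C n A B"
  unfolding left_cotorsion_pair_def
proof (intro conjI allI impI ballI)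
  show "summand_closed C A" by (rule summand_closed_transfer[OF pair X X'])
  show "Ext_vanishes C i A B" if "1 \<le> i \<and> i \<le> n" for i
    using Ext_vanishes_transfer[OF pair A B X Y] that by blast
  fix c assume c: "c \<in> Obj C"
  obtain k h where kh: "Dom (Ch C) h \<in> \<X>" "Dom (Ch C) k \<in> finite_resol (Ch C) \<Y> (n - 1)"
    "ses C (Ob (Dom (Ch C) k) 1) (Comps k 1) (Ob (Dom (Ch C) h) 1) (Comps h 1) c"
    using precover[OF pair c] by metis
  have "Ob (Dom (Ch C) k) 1 \<in> finite_resol C B (n - 1)" using ev1.F_finite_resol[OF kh(2)] Y1 by blast
  moreover have "Ob (Dom (Ch C) h) 1 \<in> A" using X1 kh(1) .
  moreover have "Dom C (Comps k 1) = Ob (Dom (Ch C) k) 1" "Dom C (Comps h 1) = Ob (Dom (Ch C) h) 1"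
    "Cod C (Comps h 1) = c"
    using sesD(1,2)[OF kh(3)] unfolding Hom_iff by blast+
  ultimately show "\<exists>f g. short_exact C f g \<and> Cod C g = c \<and> Dom C g \<in> A \<and> Dom C f \<in> finite_resol C B (n - 1)"
    using ses_short_exact[OF kh(3)] by metis
qed

end

theorem theorem6p8:
  fixes C :: "('o, 'm) cat" and A B :: "'o set" and n :: nat
  assumes "n \<ge> 1"
    and "abelian_category C" and "enough_injectives C"
    and "object_class C A" and "object_class C B"
    and "Ext_vanishes C 1 A B"
    and "extension_closed C B"
    and "\<And>e. injective_object C e \<Longrightarrow> e \<in> B"
    and "left_cotorsion_pair (Ch C) n (Ch_acy_left C A B) (tilde_class C B) \<or>
         left_cotorsion_pair (Ch C) n (tilde_class C A) (Ch_acy_right C A B)"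
  shows "left_cotorsion_pair C n A B"
proof -
  interpret abelian_category C by fact
  obtain z where z: "zero_object C z" using ex_zero_object by blast
  interpret pointed_abelian C z by unfold_locales (rule z)
  have A: "A \<subseteq> Obj C" and B: "B \<subseteq> Obj C" using assms(4,5) unfolding object_class_def by auto
  \<comment> \<open>The zero object is injective, so the assumption on injective objects applies to
    it.\<close>
  have zB: "z \<in> B" using assms(8) injective_zero_object[OF z] by blast
  from assms(9) show ?thesis
  proof
    assume pair: "left_cotorsion_pair (Ch C) n (Ch_acy_left C A B) (tilde_class C B)"
    have X1: "Ob W 1 \<in> A" if "W \<in> Ch_acy_left C A B" for W
      using that unfolding Ch_acy_left_def Ch_class_def by blast
    then have X': "a \<in> A" if "disk C z 1 a \<in> Ch_acy_left C A B" for a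
      using that by (metis disk_Ob)
    have zA: "z \<in> A" using X' disk_zero_left_class[OF pair] by blast
    show ?thesis
    proof (rule left_cotorsion_pair_transfer[OF pair A B])
      fix W assume "W \<in> tilde_class C B"
      then obtain a f g c where ses: "a \<in> B" "c \<in> B" "ses C a f (Ob W 1) g c" by (rule tilde_class_ses)
      \<comment> \<open>\<open>W\<close> has degree 1 part an extension of two cycle objects, so
        closure of \<open>B\<close> under extensions is used here.\<close>
      have "Dom C f = a" "Cod C g = c" "Cod C f = Ob W 1" using sesD(1,2)[OF ses(3)] unfolding Hom_iff by blast+
      then show "Ob W 1 \<in> B"
        using assms(7) ses_short_exact[OF ses(3)] ses(1,2) unfolding extension_closed_def by metis
    qed (use X1 X' disk_Ch_acy_left[OF A zA] disk_tilde_class[OF B zB] in auto)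
  next
    assume pair: "left_cotorsion_pair (Ch C) n (tilde_class C A) (Ch_acy_right C A B)"
    note X' = tilde_class_disk[OF assms(4)]
    have zA: "z \<in> A" using X'[OF z_obj] disk_zero_left_class[OF pair] by blast
    note X = disk_tilde_class[OF A zA] and Y = disk_Ch_acy_right[OF B zB]
    have Y1: "Ob W 1 \<in> B" if "W \<in> Ch_acy_right C A B" for W
      using that unfolding Ch_acy_right_def Ch_class_def by blast
    note ext = Ext_vanishes_transfer[OF pair A B X Y]
    \<comment> \<open>The same extension of cycles as for \<open>B\<close> in the other case, but
      closure of \<open>A\<close> is derived from the pair itself, with the Ext vanishing
      \<open>ext\<close> just transferred.\<close>
    have X1: "Ob W 1 \<in> A" if W: "W \<in> tilde_class C A" for W
    proof -
      obtain a f g c where ses: "a \<in> A" "c \<in> A" "ses C a f (Ob W 1) g c"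
        using W by (rule tilde_class_ses)
      show ?thesis
        by (rule extension_closed_left_class[OF pair assms(1,3) X' B Y1 ext ses(3,1,2)])
    qed
    show ?thesis by (rule left_cotorsion_pair_transfer[OF pair A B X Y X' X1 Y1])
  qed
qed

end
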